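(* Let $G$ be a discrete countable infinite group. Let $\mathcal T=(C_n,F_{n-1})_{n=1}^\infty$ and $\widetilde{\mathcal T}=(\widetilde C_n,\widetilde F_{n-1})_{n=1}^\infty$ be two $(C,F)$-sequences in $G$, with associated $(C,F)$-spaces $X$ and $\widetilde X$ and Haar measures $\mu$ and $\widetilde\mu$. Assume $\mu(X\setminus X^G)=0$ and $\widetilde\mu(\widetilde X\setminus\widetilde X^G)=0$, and let $T=(T_g)_{g\in G}$ and $\widetilde T=(\widetilde T_g)_{g\in G}$ be the measure-preserving $(C,F)$-actions associated with $\mathcal T$ and $\widetilde{\mathcal T}$. Suppose that either $\max(\mu(X),\widetilde\mu(\widetilde X))<\infty$ or $\min(\mu(X),\widetilde\mu(\widetilde X))=\infty$. Then there exist a conull $T$-invariant Borel subset $X^\circ\subset X$ (contained in $X^G$, where $T$ is defined), a conull $\widetilde T$-invariant Borel subset $\widetilde X^\circ\subset\widetilde X$ (contained in $\widetilde X^G$), a Borel bijection $\phi:X^\circ\to\widetilde X^\circ$ and a number $c>0$ such that $$\widetilde\mu\circ\phi=c\cdot\mu\qquad\text{and}\qquad \phi(\{T_gx\mid g\in G\})=\{\widetilde T_g\phi(x)\mid g\in G\}\ \text{ for each } x\in X^\circ.$$ If $\max(\mu(X),\widetilde\mu(\widetilde X))<\infty$, then $c=\widetilde\mu(\widetilde X)/\mu(X)$. The objects $X^\circ$, $\widetilde X^\circ$ and $\phi$ are constructed explicitly in terms of $\mathcal T$ and $\widetilde{\mathcal T}$.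
   Context: A $(C,F)$-sequence in a countable discrete group $G$ is a sequence $\mathcal T=(C_n,F_{n-1})_{n=1}^\infty$ of pairs of finite subsets of $G$ with $\#F_0=1$ and $\#C_n>1$ for all $n\ge1$, such that for all $n\ge0$: $F_nC_{n+1}\subset F_{n+1}$, and $F_nc\cap F_nc'=\emptyset$ for distinct $c,c'\in C_{n+1}$. Put $X_n:=F_n\times C_{n+1}\times C_{n+2}\times\cdots$ with the product topology (a compact space). The map $(f_n,c_{n+1},c_{n+2},\dots)\mapsto(f_nc_{n+1},c_{n+2},\dots)$ is a continuous open embedding $X_n\to X_{n+1}$. The $(C,F)$-space $X$ associated with $\mathcal T$ is the topological inductive limit of $(X_n)_{n\ge0}$; it is a locally compact Cantor space, and we view $X=\bigcup_{n\ge0}X_n$ as an increasing union of compact open subsets. The Haar measure $\mu$ on $X$ is the unique $\sigma$-finite Radon measure whose restriction to each $X_n$ is $\nu_n\otimes\bigotimes_{k>n}\kappa_k$, where $\kappa_k$ is the uniform probability measure on $C_k$ and $\nu_n(\{f\})=1/\prod_{k=1}^n\#C_k$ for each $f\in F_n$ (so $\mu(X_0)=1$). For $g\in G$ let $X_n^g:=\{(f_n,c_{n+1},\dots)\in X_n\mid gf_n\in F_n\}$, $X^g:=\bigcup_{n\ge0}X_n^g$ and $X^G:=\bigcap_{g\in G}X^g$. For $x\in X^G$ and $g\in G$ choose $n$ with $x=(f_n,c_{n+1},\dots)\in X_n$ and $gf_n\in F_n$, and set $T_gx:=(gf_n,c_{n+1},\dots)\in X_n\subset X$. This gives a well-defined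 free continuous $G$-action $T=(T_g)_{g\in G}$ on $X^G$, preserving $\mu$. If $\mu(X\setminus X^G)=0$, then $(X,\mu,T)$ is called the measure-preserving $(C,F)$-action associated with $\mathcal T$. All objects associated with $\widetilde{\mathcal T}$ are defined in the same way and carry tildes. The identity $\widetilde\mu\circ\phi=c\cdot\mu$ means $\widetilde\mu(\phi(A))=c\,\mu(A)$ for every Borel $A\subset X^\circ$. "Explicitly in terms of $\mathcal T$ and $\widetilde{\mathcal T}$" is meant in a finite-stage sense: after enumerations of the finite parameter sets have been fixed, the subsets, injections and bijections entering each stage of the inductive construction are specified by finite searches. *)

theory Defs
  imports "HOL-Probability.Probability" "HOL-Algebra.Coset" "HOL-Library.Nat_Bijection"
begin

section \<open>\<open>(C,F)\<close>-sequences and their spaces\<close>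

text \<open>The sequence \<open>(C\<^sub>n, F\<^sub>n\<^sub>-\<^sub>1)\<close> for \<open>n \<ge> 1\<close> is given by two functions \<open>C\<close> and \<open>F\<close>;
  the value \<open>C 0\<close> is never used.\<close>

definition CF_sequence :: "('g, 'm) monoid_scheme \<Rightarrow> (nat \<Rightarrow> 'g set) \<Rightarrow> (nat \<Rightarrow> 'g set) \<Rightarrow> bool" where
  "CF_sequence G C F \<longleftrightarrow>
     (\<forall>n. finite (F n) \<and> F n \<subseteq> carrier G) \<and>
     (\<forall>n\<ge>1. finite (C n) \<and> C n \<subseteq> carrier G) \<and>
     card (F 0) = 1 \<and> (\<forall>n\<ge>1. card (C n) > 1) \<and>
     (\<forall>n. F n <#>\<^bsub>G\<^esub> C (Suc n) \<subseteq> F (Suc n)) \<and>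
     (\<forall>n. \<forall>c\<in>C (Suc n). \<forall>c'\<in>C (Suc n). c \<noteq> c' \<longrightarrow> (F n #>\<^bsub>G\<^esub> c) \<inter> (F n #>\<^bsub>G\<^esub> c') = {})"

text \<open>A point \<open>(f\<^sub>n, c\<^sub>n\<^sub>+\<^sub>1, c\<^sub>n\<^sub>+\<^sub>2, \<dots>)\<close> of \<open>X\<^sub>n\<close> is a pair \<open>(f, c)\<close> where the function \<open>c\<close> is
  indexed by \<open>k > n\<close>, and is \<open>undefined\<close> for \<open>k \<le> n\<close>.\<close>

definition CF_level :: "(nat \<Rightarrow> 'g set) \<Rightarrow> (nat \<Rightarrow> 'g set) \<Rightarrow> nat \<Rightarrow> ('g \<times> (nat \<Rightarrow> 'g)) set" where
  "CF_level C F n = F n \<times> (\<Pi>\<^sub>E k\<in>{n<..}. C k)"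

definition CF_level_topology ::
    "(nat \<Rightarrow> 'g set) \<Rightarrow> (nat \<Rightarrow> 'g set) \<Rightarrow> nat \<Rightarrow> ('g \<times> (nat \<Rightarrow> 'g)) topology" where
  "CF_level_topology C F n =
     prod_topology (discrete_topology (F n))
       (product_topology (\<lambda>k. discrete_topology (C k)) {n<..})"

fun CF_step :: "('g, 'm) monoid_scheme \<Rightarrow> nat \<times> 'g \<times> (nat \<Rightarrow> 'g) \<Rightarrow> nat \<times> 'g \<times> (nat \<Rightarrow> 'g)" where
  "CF_step G (n, f, c) = (Suc n, f \<otimes>\<^bsub>G\<^esub> c (Suc n), restrict c {Suc n<..})"

text \<open>The inductive limit of the embeddings \<open>X\<^sub>n \<rightarrow> X\<^sub>n\<^sub>+\<^sub>1\<close>: the quotient of the disjoint union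
  of all \<open>X\<^sub>n\<close>, where two points are identified if they have the same image in some \<open>X\<^sub>m\<close>.\<close>

definition CF_rel :: "('g, 'm) monoid_scheme \<Rightarrow> (nat \<Rightarrow> 'g set) \<Rightarrow> (nat \<Rightarrow> 'g set) \<Rightarrow>
    ((nat \<times> 'g \<times> (nat \<Rightarrow> 'g)) \<times> (nat \<times> 'g \<times> (nat \<Rightarrow> 'g))) set" where
  "CF_rel G C F =
     {(p, q). p \<in> Sigma UNIV (CF_level C F) \<and> q \<in> Sigma UNIV (CF_level C F) \<and>
        (\<exists>i j. (CF_step G ^^ i) p = (CF_step G ^^ j) q)}"

type_synonym 'g CF_point = "(nat \<times> 'g \<times> (nat \<Rightarrow> 'g)) set"

definition CF_space :: "('g, 'm) monoid_scheme \<Rightarrow> (nat \<Rightarrow> 'g set) \<Rightarrow> (nat \<Rightarrow> 'g set) \<Rightarrow> 'g CF_point set" where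
  "CF_space G C F = Sigma UNIV (CF_level C F) // CF_rel G C F"

definition CF_incl :: "('g, 'm) monoid_scheme \<Rightarrow> (nat \<Rightarrow> 'g set) \<Rightarrow> (nat \<Rightarrow> 'g set) \<Rightarrow> nat \<Rightarrow>
    'g \<times> (nat \<Rightarrow> 'g) \<Rightarrow> 'g CF_point" where
  "CF_incl G C F n z = CF_rel G C F `` {(n, z)}"

definition CF_topology :: "('g, 'm) monoid_scheme \<Rightarrow> (nat \<Rightarrow> 'g set) \<Rightarrow> (nat \<Rightarrow> 'g set) \<Rightarrow>
    'g CF_point topology" where
  "CF_topology G C F = topology (\<lambda>U. U \<subseteq> CF_space G C F \<and>
     (\<forall>n. openin (CF_level_topology C F n) {z \<in> CF_level C F n. CF_incl G C F n z \<in> U}))"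

lemma openin_CF_topology:
  "openin (CF_topology G C F) U \<longleftrightarrow> U \<subseteq> CF_space G C F \<and>
     (\<forall>n. openin (CF_level_topology C F n) {z \<in> CF_level C F n. CF_incl G C F n z \<in> U})"
proof -
  define P where "P = (\<lambda>U. U \<subseteq> CF_space G C F \<and>
     (\<forall>n. openin (CF_level_topology C F n) {z \<in> CF_level C F n. CF_incl G C F n z \<in> U}))"
  have "istopology P"
    unfolding istopology_def
  proof (intro conjI allI impI)
    fix S T assume *: "P S" "P T"
    have "{z \<in> CF_level C F n. CF_incl G C F n z \<in> S \<inter> T} =
        {z \<in> CF_level C F n. CF_incl G C F n z \<in> S} \<inter> {z \<in> CF_level C F n. CF_incl G C F n z \<in> T}" for n
      by auto
    with * show "P (S \<inter> T)"
      unfolding P_def by (simp add: openin_Int le_infI1)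
  next
    fix \<K> assume *: "\<forall>K\<in>\<K>. P K"
    have "{z \<in> CF_level C F n. CF_incl G C F n z \<in> \<Union>\<K>} =
        (\<Union>K\<in>\<K>. {z \<in> CF_level C F n. CF_incl G C F n z \<in> K})" for n
      by auto
    moreover have "openin (CF_level_topology C F n)
        (\<Union>K\<in>\<K>. {z \<in> CF_level C F n. CF_incl G C F n z \<in> K})" for n
      using * unfolding P_def by (intro openin_Union) auto
    moreover have "\<Union>\<K> \<subseteq> CF_space G C F"
      using * unfolding P_def by (intro Union_least) simp
    ultimately show "P (\<Union>\<K>)"
      unfolding P_def by simp
  qed
  then have "openin (topology P) = P"
    by (rule topology_inverse')
  then show ?thesis
    by (simp add: CF_topology_def P_def)
qed

definition CF_borel :: "('g, 'm) monoid_scheme \<Rightarrow> (nat \<Rightarrow> 'g set) \<Rightarrow> (nat \<Rightarrow> 'g set) \<Rightarrow>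
    'g CF_point measure" where
  "CF_borel G C F = sigma (CF_space G C F) {U. openin (CF_topology G C F) U}"


section \<open>The Haar measure\<close>

definition CF_level_measure ::
    "(nat \<Rightarrow> 'g set) \<Rightarrow> (nat \<Rightarrow> 'g set) \<Rightarrow> nat \<Rightarrow> ('g \<times> (nat \<Rightarrow> 'g)) measure" where
  "CF_level_measure C F n =
     point_measure (F n) (\<lambda>_. ennreal (1 / (\<Prod>k=1..n. real (card (C k)))))
       \<Otimes>\<^sub>M (\<Pi>\<^sub>M k\<in>{n<..}. uniform_count_measure (C k))"

text \<open>The images of the level measures in \<open>X\<close> increase with \<open>n\<close>, each being the restriction to
  \<open>X\<^sub>n\<close> of the next one; their supremum is the measure on \<open>X\<close> with the prescribed restriction
  to every \<open>X\<^sub>n\<close>.\<close>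

definition CF_haar :: "('g, 'm) monoid_scheme \<Rightarrow> (nat \<Rightarrow> 'g set) \<Rightarrow> (nat \<Rightarrow> 'g set) \<Rightarrow>
    'g CF_point measure" where
  "CF_haar G C F = (SUP n. distr (CF_level_measure C F n) (CF_borel G C F) (CF_incl G C F n))"


section \<open>The action\<close>

definition CF_dom :: "('g, 'm) monoid_scheme \<Rightarrow> (nat \<Rightarrow> 'g set) \<Rightarrow> (nat \<Rightarrow> 'g set) \<Rightarrow> 'g \<Rightarrow>
    'g CF_point set" where
  "CF_dom G C F g =
     (\<Union>n. CF_incl G C F n ` {(f, c). (f, c) \<in> CF_level C F n \<and> g \<otimes>\<^bsub>G\<^esub> f \<in> F n})"

definition CF_domain :: "('g, 'm) monoid_scheme \<Rightarrow> (nat \<Rightarrow> 'g set) \<Rightarrow> (nat \<Rightarrow> 'g set) \<Rightarrow>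
    'g CF_point set" where
  "CF_domain G C F = (\<Inter>g\<in>carrier G. CF_dom G C F g)"

definition CF_act :: "('g, 'm) monoid_scheme \<Rightarrow> (nat \<Rightarrow> 'g set) \<Rightarrow> (nat \<Rightarrow> 'g set) \<Rightarrow> 'g \<Rightarrow>
    'g CF_point \<Rightarrow> 'g CF_point" where
  "CF_act G C F g x =
     (THE y. \<exists>n f c. (f, c) \<in> CF_level C F n \<and> g \<otimes>\<^bsub>G\<^esub> f \<in> F n \<and>
        x = CF_incl G C F n (f, c) \<and> y = CF_incl G C F n (g \<otimes>\<^bsub>G\<^esub> f, c))"

definition CF_orbit :: "('g, 'm) monoid_scheme \<Rightarrow> (nat \<Rightarrow> 'g set) \<Rightarrow> (nat \<Rightarrow> 'g set) \<Rightarrow>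
    'g CF_point \<Rightarrow> 'g CF_point set" where
  "CF_orbit G C F x = {CF_act G C F g x | g. g \<in> carrier G}"

definition conull_invariant :: "('g, 'm) monoid_scheme \<Rightarrow> (nat \<Rightarrow> 'g set) \<Rightarrow> (nat \<Rightarrow> 'g set) \<Rightarrow>
    'g CF_point set \<Rightarrow> bool" where
  "conull_invariant G C F Y \<longleftrightarrow>
     Y \<subseteq> CF_domain G C F \<and> Y \<in> sets (CF_borel G C F) \<and>
     emeasure (CF_haar G C F) (CF_space G C F - Y) = 0 \<and>
     (\<forall>g\<in>carrier G. CF_act G C F g ` Y = Y)"


section \<open>Explicit constructions by finite searches\<close>

text \<open>Programs for the functions on \<open>nat\<close> that are recursive in two oracles \<open>\<alpha>\<close> and \<open>\<beta>\<close>.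
  Pairs are coded by \<^const>\<open>prod_encode\<close>. A \<open>Search\<close> tries \<open>0, 1, 2, \<dots>\<close> and has a value only
  if it stops after finitely many steps.\<close>

datatype program =
    Zero | Succ | First | Second | Query_left | Query_right
  | Tuple program program
  | Compose program program
  | Recurse program program
  | Search program

inductive evaluates :: "(nat \<Rightarrow> nat) \<Rightarrow> (nat \<Rightarrow> nat) \<Rightarrow> program \<Rightarrow> nat \<Rightarrow> nat \<Rightarrow> bool"
  for \<alpha> \<beta> :: "nat \<Rightarrow> nat" where
  "evaluates \<alpha> \<beta> Zero a 0"
| "evaluates \<alpha> \<beta> Succ a (Suc a)"
| "evaluates \<alpha> \<beta> First (prod_encode (a, b)) a"
| "evaluates \<alpha> \<beta> Second (prod_encode (a, b)) b"
| "evaluates \<alpha> \<beta> Query_left a (\<alpha> a)"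
| "evaluates \<alpha> \<beta> Query_right a (\<beta> a)"
| "evaluates \<alpha> \<beta> p a u \<Longrightarrow> evaluates \<alpha> \<beta> q a v \<Longrightarrow>
     evaluates \<alpha> \<beta> (Tuple p q) a (prod_encode (u, v))"
| "evaluates \<alpha> \<beta> q a u \<Longrightarrow> evaluates \<alpha> \<beta> p u v \<Longrightarrow> evaluates \<alpha> \<beta> (Compose p q) a v"
| "evaluates \<alpha> \<beta> p a v \<Longrightarrow> evaluates \<alpha> \<beta> (Recurse p q) (prod_encode (a, 0)) v"
| "evaluates \<alpha> \<beta> (Recurse p q) (prod_encode (a, n)) u \<Longrightarrow>
     evaluates \<alpha> \<beta> q (prod_encode (a, prod_encode (n, u))) v \<Longrightarrow>
     evaluates \<alpha> \<beta> (Recurse p q) (prod_encode (a, Suc n)) v"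
| "evaluates \<alpha> \<beta> p (prod_encode (a, n)) 0 \<Longrightarrow>
     (\<forall>i<n. \<exists>v. evaluates \<alpha> \<beta> p (prod_encode (a, i)) (Suc v)) \<Longrightarrow>
     evaluates \<alpha> \<beta> (Search p) a n"

definition CF_enumeration :: "(nat \<Rightarrow> 'g set) \<Rightarrow> (nat \<Rightarrow> 'g set) \<Rightarrow> (nat \<Rightarrow> 'g list) \<Rightarrow>
    (nat \<Rightarrow> 'g list) \<Rightarrow> bool" where
  "CF_enumeration C F cs fs \<longleftrightarrow>
     (\<forall>n\<ge>1. distinct (cs n) \<and> set (cs n) = C n) \<and> (\<forall>n. distinct (fs n) \<and> set (fs n) = F n)"

text \<open>The finite tables of the products \<open>F\<^sub>n \<times> C\<^sub>n\<^sub>+\<^sub>1 \<rightarrow> F\<^sub>n\<^sub>+\<^sub>1\<close> in terms of positions in the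
  enumerations. The value 0 marks positions that are out of range, so that the table also
  determines the cardinalities of \<open>F\<^sub>n\<close> and \<open>C\<^sub>n\<^sub>+\<^sub>1\<close>.\<close>

definition CF_table :: "('g, 'm) monoid_scheme \<Rightarrow> (nat \<Rightarrow> 'g list) \<Rightarrow> (nat \<Rightarrow> 'g list) \<Rightarrow> nat \<Rightarrow> nat" where
  "CF_table G cs fs a =
     (let (n, b) = prod_decode a; (i, j) = prod_decode b in
      if i < length (fs n) \<and> j < length (cs (Suc n))
      then Suc (LEAST k. k < length (fs (Suc n)) \<and> fs (Suc n) ! k = fs n ! i \<otimes>\<^bsub>G\<^esub> cs (Suc n) ! j)
      else 0)"

definition CF_cylinder :: "('g, 'm) monoid_scheme \<Rightarrow> (nat \<Rightarrow> 'g set) \<Rightarrow> (nat \<Rightarrow> 'g set) \<Rightarrow> nat \<Rightarrow> 'g \<Rightarrow>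
    'g CF_point set" where
  "CF_cylinder G C F n f = CF_incl G C F n ` ({f} \<times> (\<Pi>\<^sub>E k\<in>{n<..}. C k))"

text \<open>A stage of the construction is a triple \<open>(k, l, R)\<close> where \<open>R\<close> relates finitely many
  cylinders of level \<open>k\<close> in the first space (given by their positions in the enumeration of
  \<open>F\<^sub>k\<close>) to cylinders of level \<open>l\<close> in the second space.\<close>

definition stage_decode :: "nat \<Rightarrow> nat \<times> nat \<times> (nat \<times> nat) set" where
  "stage_decode s =
     (let (k, t) = prod_decode s; (l, r) = prod_decode t in (k, l, prod_decode ` set_decode r))"

text \<open>The points \<open>x\<close> and \<open>y\<close> are matched if all but finitely many stages relate a cylinder around
  \<open>x\<close> to a cylinder around \<open>y\<close>.\<close>

definition stages_match :: "('g, 'm) monoid_scheme \<Rightarrow>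
    (nat \<Rightarrow> 'g set) \<Rightarrow> (nat \<Rightarrow> 'g set) \<Rightarrow> (nat \<Rightarrow> 'g list) \<Rightarrow>
    (nat \<Rightarrow> 'g set) \<Rightarrow> (nat \<Rightarrow> 'g set) \<Rightarrow> (nat \<Rightarrow> 'g list) \<Rightarrow>
    (nat \<Rightarrow> nat) \<Rightarrow> 'g CF_point \<Rightarrow> 'g CF_point \<Rightarrow> bool" where
  "stages_match G C F fs C' F' fs' \<sigma> x y \<longleftrightarrow>
     (\<forall>\<^sub>F n in sequentially. case stage_decode (\<sigma> n) of (k, l, R) \<Rightarrow>
        \<exists>(i, j)\<in>R. x \<in> CF_cylinder G C F k (fs k ! i) \<and> y \<in> CF_cylinder G C' F' l (fs' l ! j))"

text \<open>Stages with even number are maps from finite subsets of \<open>F\<^sub>k\<close> to \<open>F'\<^sub>l\<close>, stages with odd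
  number are maps from finite subsets of \<open>F'\<^sub>l\<close> to \<open>F\<^sub>k\<close>. They are computed from the number of
  the stage and finitely many entries of the two tables. The map \<open>\<phi>\<close> and the sets \<open>Y\<close> and \<open>Y'\<close>
  are the graph, the domain and the range of the limit of the stages, inside of the sets on
  which the two actions are defined.\<close>

definition explicitly_constructed :: "program \<Rightarrow> ('g, 'm) monoid_scheme \<Rightarrow>
    (nat \<Rightarrow> 'g set) \<Rightarrow> (nat \<Rightarrow> 'g set) \<Rightarrow> (nat \<Rightarrow> 'g list) \<Rightarrow> (nat \<Rightarrow> 'g list) \<Rightarrow>
    (nat \<Rightarrow> 'g set) \<Rightarrow> (nat \<Rightarrow> 'g set) \<Rightarrow> (nat \<Rightarrow> 'g list) \<Rightarrow> (nat \<Rightarrow> 'g list) \<Rightarrow>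
    'g CF_point set \<Rightarrow> 'g CF_point set \<Rightarrow> ('g CF_point \<Rightarrow> 'g CF_point) \<Rightarrow> bool" where
  "explicitly_constructed p G C F cs fs C' F' cs' fs' Y Y' \<phi> \<longleftrightarrow>
     (\<exists>\<sigma>. (\<forall>n. evaluates (CF_table G cs fs) (CF_table G cs' fs') p n (\<sigma> n)) \<and>
        (\<forall>n. case stage_decode (\<sigma> n) of (k, l, R) \<Rightarrow>
           R \<subseteq> {..<length (fs k)} \<times> {..<length (fs' l)} \<and>
           (if even n then single_valued R else single_valued (R\<inverse>))) \<and>
        Y = {x \<in> CF_domain G C F. \<exists>y\<in>CF_domain G C' F'. stages_match G C F fs C' F' fs' \<sigma> x y} \<and>
        Y' = {y \<in> CF_domain G C' F'. \<exists>x\<in>CF_domain G C F. stages_match G C F fs C' F' fs' \<sigma> x y} \<and>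
        (\<forall>x\<in>Y. \<forall>y\<in>Y'. \<phi> x = y \<longleftrightarrow> stages_match G C F fs C' F' fs' \<sigma> x y))"

end

theory Submission
  imports Defs
begin

text \<open>On \<open>X\<^sup>G\<close> the orbits of the action are the classes of the tail relation: two points are
  equivalent iff they have representatives \<open>(f, c)\<close> and \<open>(f', c)\<close> in some \<open>X\<^sub>n\<close>. An orbit equivalence is
  therefore obtained by interlacing the two sequences of cylinder partitions. Along levels
  \<open>h\<^sub>0, h\<^sub>2, \<dots>\<close> of the second and \<open>h\<^sub>1, h\<^sub>3, \<dots>\<close> of the first space one builds injections
  \<open>\<iota>\<^sub>n : F(h\<^sub>n) \<times> {..<D\<^sub>n} \<rightarrow> F(h\<^sub>n\<^sub>+\<^sub>1)\<close> such that \<open>\<iota>\<^sub>n\<^sub>+\<^sub>1(\<iota>\<^sub>n(u, d), d')\<close> is the product of \<open>u\<close> and a word in the \<open>C\<^sub>k\<close> that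
  depends on \<open>d\<close> and \<open>d'\<close> only. Sequences with \<open>u\<^sub>n\<^sub>+\<^sub>1 = \<iota>\<^sub>n(u\<^sub>n, d\<^sub>n)\<close> are the addresses of pairs of matched
  points, and tail equivalence on both sides is eventual equality of the digits \<open>d\<^sub>n\<close>. If \<open>w\<^sub>n\<close> is
  the number of all words between \<open>h\<^sub>n\<close> and \<open>h\<^sub>n\<^sub>+\<^sub>2\<close>, then almost all points are matched as soon as
  \<open>\<Sum>(1 - D\<^sub>n D\<^sub>n\<^sub>+\<^sub>1 / w\<^sub>n) < \<infinity>\<close>. This holds if \<open>D\<^sub>n\<^sub>+\<^sub>1\<close> is chosen as large as the cardinalities allow, and
  the ratio of the measures of a set of matched points and of its image is constant because all
  cylinders of a level have the same measure.\<close>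

section \<open>Uniform computability\<close>

text \<open>Words stand on the right and the group acts on the left, so a translation changes
  \<open>f\<close> but no word. This is why the word in the condition on two consecutive injections
  may depend on the digits only: equal digits then mean a common translation on both sides at once.
  Each injection is forced on the image of its predecessor and free elsewhere. The forced part is
  injective if pairs of digits fit into the words, and it extends if the target level has enough
  room; these two bounds determine \<open>D\<close>. For infinite measure the level can be chosen so
  late that room is no restriction, and only rounding is lost. For finite measure room may restrict
  \<open>D\<close> at any stage, and the loss has to be paid from the growth of the masses, whose
  total is finite. The distinction is made outside of the programs: one bit selects between two of
  them. Explicitness adds a constraint of its own: all searches have to halt on every argument, also
  on numbers that code no state of the construction. The search conditions therefore carry premises
  that make them vacuous there.\<close>

type_synonym oracles = "(nat \<Rightarrow> nat) \<times> (nat \<Rightarrow> nat)"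

text \<open>A value is demanded at every argument, so totality is part of the notion. The set
  \<open>S\<close> lets a program rely on properties shared by all admissible oracle pairs.\<close>

definition computable :: "oracles set \<Rightarrow> (oracles \<Rightarrow> nat \<Rightarrow> nat) \<Rightarrow> bool" where
  "computable S f \<longleftrightarrow> (\<exists>p. \<forall>t\<in>S. \<forall>a. evaluates (fst t) (snd t) p a (f t a))"

definition decidable :: "oracles set \<Rightarrow> (oracles \<Rightarrow> nat \<Rightarrow> bool) \<Rightarrow> bool" where
  "decidable S P \<longleftrightarrow> computable S (\<lambda>t a. of_bool (P t a))"

abbreviation pair :: "nat \<Rightarrow> nat \<Rightarrow> nat" where
  "pair a b \<equiv> prod_encode (a, b)"

definition lt :: "nat \<Rightarrow> nat" where
  "lt a = fst (prod_decode a)"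

definition rt :: "nat \<Rightarrow> nat" where
  "rt a = snd (prod_decode a)"

lemma lt_pair [simp]: "lt (pair a b) = a" and rt_pair [simp]: "rt (pair a b) = b"
  by (simp_all add: lt_def rt_def)

lemma pair_lt_rt [simp]: "pair (lt a) (rt a) = a"
  by (simp add: lt_def rt_def)

named_theorems computable_intros

lemma computable_id [computable_intros]: "computable S (\<lambda>t a. a)"
proof -
  \<comment> \<open>The pairing code is onto, so taking a number apart and pairing again is an
    identity program.\<close>
  have "evaluates \<alpha> \<beta> (Tuple First Second) a a" for \<alpha> \<beta> :: "nat \<Rightarrow> nat" and a
    using evaluates.intros(7)[OF evaluates.intros(3) evaluates.intros(4), of \<alpha> \<beta> "lt a" "rt a"]
    by simp
  then show ?thesis
    unfolding computable_def by blast
qed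

lemma computable_compose:
  assumes "computable S f" and "computable S g"
  shows "computable S (\<lambda>t a. f t (g t a))"
proof -
  from assms obtain p q where
    "\<forall>t\<in>S. \<forall>a. evaluates (fst t) (snd t) p a (f t a)" "\<forall>t\<in>S. \<forall>a. evaluates (fst t) (snd t) q a (g t a)"
    unfolding computable_def by blast
  then have "\<forall>t\<in>S. \<forall>a. evaluates (fst t) (snd t) (Compose p q) a (f t (g t a))"
    using evaluates.intros(8) by blast
  then show ?thesis
    unfolding computable_def by blast
qed

lemma computable_Suc [computable_intros]:
  assumes "computable S f"
  shows "computable S (\<lambda>t a. Suc (f t a))"
proof -
  have "computable S (\<lambda>t a. Suc a)"
    unfolding computable_def using evaluates.intros(2) by blast
  from computable_compose[OF this assms] show ?thesis .
qed

lemma computable_lt [computable_intros]: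
  assumes "computable S f"
  shows "computable S (\<lambda>t a. lt (f t a))"
proof -
  have "evaluates \<alpha> \<beta> First a (lt a)" for \<alpha> \<beta> a
    using evaluates.intros(3)[of \<alpha> \<beta> "lt a" "rt a"] by simp
  then have "computable S (\<lambda>t a. lt a)"
    unfolding computable_def by blast
  from computable_compose[OF this assms] show ?thesis .
qed

lemma computable_rt [computable_intros]:
  assumes "computable S f"
  shows "computable S (\<lambda>t a. rt (f t a))"
proof -
  have "evaluates \<alpha> \<beta> Second a (rt a)" for \<alpha> \<beta> a
    using evaluates.intros(4)[of \<alpha> \<beta> "lt a" "rt a"] by simp
  then have "computable S (\<lambda>t a. rt a)"
    unfolding computable_def by blast
  from computable_compose[OF this assms] show ?thesis .
qed

lemma computable_oracles [computable_intros]: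
  assumes "computable S f"
  shows "computable S (\<lambda>t a. fst t (f t a))" "computable S (\<lambda>t a. snd t (f t a))"
proof -
  have "computable S (\<lambda>t a. fst t a)" "computable S (\<lambda>t a. snd t a)"
    unfolding computable_def using evaluates.intros(5,6) by blast+
  from this[THEN computable_compose, OF assms]
  show "computable S (\<lambda>t a. fst t (f t a))" "computable S (\<lambda>t a. snd t (f t a))" .
qed

lemma computable_pair [computable_intros]:
  assumes "computable S f" and "computable S g"
  shows "computable S (\<lambda>t a. pair (f t a) (g t a))"
proof -
  from assms obtain p q where
    "\<forall>t\<in>S. \<forall>a. evaluates (fst t) (snd t) p a (f t a)" "\<forall>t\<in>S. \<forall>a. evaluates (fst t) (snd t) q a (g t a)"
    unfolding computable_def by blast
  then have "\<forall>t\<in>S. \<forall>a. evaluates (fst t) (snd t) (Tuple p q) a (pair (f t a) (g t a))"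
    using evaluates.intros(7) by blast
  then show ?thesis
    unfolding computable_def by blast
qed

lemma computable_const [computable_intros]: "computable S (\<lambda>t a. k)"
proof (induction k)
  case 0
  show ?case
    unfolding computable_def using evaluates.intros(1) by blast
qed (rule computable_Suc)

text \<open>\<open>Recurse\<close> hands the code of \<open>(a, (n, u))\<close> to the step program.
  The hypothesis on \<open>g\<close> has this shape, so that the rule applies backwards to any
  \<open>rec_nat\<close> whose step mentions the argument \<open>a\<close>.\<close>

lemma computable_rec [computable_intros]:
  assumes f: "computable S f" and g: "computable S (\<lambda>t z. g t (lt z) (lt (rt z)) (rt (rt z)))"
    and N: "computable S N"
  shows "computable S (\<lambda>t a. rec_nat (f t a) (g t a) (N t a))"
proof -
  from f g obtain p q where
    p: "\<forall>t\<in>S. \<forall>a. evaluates (fst t) (snd t) p a (f t a)" and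
    q: "\<forall>t\<in>S. \<forall>z. evaluates (fst t) (snd t) q z (g t (lt z) (lt (rt z)) (rt (rt z)))"
    unfolding computable_def by blast
  have "evaluates (fst t) (snd t) (Recurse p q) (pair a n) (rec_nat (f t a) (g t a) n)"
    if "t \<in> S" for t a n
  proof (induction n)
    case 0
    show ?case
      using evaluates.intros(9) p that by simp
  next
    case (Suc n)
    have "evaluates (fst t) (snd t) q (pair a (pair n (rec_nat (f t a) (g t a) n)))
        (g t a n (rec_nat (f t a) (g t a) n))"
      using q[rule_format, OF that, of "pair a (pair n (rec_nat (f t a) (g t a) n))"] by simp
    from evaluates.intros(10)[OF Suc this] show ?case
      by simp
  qed
  then have "evaluates (fst t) (snd t) (Recurse p q) z (rec_nat (f t (lt z)) (g t (lt z)) (rt z))"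
    if "t \<in> S" for t z
    using that by (metis pair_lt_rt)
  then have "computable S (\<lambda>t z. rec_nat (f t (lt z)) (g t (lt z)) (rt z))"
    unfolding computable_def by blast
  from computable_compose[OF this computable_pair[OF computable_id N]] show ?thesis
    by simp
qed

lemma computable_pred: 
  assumes "computable S f"
  shows "computable S (\<lambda>t a. f t a - Suc 0)"
proof -
  have *: "n - Suc 0 = rec_nat 0 (\<lambda>i u. i) n" for n
    by (cases n) auto
  show ?thesis
    unfolding * by (intro computable_intros assms)
qed

lemma computable_plus [computable_intros]:
  assumes "computable S f" and "computable S g"
  shows "computable S (\<lambda>t a. f t a + g t a)"
proof -
  have *: "m + n = rec_nat m (\<lambda>i u. Suc u) n" for m n
    by (induction n) auto
  show ?thesis
    unfolding * by (intro computable_intros assms)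
qed

lemma computable_minus [computable_intros]:
  assumes "computable S f" and "computable S g"
  shows "computable S (\<lambda>t a. f t a - g t a)"
proof -
  have *: "m - n = rec_nat m (\<lambda>i u. u - Suc 0) n" for m n :: nat
    by (induction n) auto
  have "computable S (\<lambda>t a. rec_nat (f t a) (\<lambda>i u. u - Suc 0) (g t a))"
    by (intro computable_intros computable_pred assms)
  then show ?thesis
    by (simp only: *[symmetric])
qed

lemma computable_times [computable_intros]:
  assumes "computable S f" and "computable S g"
  shows "computable S (\<lambda>t a. f t a * g t a)"
proof -
  have *: "m * n = rec_nat 0 (\<lambda>i u. u + m) n" for m n :: nat
    by (induction n) auto
  show ?thesis
    unfolding * by (intro computable_intros assms computable_compose[OF assms(1) computable_lt[OF computable_id]])
qed

lemma computable_power [computable_intros]: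
  assumes "computable S f" and "computable S g"
  shows "computable S (\<lambda>t a. f t a ^ g t a)"
proof -
  have *: "m ^ n = rec_nat 1 (\<lambda>i u. m * u) n" for m n :: nat
    by (induction n) auto
  show ?thesis
    unfolding * by (intro computable_intros assms computable_compose[OF assms(1) computable_lt[OF computable_id]])
qed

lemma computable_sum [computable_intros]:
  assumes "computable S (\<lambda>t z. f t (lt z) (rt z))" and "computable S N"
  shows "computable S (\<lambda>t a. \<Sum>i<N t a. f t a i)"
proof -
  have *: "(\<Sum>i<n. h i) = rec_nat 0 (\<lambda>i u. u + h i) n" for h and n :: nat
    by (induction n) auto
  have "computable S (\<lambda>t z. f t (lt z) (lt (rt z)))"
    using computable_compose[OF assms(1) computable_pair[OF computable_lt computable_lt[OF computable_rt]],
        OF computable_id computable_id] by simp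
  then show ?thesis
    unfolding * by (intro computable_intros assms)
qed

lemma computable_prod [computable_intros]:
  assumes "computable S (\<lambda>t z. f t (lt z) (rt z))" and "computable S N"
  shows "computable S (\<lambda>t a. \<Prod>i<N t a. f t a i)"
proof -
  have *: "(\<Prod>i<n. h i) = rec_nat 1 (\<lambda>i u. u * h i) n" for h and n :: nat
    by (induction n) auto
  have "computable S (\<lambda>t z. f t (lt z) (lt (rt z)))"
    using computable_compose[OF assms(1) computable_pair[OF computable_lt computable_lt[OF computable_rt]],
        OF computable_id computable_id] by simp
  then show ?thesis
    unfolding * by (intro computable_intros assms)
qed

section \<open>Decidable predicates, bounded quantifiers and search\<close>

lemma decidable_not [computable_intros]:
  assumes "decidable S P"
  shows "decidable S (\<lambda>t a. \<not> P t a)"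
proof -
  have *: "of_bool (\<not> b) = (1::nat) - of_bool b" for b
    by simp
  show ?thesis
    using assms unfolding decidable_def * by (intro computable_intros)
qed

lemma decidable_conj [computable_intros]:
  assumes "decidable S P" and "decidable S Q"
  shows "decidable S (\<lambda>t a. P t a \<and> Q t a)"
  using assms unfolding decidable_def of_bool_conj by (intro computable_intros)

lemma decidable_disj [computable_intros]:
  assumes "decidable S P" and "decidable S Q"
  shows "decidable S (\<lambda>t a. P t a \<or> Q t a)"
proof -
  have "decidable S (\<lambda>t a. \<not> (\<not> P t a \<and> \<not> Q t a))"
    by (intro computable_intros assms)
  then show ?thesis
    by simp
qed

lemma decidable_imp [computable_intros]:
  assumes "decidable S P" and "decidable S Q"
  shows "decidable S (\<lambda>t a. P t a \<longrightarrow> Q t a)"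
  unfolding imp_conv_disj by (intro computable_intros assms)

lemma decidable_const [computable_intros]: "decidable S (\<lambda>t a. b)"
  unfolding decidable_def by (rule computable_const)

lemma decidable_le [computable_intros]:
  assumes "computable S f" and "computable S g"
  shows "decidable S (\<lambda>t a. f t a \<le> g t a)"
proof -
  have *: "of_bool (m \<le> n) = 1 - (m - n)" for m n :: nat
    by simp
  show ?thesis
    unfolding decidable_def * by (intro computable_intros assms)
qed

lemma decidable_less [computable_intros]:
  assumes "computable S f" and "computable S g"
  shows "decidable S (\<lambda>t a. f t a < g t a)"
  unfolding less_eq_Suc_le by (intro computable_intros assms)

lemma decidable_eq [computable_intros]:
  assumes "computable S f" and "computable S g"
  shows "decidable S (\<lambda>t a. f t a = g t a)"
  unfolding eq_iff by (intro computable_intros assms)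

text \<open>A bounded universal quantifier is the product of its truth values.\<close>

lemma decidable_all [computable_intros]:
  assumes "decidable S (\<lambda>t z. P t (lt z) (rt z))" and "computable S N"
  shows "decidable S (\<lambda>t a. \<forall>i<N t a. P t a i)"
proof -
  have "of_bool (\<forall>i<n. h i) = (\<Prod>i<n. of_bool (h i) :: nat)" for h and n :: nat
    by (induction n) (auto simp: less_Suc_eq)
  then show ?thesis
    using assms unfolding decidable_def by (simp add: computable_prod)
qed

text \<open>The branches are weighted by the truth value instead of being selected. Both get
  evaluated, which is harmless because both are total on \<open>S\<close>.\<close>

lemma computable_if [computable_intros]:
  assumes "decidable S P" and "computable S f" and "computable S g"
  shows "computable S (\<lambda>t a. if P t a then f t a else g t a)"
proof -
  have *: "(if b then m else n) = of_bool b * m + (1 - of_bool b) * n" for b and m n :: nat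
    by simp
  show ?thesis
    using assms unfolding decidable_def * by (intro computable_intros)
qed

text \<open>\<open>Search\<close> looks for a zero, hence the program for the negated predicate. The
  existence hypothesis covers every argument, since a search without a witness would leave the
  function partial.\<close>

lemma computable_Least:
  assumes P: "decidable S (\<lambda>t z. P t (lt z) (rt z))" and ex: "\<And>t a. t \<in> S \<Longrightarrow> \<exists>n. P t a n"
  shows "computable S (\<lambda>t a. LEAST n. P t a n)"
proof -
  have "decidable S (\<lambda>t z. \<not> P t (lt z) (rt z))"
    by (intro computable_intros P)
  then obtain p where p: "\<forall>t\<in>S. \<forall>z. evaluates (fst t) (snd t) p z (of_bool (\<not> P t (lt z) (rt z)))"
    unfolding decidable_def computable_def by blast
  have "evaluates (fst t) (snd t) (Search p) a (LEAST n. P t a n)" if t: "t \<in> S" for t a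
  proof (rule evaluates.intros(11))
    have *: "P t a (LEAST n. P t a n)"
      using ex[OF t] by (rule LeastI_ex)
    show "evaluates (fst t) (snd t) p (pair a (LEAST n. P t a n)) 0"
      using p[rule_format, OF t, of "pair a (LEAST n. P t a n)"] * by simp
    show "\<forall>i<LEAST n. P t a n. \<exists>v. evaluates (fst t) (snd t) p (pair a i) (Suc v)"
    proof (intro allI impI)
      fix i assume "i < (LEAST n. P t a n)"
      then have "\<not> P t a i"
        by (rule not_less_Least)
      then show "\<exists>v. evaluates (fst t) (snd t) p (pair a i) (Suc v)"
        using p[rule_format, OF t, of "pair a i"] by auto
    qed
  qed
  then show ?thesis
    unfolding computable_def by blast
qed

lemma computable_div [computable_intros]:
  assumes "computable S f" and "computable S g"
  shows "computable S (\<lambda>t a. f t a div g t a)"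
proof -
  \<comment> \<open>For \<open>n = 0\<close> the guard stops the search at 0, which is the value of
    \<open>m div 0\<close>.\<close>
  have *: "m div n = (LEAST q. n = 0 \<or> m < Suc q * n)" for m n :: nat
  proof (rule sym, rule Least_equality)
    show "n = 0 \<or> m < Suc (m div n) * n"
      using dividend_less_div_times[of n m] by (auto simp: add.commute)
    show "m div n \<le> y" if "n = 0 \<or> m < Suc y * n" for y
      using that less_mult_imp_div_less[of m "Suc y" n] by (cases "n = 0") (simp_all add: less_Suc_eq_le)
  qed
  have "\<exists>q. n = 0 \<or> m < Suc q * n" for m n :: nat
    by (cases n) (auto intro!: exI[of _ m])
  moreover have "computable S (\<lambda>t z. f t (lt z))" "computable S (\<lambda>t z. g t (lt z))"
    using assms[THEN computable_compose, OF computable_lt[OF computable_id]] .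
  ultimately show ?thesis
    unfolding * by (intro computable_Least computable_intros)
qed

lemma computable_mod [computable_intros]:
  assumes "computable S f" and "computable S g"
  shows "computable S (\<lambda>t a. f t a mod g t a)"
  unfolding minus_div_mult_eq_mod[symmetric] by (intro computable_intros assms)

lemma computable_min [computable_intros]:
  assumes "computable S f" and "computable S g"
  shows "computable S (\<lambda>t a. min (f t a) (g t a))"
  unfolding min_def by (intro computable_intros assms)

lemma decidable_even [computable_intros]:
  assumes "computable S f"
  shows "decidable S (\<lambda>t a. even (f t a))"
  unfolding even_iff_mod_2_eq_zero by (intro computable_intros assms)

section \<open>Tables of products\<close>

text \<open>Tables mark positions out of range by 0. Column 0 is in range because \<open>C\<close>
  is nonempty, so the first zero in it is the cardinality of \<open>F n\<close>.\<close>

definition num_F :: "(nat \<Rightarrow> nat) \<Rightarrow> nat \<Rightarrow> nat" where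
  "num_F \<alpha> n = (LEAST i. \<alpha> (pair n (pair i 0)) = 0)"

text \<open>Index shift: this is the cardinality of \<open>C (Suc n)\<close>, the set that leads
  from level \<open>n\<close> to level \<open>n + 1\<close>.\<close>

definition num_C :: "(nat \<Rightarrow> nat) \<Rightarrow> nat \<Rightarrow> nat" where
  "num_C \<alpha> n = (LEAST j. \<alpha> (pair n (pair 0 j)) = 0)"

text \<open>The subtraction undoes the \<open>Suc\<close> by which tables keep the value 0 free as a
  mark.\<close>

definition mult_pos :: "(nat \<Rightarrow> nat) \<Rightarrow> nat \<Rightarrow> nat \<Rightarrow> nat \<Rightarrow> nat" where
  "mult_pos \<alpha> n i j = \<alpha> (pair n (pair i j)) - 1"

text \<open>The words \<open>c\<^sub>L\<^sub>+\<^sub>1 \<dots> c\<^sub>L\<^sub>+\<^sub>t\<close> are numbered by the numbers below \<open>num_words \<alpha> L t\<close> in mixed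
  radix notation; \<open>extend \<alpha> L t i b\<close> is the position in \<open>F\<^sub>L\<^sub>+\<^sub>t\<close> of the product of the \<open>i\<close>-th element
  of \<open>F\<^sub>L\<close> and the \<open>b\<close>-th word.\<close>

definition num_words :: "(nat \<Rightarrow> nat) \<Rightarrow> nat \<Rightarrow> nat \<Rightarrow> nat" where
  "num_words \<alpha> L t = (\<Prod>i<t. num_C \<alpha> (L + i))"

definition extend :: "(nat \<Rightarrow> nat) \<Rightarrow> nat \<Rightarrow> nat \<Rightarrow> nat \<Rightarrow> nat \<Rightarrow> nat" where
  "extend \<alpha> L t i b =
     rec_nat i (\<lambda>k u. mult_pos \<alpha> (L + k) u (b div num_words \<alpha> L k mod num_C \<alpha> (L + k))) t"

lemma extend_0 [simp]: "extend \<alpha> L 0 i b = i"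
  and extend_Suc: "extend \<alpha> L (Suc t) i b =
    mult_pos \<alpha> (L + t) (extend \<alpha> L t i b) (b div num_words \<alpha> L t mod num_C \<alpha> (L + t))"
  by (simp_all add: extend_def)

lemma num_words_0 [simp]: "num_words \<alpha> L 0 = 1"
  and num_words_Suc: "num_words \<alpha> L (Suc t) = num_words \<alpha> L t * num_C \<alpha> (L + t)"
  by (simp_all add: num_words_def)

lemma num_words_add: "num_words \<alpha> L (s + t) = num_words \<alpha> L s * num_words \<alpha> (L + s) t"
  by (induction t) (simp_all add: num_words_Suc add.assoc)

text \<open>Only the first \<open>t\<close> mixed radix digits of \<open>b\<close> are read, and the
  residue determines them. This allows a digit to be put on top of a number without disturbing the
  word below it.\<close>

lemma extend_cong: "b mod num_words \<alpha> L t = b' mod num_words \<alpha> L t \<Longrightarrow> extend \<alpha> L t i b = extend \<alpha> L t i b'"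
proof (induction t)
  case (Suc t)
  let ?P = "num_words \<alpha> L t" and ?c = "num_C \<alpha> (L + t)"
  have eq: "?P * (b div ?P mod ?c) + b mod ?P = ?P * (b' div ?P mod ?c) + b' mod ?P"
    using Suc.prems by (simp add: num_words_Suc mod_mult2_eq)
  have 1: "b mod ?P = b' mod ?P"
    using arg_cong[OF eq, of "\<lambda>x. x mod ?P"] by simp
  with eq have 2: "?P = 0 \<or> b div ?P mod ?c = b' div ?P mod ?c"
    by auto
  from 1 2 have "b div ?P mod ?c = b' div ?P mod ?c"
    by (cases "?P = 0") auto
  then show ?case
    using Suc.IH[OF 1] by (simp add: extend_Suc)
qed simp

text \<open>The axioms of a \<open>(C,F)\<close>-sequence with the group removed. Injectivity of the
  product on positions combines the disjointness of the translates of \<open>F n\<close> with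
  cancellation in the group.\<close>

locale valid_table =
  fixes \<alpha> :: "nat \<Rightarrow> nat"
  assumes zero_F: "\<exists>i. \<alpha> (pair n (pair i 0)) = 0"
    and zero_C: "\<exists>j. \<alpha> (pair n (pair 0 j)) = 0"
    and num_F_0: "num_F \<alpha> 0 = 1"
    and num_C_ge: "2 \<le> num_C \<alpha> n"
    and mult_pos_less: "i < num_F \<alpha> n \<Longrightarrow> j < num_C \<alpha> n \<Longrightarrow> mult_pos \<alpha> n i j < num_F \<alpha> (Suc n)"
    and mult_pos_inj: "i < num_F \<alpha> n \<Longrightarrow> j < num_C \<alpha> n \<Longrightarrow> i' < num_F \<alpha> n \<Longrightarrow> j' < num_C \<alpha> n \<Longrightarrow>
      mult_pos \<alpha> n i j = mult_pos \<alpha> n i' j' \<Longrightarrow> i = i' \<and> j = j'"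
begin

lemma num_C_pos [simp]: "0 < num_C \<alpha> n"
  using num_C_ge[of n] by linarith

lemma num_words_pos [simp]: "0 < num_words \<alpha> L t"
  by (simp add: num_words_def)

lemma num_words_neq_0 [simp]: "num_words \<alpha> L t \<noteq> 0"
  by simp

lemma num_words_ge: "2 ^ t \<le> num_words \<alpha> L t"
proof (induction t)
  case (Suc t)
  show ?case
    using mult_le_mono[OF Suc num_C_ge[of "L + t"]] by (simp add: num_words_Suc mult.commute)
qed simp

lemma num_words_mono: "s \<le> t \<Longrightarrow> num_words \<alpha> L s \<le> num_words \<alpha> L t"
  using num_words_add[of \<alpha> L s "t - s"] by (simp add: Suc_leI)

lemma extend_less: "i < num_F \<alpha> L \<Longrightarrow> extend \<alpha> L t i b < num_F \<alpha> (L + t)"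
  by (induction t) (simp_all add: extend_Suc mult_pos_less)

text \<open>The last letter is peeled off by \<open>mult_pos_inj\<close>; it is the top digit of
  \<open>b\<close>, and the induction hypothesis handles the rest.\<close>

lemma extend_inj:
  assumes "i < num_F \<alpha> L" "i' < num_F \<alpha> L" "b < num_words \<alpha> L t" "b' < num_words \<alpha> L t"
    and "extend \<alpha> L t i b = extend \<alpha> L t i' b'"
  shows "i = i' \<and> b = b'"
  using assms(3-)
proof (induction t arbitrary: b b')
  case (Suc t)
  let ?P = "num_words \<alpha> L t" and ?c = "num_C \<alpha> (L + t)"
  have *: "extend \<alpha> L t i b = extend \<alpha> L t i' b' \<and> b div ?P mod ?c = b' div ?P mod ?c"
    using Suc.prems(3) assms(1,2) by (intro mult_pos_inj) (simp_all add: extend_Suc extend_less)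
  have "b div ?P < ?c" "b' div ?P < ?c"
    using Suc.prems(1,2) by (simp_all add: num_words_Suc less_mult_imp_div_less mult.commute)
  with * have 1: "b div ?P = b' div ?P"
    by simp
  \<comment> \<open>Reduction modulo \<open>?P\<close> brings the numbers into the range of the
    induction hypothesis and leaves the words unchanged.\<close>
  have "extend \<alpha> L t i (b mod ?P) = extend \<alpha> L t i' (b' mod ?P)"
    using * extend_cong[of "b mod ?P" \<alpha> L t b i] extend_cong[of "b' mod ?P" \<alpha> L t b' i'] by simp
  then have 2: "i = i' \<and> b mod ?P = b' mod ?P"
    by (intro Suc.IH) simp_all
  with 1 show ?case
    by (metis div_mult_mod_eq)
qed simp

lemma num_F_mult_le: "num_F \<alpha> L * num_words \<alpha> L t \<le> num_F \<alpha> (L + t)"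
proof -
  have "inj_on (\<lambda>(i, b). extend \<alpha> L t i b) ({..<num_F \<alpha> L} \<times> {..<num_words \<alpha> L t})"
    using extend_inj by (fastforce intro!: inj_onI)
  then have "card ({..<num_F \<alpha> L} \<times> {..<num_words \<alpha> L t}) \<le> card {..<num_F \<alpha> (L + t)}"
    by (rule card_inj_on_le) (auto intro: extend_less)
  then show ?thesis
    by (simp add: card_cartesian_product)
qed

lemma num_F_ge: "num_words \<alpha> 0 n \<le> num_F \<alpha> n"
  using num_F_mult_le[of 0 n] by (simp add: num_F_0)

lemma num_F_pos [simp]: "0 < num_F \<alpha> n"
  using num_F_ge[of n] num_words_pos[of 0 n] by linarith

text \<open>The Haar measure of \<open>X_n\<close>: each of its \<open>num_F \<alpha> n\<close>
  cylinders has measure \<open>1 / num_words \<alpha> 0 n\<close>.\<close>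

definition mass :: "nat \<Rightarrow> real" where
  "mass n = num_F \<alpha> n / num_words \<alpha> 0 n"

text \<open>The left side is the fraction of the cylinders of level \<open>L + t\<close> that lie in
  \<open>X_L\<close>.\<close>

lemma mass_step: "num_F \<alpha> L * num_words \<alpha> L t / num_F \<alpha> (L + t) = mass L / mass (L + t)"
  by (simp add: mass_def num_words_add field_simps)

lemma mass_mono: "L \<le> L' \<Longrightarrow> mass L \<le> mass L'"
proof -
  assume "L \<le> L'"
  then obtain t where t: "L' = L + t"
    using le_Suc_ex by blast
  have "real (num_F \<alpha> L) * real (num_words \<alpha> L t) \<le> real (num_F \<alpha> (L + t))"
    using num_F_mult_le[of L t] by (metis of_nat_le_iff of_nat_mult)
  then show ?thesis
    using num_words_pos[of 0 L] num_words_pos[of L t] by (simp add: t mass_def num_words_add field_simps)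
qed

lemma mass_ge_1: "1 \<le> mass n"
  using mass_mono[of 0 n] by (simp add: mass_def num_F_0)

end

text \<open>Infinite Haar measure, phrased without division.\<close>

definition unbounded_table :: "(nat \<Rightarrow> nat) \<Rightarrow> bool" where
  "unbounded_table \<alpha> \<longleftrightarrow> (\<forall>B. \<exists>n. B * num_words \<alpha> 0 n \<le> num_F \<alpha> n)"

lemma (in valid_table) unbounded_tableD:
  assumes "unbounded_table \<alpha>"
  shows "\<exists>n. \<forall>m\<ge>n. B * num_words \<alpha> 0 m \<le> num_F \<alpha> m"
proof -
  obtain n where n: "B * num_words \<alpha> 0 n \<le> num_F \<alpha> n"
    using assms unfolding unbounded_table_def by blast
  have "B * num_words \<alpha> 0 m \<le> num_F \<alpha> m" if "n \<le> m" for m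
  proof -
    obtain t where t: "m = n + t"
      using \<open>n \<le> m\<close> le_Suc_ex by blast
    have "B * num_words \<alpha> 0 m \<le> num_F \<alpha> n * num_words \<alpha> n t"
      using mult_le_mono1[OF n, of "num_words \<alpha> n t"] by (simp add: t num_words_add mult.assoc)
    also have "\<dots> \<le> num_F \<alpha> m"
      unfolding t by (rule num_F_mult_le)
    finally show ?thesis .
  qed
  then show ?thesis
    by blast
qed


section \<open>The recursive construction of the stages\<close>

text \<open>Every number codes an infinite sequence by repeated right projection, and any finite
  initial segment can be prescribed. Hence a search through all numbers meets every function on a
  finite domain.\<close>

definition entry :: "nat \<Rightarrow> nat \<Rightarrow> nat" where
  "entry e p = lt (rec_nat e (\<lambda>_. rt) p)"

lemma entry_pair_0: "entry (pair a e) 0 = a"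
  by (simp add: entry_def)

lemma entry_pair_Suc: "entry (pair a e) (Suc p) = entry e p"
proof -
  have "rec_nat (pair a e) (\<lambda>_. rt) (Suc p) = rec_nat e (\<lambda>_. rt) p"
    by (induction p) auto
  then show ?thesis
    by (simp only: entry_def)
qed

lemma entry_exists: "\<exists>e. \<forall>p<n. entry e p = g p"
proof (induction n arbitrary: g)
  case (Suc n)
  obtain e where e: "\<forall>p<n. entry e p = g (Suc p)"
    using Suc.IH[of "\<lambda>p. g (Suc p)"] by blast
  have "entry (pair (g 0) e) p = g p" if "p < Suc n" for p
    using e that by (cases p) (simp_all add: entry_pair_0 entry_pair_Suc)
  then show ?case
    by blast
qed simp

text \<open>For even \<open>n\<close>, stage \<open>n\<close> starts from a level of the second space.\<close>

definition side :: "oracles \<Rightarrow> nat \<Rightarrow> nat \<Rightarrow> nat" where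
  "side t n = (if even n then snd t else fst t)"

lemma side_Suc_Suc [simp]: "side t (Suc (Suc n)) = side t n"
  by (simp add: side_def)

text \<open>A state at stage \<open>n\<close> consists of levels \<open>L\<close> and \<open>K\<close> on the sides \<open>n\<close> and \<open>n + 1\<close>, a number \<open>D\<close>
  and a code of an injection \<open>F\<^sub>L \<times> {..<D} \<rightarrow> F\<^sub>K\<close>.\<close>

definition st_L :: "nat \<Rightarrow> nat" where "st_L s = lt s"
definition st_K :: "nat \<Rightarrow> nat" where "st_K s = lt (rt s)"
definition st_D :: "nat \<Rightarrow> nat" where "st_D s = lt (rt (rt s))"
definition st_e :: "nat \<Rightarrow> nat" where "st_e s = rt (rt (rt s))"

text \<open>The largest \<open>D'\<close> with \<open>D * D' <= w\<close>: up to this bound the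
  pairs of digits can name different words.\<close>

definition next_words :: "oracles \<Rightarrow> nat \<Rightarrow> nat \<Rightarrow> nat \<Rightarrow> nat" where
  "next_words t n s L = num_words (side t n) (st_L s) (L - st_L s) div st_D s"

text \<open>The largest \<open>D'\<close> for which the elements of \<open>F_K\<close> times
  \<open>D'\<close> digits fit injectively into the new level.\<close>

definition next_room :: "oracles \<Rightarrow> nat \<Rightarrow> nat \<Rightarrow> nat \<Rightarrow> nat" where
  "next_room t n s L = num_F (side t n) L div num_F (side t (Suc n)) (st_K s)"

definition next_D :: "oracles \<Rightarrow> nat \<Rightarrow> nat \<Rightarrow> nat \<Rightarrow> nat" where
  "next_D t n s L = min (next_words t n s L) (next_room t n s L)"

text \<open>The bound by \<open>2 ^ n\<close> makes rounding in the two quotients cost at most a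
  summable fraction. The last condition, imposed for infinite measure, keeps room from being the
  restricting bound.\<close>

definition level_ok :: "bool \<Rightarrow> oracles \<Rightarrow> nat \<Rightarrow> nat \<Rightarrow> nat \<Rightarrow> bool" where
  "level_ok fin t n s L \<longleftrightarrow> st_L s < L \<and> 2 ^ n \<le> next_D t n s L \<and>
     (fin \<or> next_words t n s L \<le> next_room t n s L)"

text \<open>No level is ok when \<open>st_D s = 0\<close>, as then \<open>next_words\<close>
  vanishes; the premise lets the search halt for such \<open>s\<close>.\<close>

definition next_L :: "bool \<Rightarrow> oracles \<Rightarrow> nat \<Rightarrow> nat \<Rightarrow> nat" where
  "next_L fin t n s = (LEAST L. 0 < st_D s \<longrightarrow> level_ok fin t n s L)"

definition code_ok :: "nat \<Rightarrow> nat \<Rightarrow> nat \<Rightarrow> bool" where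
  "code_ok e M N \<longleftrightarrow> (\<forall>p<M. entry e p < N) \<and> (\<forall>p<M. \<forall>q<M. entry e p = entry e q \<longrightarrow> p = q)"

definition state_ok :: "oracles \<Rightarrow> nat \<Rightarrow> nat \<Rightarrow> bool" where
  "state_ok t n s \<longleftrightarrow> 0 < st_D s \<and>
     code_ok (st_e s) (num_F (side t n) (st_L s) * st_D s) (num_F (side t (Suc n)) (st_K s))"

text \<open>The condition on two consecutive injections: their composition is right multiplication
  by the word with number \<open>d + D * d'\<close>, whatever \<open>j\<close> is. The pair
  \<open>(j, d)\<close> is stored at index \<open>j * D + d\<close>.\<close>

definition compatible :: "oracles \<Rightarrow> nat \<Rightarrow> nat \<Rightarrow> nat \<Rightarrow> nat \<Rightarrow> nat \<Rightarrow> bool" where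
  "compatible t n s L D e \<longleftrightarrow>
     (\<forall>j<num_F (side t n) (st_L s). \<forall>d<st_D s. \<forall>d'<D.
        entry e (entry (st_e s) (j * st_D s + d) * D + d') =
        extend (side t n) (st_L s) (L - st_L s) j (d + st_D s * d'))"

text \<open>As in \<open>next_L\<close>, the premise makes the search halt on numbers
  \<open>s\<close> that are not states.\<close>

definition next_e :: "oracles \<Rightarrow> nat \<Rightarrow> nat \<Rightarrow> nat \<Rightarrow> nat" where
  "next_e t n s L = (LEAST e. state_ok t n s \<and> st_L s \<le> L \<longrightarrow>
     code_ok e (num_F (side t (Suc n)) (st_K s) * next_D t n s L) (num_F (side t n) L) \<and>
     compatible t n s L (next_D t n s L) e)"

definition next_state :: "bool \<Rightarrow> oracles \<Rightarrow> nat \<Rightarrow> nat \<Rightarrow> nat" where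
  "next_state fin t n s = (let L = next_L fin t n s in
     pair (st_K s) (pair L (pair (next_D t n s L) (next_e t n s L))))"

text \<open>The start has level 0 on both sides and \<open>D = 1\<close>. Both sets
  \<open>F_0\<close> are singletons, and the code 0, whose entry at 0 is 0, is the bijection between
  them.\<close>

definition state :: "bool \<Rightarrow> oracles \<Rightarrow> nat \<Rightarrow> nat" where
  "state fin t n = rec_nat (pair 0 (pair 0 (pair 1 0))) (next_state fin t) n"

text \<open>The relation is always written with the first space on the left, hence the exchange for
  even \<open>n\<close>. The exponents are pairwise distinct because the entries are, so the sum is
  the usual binary code of a finite set.\<close>

definition stage :: "bool \<Rightarrow> oracles \<Rightarrow> nat \<Rightarrow> nat" where
  "stage fin t n = (let s = state fin t n; M = num_F (side t n) (st_L s) * st_D s in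
     if even n
     then pair (st_K s) (pair (st_L s) (\<Sum>p<M. 2 ^ pair (entry (st_e s) p) (p div st_D s)))
     else pair (st_L s) (pair (st_K s) (\<Sum>p<M. 2 ^ pair (p div st_D s) (entry (st_e s) p))))"

section \<open>Existence of the next level and of the next injection\<close>

lemma injection_extension:
  assumes "finite A" "finite B" "card A \<le> card B" "P \<subseteq> A" "inj_on f P" "f ` P \<subseteq> B"
  shows "\<exists>g. inj_on g A \<and> g ` A \<subseteq> B \<and> (\<forall>p\<in>P. g p = f p)"
proof -
  have "finite P"
    using assms finite_subset by blast
  then have "card (A - P) \<le> card (B - f ` P)"
    using assms by (simp add: card_Diff_subset card_image)
  then obtain h where h: "h ` (A - P) \<subseteq> B - f ` P" "inj_on h (A - P)"
    using card_le_inj[of "A - P" "B - f ` P"] assms by blast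
  define g where "g = (\<lambda>p. if p \<in> P then f p else h p)"
  have "inj_on g A"
  proof (rule inj_onI)
    fix x y assume "x \<in> A" "y \<in> A" "g x = g y"
    moreover have "h z \<notin> f ` P" if "z \<in> A" "z \<notin> P" for z
      using h(1) that by blast
    ultimately show "x = y"
      unfolding g_def using assms(5) h(2) by (metis Diff_iff imageI inj_onD)
  qed
  moreover have "g ` A \<subseteq> B"
    using h(1) assms(6) unfolding g_def by auto
  moreover have "\<forall>p\<in>P. g p = f p"
    by (simp add: g_def)
  ultimately show ?thesis
    by blast
qed

lemma mixed_radix_less:
  assumes "d < D" "d' < D'"
  shows "d + D * d' < D * (D'::nat)"
proof -
  have "d + D * d' < D * Suc d'"
    using assms by simp
  also have "\<dots> \<le> D * D'"
    using assms by (intro mult_le_mono) auto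
  finally show ?thesis .
qed

lemma mixed_radix_eq:
  assumes "d < D" "e < D" "d + D * d' = e + D * (e'::nat)"
  shows "d = e \<and> d' = e'"
proof -
  have "d = (d + D * d') mod D" "d' = (d + D * d') div D"
    using assms(1) by simp_all
  moreover have "e = (e + D * e') mod D" "e' = (e + D * e') div D"
    using assms(2) by simp_all
  ultimately show ?thesis
    using assms(3) by metis
qed

locale valid_tables =
  fixes t :: oracles
  assumes valid: "valid_table (side t n)"
begin

text \<open>The number of words grows at least like a power of 2, and so does \<open>F\<close> by
  \<open>num_F_ge\<close>, so both quotients pass \<open>2 ^ n\<close>. With unbounded masses the
  new level eventually holds \<open>K\<close> times as many elements as there are words.\<close>

lemma level_exists:
  assumes D: "0 < st_D s" and fin: "fin \<or> unbounded_table (side t n)"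
  shows "\<exists>L. level_ok fin t n s L"
proof -
  interpret A: valid_table "side t n"
    by (rule valid)
  interpret B: valid_table "side t (Suc n)"
    by (rule valid)
  define K where "K = num_F (side t (Suc n)) (st_K s)"
  have K: "0 < K"
    by (simp add: K_def)
  obtain L0 where L0: "fin \<or> (\<forall>m\<ge>L0. K * num_words (side t n) 0 m \<le> num_F (side t n) m)"
    using fin A.unbounded_tableD by blast
  \<comment> \<open>Each summand serves one estimate: \<open>st_D s\<close> and \<open>K\<close>
    with \<open>n\<close> make the two quotients at least \<open>2 ^ n\<close> through
    \<open>x <= 2 ^ x\<close>, and \<open>L0\<close> handles infinite measure.\<close>
  define L where "L = Suc (L0 + st_L s + n + st_D s + K)"
  have big: "2 ^ n * x \<le> num_words (side t n) M (n + x)" for M x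
  proof -
    have "2 ^ n * x \<le> 2 ^ n * 2 ^ x"
      by simp
    also have "\<dots> \<le> num_words (side t n) M (n + x)"
      using A.num_words_ge[of "n + x" M] by (simp add: power_add)
    finally show ?thesis .
  qed
  have 1: "2 ^ n \<le> next_words t n s L"
  proof -
    have "2 ^ n * st_D s \<le> num_words (side t n) (st_L s) (L - st_L s)"
      using big[of "st_D s" "st_L s"] A.num_words_mono[of "n + st_D s" "L - st_L s" "st_L s"]
      by (simp add: L_def)
    then show ?thesis
      using D by (simp add: next_words_def less_eq_div_iff_mult_less_eq)
  qed
  have 2: "2 ^ n \<le> next_room t n s L"
  proof -
    have "2 ^ n * K \<le> num_F (side t n) L"
      using big[of K 0] A.num_words_mono[of "n + K" L 0] A.num_F_ge[of L] by (simp add: L_def)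
    then show ?thesis
      using K by (simp add: next_room_def K_def[symmetric] less_eq_div_iff_mult_less_eq)
  qed
  have 3: "next_words t n s L \<le> next_room t n s L" if "\<not> fin"
  proof -
    have "num_words (side t n) (st_L s) (L - st_L s) * K \<le> num_words (side t n) 0 L * K"
    proof -
      have "num_words (side t n) 0 L = num_words (side t n) 0 (st_L s) * num_words (side t n) (st_L s) (L - st_L s)"
      proof -
        have "L = st_L s + (L - st_L s)"
          by (simp add: L_def)
        then show ?thesis
          using num_words_add[of "side t n" 0 "st_L s" "L - st_L s"] by simp
      qed
      moreover have "1 \<le> num_words (side t n) 0 (st_L s)"
        using A.num_words_pos[of 0 "st_L s"] by linarith
      ultimately show ?thesis
        by simp
    qed
    also have "\<dots> \<le> num_F (side t n) L"
      using L0 that by (simp add: L_def mult.commute)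
    finally have "num_words (side t n) (st_L s) (L - st_L s) \<le> next_room t n s L"
      using K by (simp add: next_room_def K_def[symmetric] less_eq_div_iff_mult_less_eq)
    then show ?thesis
      using div_le_dividend order_trans unfolding next_words_def by blast
  qed
  have "st_L s < L"
    by (simp add: L_def)
  with 1 2 3 show ?thesis
    unfolding level_ok_def next_D_def by auto
qed

text \<open>The new injection is prescribed on the image of the old one. The prescription is
  consistent because the old map is injective, and it is injective because
  \<open>D * D' <= w\<close> keeps the words apart. It extends to all of \<open>K * D'\<close>
  positions because these are at most as many as the elements of the new level.\<close>

lemma code_exists:
  assumes ok: "state_ok t n s" and L: "st_L s \<le> L"
  shows "\<exists>e. code_ok e (num_F (side t (Suc n)) (st_K s) * next_D t n s L) (num_F (side t n) L) \<and>
     compatible t n s L (next_D t n s L) e"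
proof -
  interpret A: valid_table "side t n"
    by (rule valid)
  interpret B: valid_table "side t (Suc n)"
    by (rule valid)
  define J D K D' w where "J = num_F (side t n) (st_L s)" and "D = st_D s"
    and "K = num_F (side t (Suc n)) (st_K s)" and "D' = next_D t n s L"
    and "w = num_words (side t n) (st_L s) (L - st_L s)"
  define \<iota> where "\<iota> = entry (st_e s)"
  have D: "0 < D" and K: "0 < K"
    and \<iota>: "\<And>p. p < J * D \<Longrightarrow> \<iota> p < K" "\<And>p q. p < J * D \<Longrightarrow> q < J * D \<Longrightarrow> \<iota> p = \<iota> q \<Longrightarrow> p = q"
    using ok unfolding state_ok_def code_ok_def J_def D_def K_def \<iota>_def by auto
  have DD: "D * D' \<le> w"
  proof -
    have "D * D' \<le> D * (w div D)"
      by (intro mult_le_mono) (auto simp: D'_def next_D_def next_words_def w_def D_def)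
    then show ?thesis
      using times_div_less_eq_dividend order_trans by blast
  qed
  have KD: "K * D' \<le> num_F (side t n) L"
  proof -
    have "K * D' \<le> K * (num_F (side t n) L div K)"
      by (intro mult_le_mono) (auto simp: D'_def next_D_def next_room_def K_def)
    then show ?thesis
      using times_div_less_eq_dividend order_trans by blast
  qed
  have idx: "j * D + d < J * D" if "j < J" "d < D" for j d
    using mixed_radix_less[OF that(2,1)] by (simp add: algebra_simps)
  \<comment> \<open>\<open>T\<close> parametrises the prescribed part: \<open>p\<close> gives the
    positions and \<open>g\<close> the values that \<open>compatible\<close> demands there.\<close>
  define T where "T = {..<J} \<times> {..<D} \<times> {..<D'}"
  define p where "p = (\<lambda>(j, d, d'). \<iota> (j * D + d) * D' + d')"
  define g where "g = (\<lambda>(j, d, d'). extend (side t n) (st_L s) (L - st_L s) j (d + D * d'))"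
  have p_inj: "inj_on p T"
  proof (rule inj_onI, clarsimp simp: T_def p_def)
    fix j d d' i e e'
    assume *: "j < J" "d < D" "d' < D'" "i < J" "e < D" "e' < D'"
      and "\<iota> (j * D + d) * D' + d' = \<iota> (i * D + e) * D' + e'"
    then have "d' = e' \<and> \<iota> (j * D + d) = \<iota> (i * D + e)"
      by (intro mixed_radix_eq[of d' D' e']) (auto simp: algebra_simps)
    with \<iota>(2)[OF idx idx] * have "d' = e'" "j * D + d = i * D + e"
      by blast+
    with * show "j = i \<and> d = e \<and> d' = e'"
      using mixed_radix_eq[of d D e j i] by (auto simp: algebra_simps)
  qed
  have p_less: "p x < K * D'" if x: "x \<in> T" for x
  proof -
    obtain j d d' where "x = (j, d, d')" "j < J" "d < D" "d' < D'"
      using x unfolding T_def by blast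
    then show ?thesis
      using mixed_radix_less[of d' D' "\<iota> (j * D + d)" K] \<iota>(1)[OF idx, of j d]
      by (simp add: p_def algebra_simps)
  qed
  have g_inj: "inj_on g T"
  proof (rule inj_onI, clarsimp simp: T_def g_def)
    fix j d d' i e e'
    assume *: "j < J" "d < D" "d' < D'" "i < J" "e < D" "e' < D'"
      and "extend (side t n) (st_L s) (L - st_L s) j (d + D * d') =
        extend (side t n) (st_L s) (L - st_L s) i (e + D * e')"
    then have "j = i \<and> d + D * d' = e + D * e'"
      using DD mixed_radix_less[of d D d' D'] mixed_radix_less[of e D e' D']
      by (intro A.extend_inj) (auto simp: J_def w_def)
    with * show "j = i \<and> d = e \<and> d' = e'"
      using mixed_radix_eq[of d D e d' e'] by auto
  qed
  have g_less: "g x < num_F (side t n) L" if "x \<in> T" for x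
    using that A.extend_less[of _ "st_L s" "L - st_L s"] L by (auto simp: T_def g_def J_def)
  have "\<exists>h. inj_on h {..<K * D'} \<and> h ` {..<K * D'} \<subseteq> {..<num_F (side t n) L} \<and>
      (\<forall>y\<in>p ` T. h y = (g \<circ> inv_into T p) y)"
  proof (rule injection_extension)
    show "inj_on (g \<circ> inv_into T p) (p ` T)"
      using g_inj p_inj by (intro comp_inj_on inj_on_inv_into) (auto simp: inv_into_image_cancel)
  qed (use KD p_less g_less p_inj in \<open>auto simp: inv_into_f_f\<close>)
  then obtain h where h: "inj_on h {..<K * D'}" "h ` {..<K * D'} \<subseteq> {..<num_F (side t n) L}"
    "\<And>x. x \<in> T \<Longrightarrow> h (p x) = g x"
    using p_inj by (auto simp: inv_into_f_f)
  obtain e where e: "\<forall>y<K * D'. entry e y = h y"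
    using entry_exists by blast
  have "code_ok e (K * D') (num_F (side t n) L)"
    using e h(1,2) unfolding code_ok_def by (auto simp: inj_on_def)
  moreover have "compatible t n s L D' e"
    unfolding compatible_def
  proof (intro allI impI)
    fix j d d' assume "j < num_F (side t n) (st_L s)" "d < st_D s" "d' < D'"
    then have x: "(j, d, d') \<in> T"
      by (simp add: T_def J_def D_def)
    show "entry e (entry (st_e s) (j * st_D s + d) * D' + d') =
        extend (side t n) (st_L s) (L - st_L s) j (d + st_D s * d')"
      using e p_less[OF x] h(3)[OF x] by (simp add: p_def g_def \<iota>_def D_def)
  qed
  ultimately show ?thesis
    unfolding K_def D'_def by blast
qed

end

section \<open>Summability of the losses\<close>

lemma nat_div_bounds:
  fixes x y :: nat assumes "0 < y"
  shows "real (x div y) * y \<le> x" "x < (real (x div y) + 1) * y"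
proof -
  have "x div y * y \<le> x" "x < Suc (x div y) * y"
    using dividend_less_div_times[OF assms, of x] by (simp_all add: add.commute)
  then show "real (x div y) * y \<le> x" "x < (real (x div y) + 1) * y"
    by (metis of_nat_le_iff of_nat_mult, metis of_nat_less_iff of_nat_mult of_nat_Suc add.commute)
qed

text \<open>In the finite case, no level can be chosen such that the loss \<open>1 - D\<^sub>n D\<^sub>n\<^sub>+\<^sub>1 / w\<^sub>n\<close> is known to be
  small; it is summable because it is controlled by the growth of the masses.\<close>

lemma summable_loss:
  fixes w D N :: "nat \<Rightarrow> nat"
  assumes pos: "\<And>n. 0 < D n" "\<And>n. 0 < N n" "\<And>n. 0 < w n"
    and D: "\<And>n. D (Suc n) = min (w n div D n) (N (Suc (Suc n)) div N (Suc n))"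
    and D0: "D 0 * N 0 \<le> N 1"
    and big: "\<And>n. 2 ^ n \<le> D (Suc n)"
    and Nw: "\<And>n. N n * w n \<le> N (Suc (Suc n))"
    and cases: "(\<forall>n. w n div D n \<le> N (Suc (Suc n)) div N (Suc n)) \<or>
      summable (\<lambda>n. 1 - real (N n * w n) / N (Suc (Suc n)))"
  shows "summable (\<lambda>n. 1 - real (D n * D (Suc n)) / w n)"
proof -
  define e :: "nat \<Rightarrow> real" where "e n = (1 / 2) ^ n" for n
  have e_sum: "summable e"
    unfolding e_def by (rule summable_geometric) simp
  have e01: "0 \<le> e n" "e n \<le> 1" for n
    by (simp_all add: e_def power_le_one)
  have DN: "D n * N n \<le> N (Suc n)" for n
  proof (cases n)
    case (Suc m)
    have "D n * N n \<le> (N (Suc n) div N n) * N n"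
      using D[of m] Suc by (intro mult_le_mono) auto
    then show ?thesis
      using div_times_less_eq_dividend order_trans by blast
  qed (use D0 in simp)
  have DD: "D n * D (Suc n) \<le> w n" for n
  proof -
    have "D n * D (Suc n) \<le> D n * (w n div D n)"
      using D[of n] by (intro mult_le_mono) auto
    then show ?thesis
      using times_div_less_eq_dividend order_trans by blast
  qed
  \<comment> \<open>Rounding down a quotient that is at least \<open>2 ^ n\<close> costs no more
    than the factor \<open>1 - e n\<close>.\<close>
  have near: "(1 - e n) * (real x / y) \<le> x div y" if "2 ^ n \<le> x div y" "0 < y" for n x y
  proof -
    have big': "2 ^ n \<le> real (x div y)"
      using that(1) by (metis of_nat_le_iff of_nat_numeral of_nat_power)
    have "real x / y < real (x div y) + 1"
      using nat_div_bounds(2)[OF that(2), of x] that(2) by (simp add: divide_less_eq)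
    also have "1 \<le> real (x div y) * e n"
      using mult_right_mono[OF big', of "e n"] e01[of n] by (simp add: e_def power_one_over)
    finally have "real x / y \<le> real (x div y) * (1 + e n)"
      by (simp add: algebra_simps)
    then have "(1 - e n) * (real x / y) \<le> (1 - e n) * (real (x div y) * (1 + e n))"
      using e01 by (intro mult_left_mono) auto
    also have "\<dots> = real (x div y) - real (x div y) * (e n)^2"
      by (simp add: algebra_simps power2_eq_square)
    also have "\<dots> \<le> x div y"
      by simp
    finally show ?thesis .
  qed
  have lower: "(1 - e n) * min (real (w n) / D n) (real (N (Suc (Suc n))) / N (Suc n)) \<le> D (Suc n)" for n
  proof -
    have *: "2 ^ n \<le> w n div D n" "2 ^ n \<le> N (Suc (Suc n)) div N (Suc n)"
      using big[of n] D[of n] by auto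
    have "(1 - e n) * min a b \<le> (1 - e n) * a" "(1 - e n) * min a b \<le> (1 - e n) * b" for a b
      using e01[of n] by (auto intro!: mult_left_mono)
    then show ?thesis
      using near[OF *(1) pos(1)] near[OF *(2) pos(2)] D[of n] by (smt (verit) min_def)
  qed
  define loss where "loss n = 1 - real (D n * D (Suc n)) / w n" for n
  have loss0: "0 \<le> loss n" for n
    using DD[of n] pos(3)[of n] unfolding loss_def by (simp del: of_nat_mult)
  have "summable loss"
    using cases
  proof
    \<comment> \<open>Here \<open>D (Suc n)\<close> equals the quotient by words, so rounding is the
      only loss.\<close>
    assume inf: "\<forall>n. w n div D n \<le> N (Suc (Suc n)) div N (Suc n)"
    have "loss n \<le> e n" for n
    proof -
      have eq: "D (Suc n) = w n div D n"
        using D[of n] inf by simp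
      have "(1 - e n) * (real (w n) / D n) \<le> D (Suc n)"
        using near[OF _ pos(1), of n "w n" n] big[of n] by (simp add: eq)
      then have "1 - e n \<le> real (D n * D (Suc n)) / w n"
        using pos(1)[of n] pos(3)[of n] by (simp add: field_simps)
      then show ?thesis
        by (simp add: loss_def)
    qed
    then show ?thesis
      using loss0 by (intro summable_comparison_test[OF _ e_sum]) auto
  next
    define t where "t n = real (N n * w n) / N (Suc (Suc n))" for n
    assume "summable (\<lambda>n. 1 - real (N n * w n) / N (Suc (Suc n)))"
    then have t_sum: "summable (\<lambda>n. 1 - t n)"
      by (simp add: t_def)
    have t01: "0 \<le> t n" "t n \<le> 1" for n
      using Nw[of n] pos(2)[of "Suc (Suc n)"] unfolding t_def by (simp_all del: of_nat_mult)
    \<comment> \<open>The right side is the fraction of level \<open>n + 2\<close> that the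
      injection of stage \<open>n + 1\<close> fills. Both candidates in the minimum of
      \<open>lower\<close> bound it from below by \<open>t n\<close> up to rounding: the quotient by
      words because of \<open>D n * N n <= N (Suc n)\<close>, the quotient by room because of
      \<open>t n <= 1\<close>.\<close>
    have t_le: "(1 - e n) * t n \<le> real (D (Suc n) * N (Suc n)) / N (Suc (Suc n))" for n
    proof -
      have "t n \<le> min (real (w n) / D n) (real (N (Suc (Suc n))) / N (Suc n)) * (real (N (Suc n)) / N (Suc (Suc n)))"
      proof -
        have "real (D n) * N n \<le> N (Suc n)"
          using DN[of n] by (metis of_nat_le_iff of_nat_mult)
        then have "real (D n) * N n * w n \<le> N (Suc n) * w n"
          by (simp add: mult_right_mono)
        then have "t n \<le> real (w n) / D n * (real (N (Suc n)) / N (Suc (Suc n)))"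
          using pos(1)[of n] pos(2)[of "Suc (Suc n)"] by (simp add: t_def field_simps)
        moreover have "t n \<le> real (N (Suc (Suc n))) / N (Suc n) * (real (N (Suc n)) / N (Suc (Suc n)))"
          using t01[of n] pos(2)[of "Suc n"] pos(2)[of "Suc (Suc n)"] by simp
        ultimately show ?thesis
          by (simp add: min_def)
      qed
      then have "(1 - e n) * t n \<le> (1 - e n) * (min (real (w n) / D n) (real (N (Suc (Suc n))) / N (Suc n)) * (real (N (Suc n)) / N (Suc (Suc n))))"
        using e01[of n] by (intro mult_left_mono) auto
      also have "\<dots> \<le> real (D (Suc n)) * (real (N (Suc n)) / N (Suc (Suc n)))"
        using mult_right_mono[OF lower[of n], of "real (N (Suc n)) / N (Suc (Suc n))"] by (simp only: mult.assoc) simp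
      finally show ?thesis
        by simp
    qed
    \<comment> \<open>Put \<open>m = n + 1\<close>. If words restrict \<open>D (Suc m)\<close>, only
      rounding is lost. If room does, then \<open>N m * w m <= N (m + 2)\<close> bounds
      \<open>D m * D (Suc m) / w m\<close> from below by the fraction
      \<open>D m * N m / N (m + 1)\<close>, up to rounding; \<open>t_le\<close> for \<open>n\<close>
      estimates this fraction, whence the shift by one.\<close>
    have "loss (Suc n) \<le> e (Suc n) + e n + (1 - t n)" for n
    proof -
      let ?m = "Suc n"
      have "(1 - e ?m) * ((1 - e n) * t n) \<le> (1 - e ?m) * (min (real (w ?m) / D ?m) (real (N (Suc (Suc ?m))) / N (Suc ?m)) * (real (D ?m) / w ?m))"
      proof (rule mult_left_mono)
        have "real (N ?m) * w ?m \<le> N (Suc (Suc ?m))"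
          using Nw[of ?m] by (metis of_nat_le_iff of_nat_mult)
        then have "real (D ?m) * (real (N ?m) * w ?m) \<le> real (D ?m) * N (Suc (Suc ?m))"
          by (intro mult_left_mono) auto
        then have "real (D ?m * N ?m) / N (Suc ?m) \<le> real (N (Suc (Suc ?m))) / N (Suc ?m) * (real (D ?m) / w ?m)"
          using pos(2)[of "Suc ?m"] pos(3)[of ?m] by (simp add: field_simps)
        then have "(1 - e n) * t n \<le> real (N (Suc (Suc ?m))) / N (Suc ?m) * (real (D ?m) / w ?m)"
          using t_le[of n] by simp
        moreover have "(1 - e n) * t n \<le> real (w ?m) / D ?m * (real (D ?m) / w ?m)"
          using mult_mono[of "1 - e n" 1 "t n" 1] e01[of n] t01[of n] pos(1)[of ?m] pos(3)[of ?m] by simp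
        ultimately show "(1 - e n) * t n \<le> min (real (w ?m) / D ?m) (real (N (Suc (Suc ?m))) / N (Suc ?m)) * (real (D ?m) / w ?m)"
          by (simp add: min_def)
      qed (use e01 in simp)
      also have "\<dots> \<le> real (D (Suc ?m)) * (real (D ?m) / w ?m)"
        using mult_right_mono[OF lower[of ?m], of "real (D ?m) / w ?m"] by (simp only: mult.assoc) simp
      finally have 1: "loss ?m \<le> 1 - (1 - e ?m) * ((1 - e n) * t n)"
        by (simp add: loss_def mult.commute)
      have "(1 - a) * (1 - b) \<ge> 1 - a - b" if "0 \<le> a" "0 \<le> b" for a b :: real
        using mult_nonneg_nonneg[OF that] by (simp add: algebra_simps)
      from this[of "e n" "1 - t n"] have 2: "(1 - e n) * t n \<ge> 1 - e n - (1 - t n)"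
        using e01[of n] t01[of n] by simp
      have "(1 - e ?m) * x \<ge> x - e ?m" if "x \<le> 1" for x
        using mult_left_mono[OF that, of "e ?m"] e01[of ?m] by (simp add: algebra_simps)
      from this[of "(1 - e n) * t n"] have "(1 - e ?m) * ((1 - e n) * t n) \<ge> (1 - e n) * t n - e ?m"
        using mult_mono[of "1 - e n" 1 "t n" 1] e01[of n] t01[of n] by simp
      with 1 2 show ?thesis
        by linarith
    qed
    moreover have "summable (\<lambda>n. e (Suc n) + e n + (1 - t n))"
      using e_sum t_sum by (intro summable_add) (simp_all add: summable_Suc_iff)
    ultimately have "summable (\<lambda>n. loss (Suc n))"
      using loss0 by (intro summable_comparison_test[of "\<lambda>n. loss (Suc n)"]) auto
    then show ?thesis
      by (simp add: summable_Suc_iff)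
  qed
  then show ?thesis
    by (simp add: loss_def[abs_def])
qed

section \<open>Properties of the constructed states\<close>

locale stages = valid_tables +
  fixes fin :: bool
  assumes fin: "fin \<or> (\<forall>n. unbounded_table (side t n))"
begin

definition level :: "nat \<Rightarrow> nat" where "level n = st_L (state fin t n)"
definition fan :: "nat \<Rightarrow> nat" where "fan n = st_D (state fin t n)"
definition size_F :: "nat \<Rightarrow> nat" where "size_F n = num_F (side t n) (level n)"
definition words :: "nat \<Rightarrow> nat" where
  "words n = num_words (side t n) (level n) (level (Suc (Suc n)) - level n)"
definition ext :: "nat \<Rightarrow> nat \<Rightarrow> nat \<Rightarrow> nat" where
  "ext n = extend (side t n) (level n) (level (Suc (Suc n)) - level n)"
definition inject :: "nat \<Rightarrow> nat \<Rightarrow> nat \<Rightarrow> nat" where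
  "inject n u d = entry (st_e (state fin t n)) (u * fan n + d)"

lemma state_Suc: "state fin t (Suc n) = next_state fin t n (state fin t n)"
  by (simp add: state_def)

lemma st_K_state: "st_K (state fin t n) = level (Suc n)"
  by (simp add: level_def state_Suc next_state_def Let_def st_L_def)

lemma level_0 [simp]: "level 0 = 0" and level_1 [simp]: "level (Suc 0) = 0" and fan_0: "fan 0 = 1"
  by (simp_all add: level_def fan_def state_def next_state_def Let_def st_L_def st_K_def st_D_def)

lemma level_Suc_Suc: "level (Suc (Suc n)) = next_L fin t n (state fin t n)"
  by (simp add: level_def[of "Suc (Suc n)"] state_Suc[of "Suc n"] state_Suc[of n] next_state_def Let_def st_L_def st_K_def)

lemma fan_Suc: "fan (Suc n) = next_D t n (state fin t n) (level (Suc (Suc n)))"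
  by (simp add: fan_def state_Suc next_state_def Let_def st_D_def level_Suc_Suc)

lemma code_Suc: "st_e (state fin t (Suc n)) = next_e t n (state fin t n) (level (Suc (Suc n)))"
  by (simp add: state_Suc next_state_def Let_def st_e_def level_Suc_Suc)

lemma level_ok:
  assumes "0 < fan n"
  shows "level_ok fin t n (state fin t n) (level (Suc (Suc n)))"
proof -
  have "\<exists>L. level_ok fin t n (state fin t n) L"
    using assms fin by (intro level_exists) (auto simp: fan_def)
  then have "0 < st_D (state fin t n) \<longrightarrow> level_ok fin t n (state fin t n) (next_L fin t n (state fin t n))"
    unfolding next_L_def
    using LeastI_ex[of "\<lambda>L. 0 < st_D (state fin t n) \<longrightarrow> level_ok fin t n (state fin t n) L"] by metis
  with assms show ?thesis
    by (simp add: fan_def level_Suc_Suc)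
qed

text \<open>A positive \<open>fan n\<close> makes the search for the level succeed, and the level
  found has \<open>2 ^ n <= fan (Suc n)\<close>.\<close>

lemma fan_pos: "0 < fan n"
proof (induction n)
  case (Suc n)
  have "2 ^ n \<le> fan (Suc n)"
    using level_ok[OF Suc] by (simp add: level_ok_def fan_Suc)
  then show ?case
    using less_le_trans[of 0 "2 ^ n" "fan (Suc n)"] by simp
qed (simp add: fan_0)

lemma level_less: "level n < level (Suc (Suc n))"
  and fan_ge: "2 ^ n \<le> fan (Suc n)"
  and infinite_case: "\<not> fin \<Longrightarrow> words n div fan n \<le> size_F (Suc (Suc n)) div size_F (Suc n)"
  and fan_eq: "fan (Suc n) = min (words n div fan n) (size_F (Suc (Suc n)) div size_F (Suc n))"
proof -
  have L: "st_L (state fin t n) = level n" and D: "st_D (state fin t n) = fan n"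
    by (simp_all add: level_def fan_def)
  have eq: "next_words t n (state fin t n) (level (Suc (Suc n))) = words n div fan n"
    "next_room t n (state fin t n) (level (Suc (Suc n))) = size_F (Suc (Suc n)) div size_F (Suc n)"
    by (simp_all add: next_words_def next_room_def words_def size_F_def st_K_state L D)
  note * = level_ok[OF fan_pos, of n, unfolded level_ok_def eq L]
  show "level n < level (Suc (Suc n))" "2 ^ n \<le> fan (Suc n)"
    "\<not> fin \<Longrightarrow> words n div fan n \<le> size_F (Suc (Suc n)) div size_F (Suc n)"
    using * by (simp_all only: fan_Suc simp_thms)
  show "fan (Suc n) = min (words n div fan n) (size_F (Suc (Suc n)) div size_F (Suc n))"
    by (simp only: fan_Suc next_D_def eq)
qed

text \<open>An induction in which correctness at \<open>n\<close> makes the search for the code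
  succeed, and the code found gives correctness at \<open>n + 1\<close>.\<close>

lemma state_ok: "state_ok t n (state fin t n)"
  and next_code: "code_ok (st_e (state fin t (Suc n))) (size_F (Suc n) * fan (Suc n)) (size_F (Suc (Suc n))) \<and>
    compatible t n (state fin t n) (level (Suc (Suc n))) (fan (Suc n)) (st_e (state fin t (Suc n)))"
proof -
  have *: "code_ok (st_e (state fin t (Suc n))) (size_F (Suc n) * fan (Suc n)) (size_F (Suc (Suc n))) \<and>
    compatible t n (state fin t n) (level (Suc (Suc n))) (fan (Suc n)) (st_e (state fin t (Suc n)))"
    if ok: "state_ok t n (state fin t n)" for n
  proof -
    let ?Q = "\<lambda>e. state_ok t n (state fin t n) \<and> st_L (state fin t n) \<le> level (Suc (Suc n)) \<longrightarrow>
      code_ok e (num_F (side t (Suc n)) (st_K (state fin t n)) * next_D t n (state fin t n) (level (Suc (Suc n))))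
        (num_F (side t n) (level (Suc (Suc n)))) \<and>
      compatible t n (state fin t n) (level (Suc (Suc n))) (next_D t n (state fin t n) (level (Suc (Suc n)))) e"
    have "\<exists>e. ?Q e"
      using code_exists[OF ok] by blast
    then have "?Q (next_e t n (state fin t n) (level (Suc (Suc n))))"
      unfolding next_e_def by (rule LeastI_ex)
    then show ?thesis
      using ok level_less[of n] by (simp add: level_def[of n] code_Suc size_F_def fan_Suc st_K_state)
  qed
  have ok: "state_ok t n (state fin t n)" for n
  proof (induction n)
    case 0
    interpret A: valid_table "side t 0"
      by (rule valid)
    interpret B: valid_table "side t (Suc 0)"
      by (rule valid)
    show ?case
      by (simp add: state_def state_ok_def code_ok_def st_D_def st_L_def st_K_def st_e_def A.num_F_0 B.num_F_0
          entry_def)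
        (simp add: lt_def prod_decode_def prod_decode_aux.simps)
  next
    case (Suc n)
    from *[OF Suc] fan_pos[of "Suc n"] show ?case
      by (simp add: state_ok_def st_K_state level_def[of "Suc n", symmetric] fan_def[symmetric] size_F_def)
  qed
  then show "state_ok t n (state fin t n)" .
  from *[OF ok] show "code_ok (st_e (state fin t (Suc n))) (size_F (Suc n) * fan (Suc n)) (size_F (Suc (Suc n))) \<and>
    compatible t n (state fin t n) (level (Suc (Suc n))) (fan (Suc n)) (st_e (state fin t (Suc n)))" .
qed

lemma code_ok: "code_ok (st_e (state fin t n)) (size_F n * fan n) (size_F (Suc n))"
  using state_ok[of n]
  by (simp add: state_ok_def st_K_state level_def[of n, symmetric] fan_def[symmetric] size_F_def)

lemma index_less: "u < size_F n \<Longrightarrow> d < fan n \<Longrightarrow> u * fan n + d < size_F n * fan n"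
  using mixed_radix_less[of d "fan n" u "size_F n"] by (simp add: algebra_simps)

lemma inject_less: "u < size_F n \<Longrightarrow> d < fan n \<Longrightarrow> inject n u d < size_F (Suc n)"
  using code_ok[of n] index_less[of u n d] by (simp add: code_ok_def inject_def)

lemma inject_inj:
  assumes "u < size_F n" "d < fan n" "u' < size_F n" "d' < fan n" "inject n u d = inject n u' d'"
  shows "u = u' \<and> d = d'"
proof -
  have "u * fan n + d = u' * fan n + d'"
    using code_ok[of n] index_less[OF assms(1,2)] index_less[OF assms(3,4)] assms(5)
    by (auto simp: code_ok_def inject_def)
  then show ?thesis
    using mixed_radix_eq[OF assms(2,4), of u u'] by (simp add: algebra_simps)
qed

lemma inject_inject:
  "u < size_F n \<Longrightarrow> d < fan n \<Longrightarrow> d' < fan (Suc n) \<Longrightarrow>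
    inject (Suc n) (inject n u d) d' = ext n u (d + fan n * d')"
  using next_code[of n]
  by (simp add: compatible_def inject_def ext_def level_def[of n, symmetric] fan_def[of n, symmetric] size_F_def)

lemma fan_mult_le: "fan n * fan (Suc n) \<le> words n"
proof -
  have "fan n * fan (Suc n) \<le> fan n * (words n div fan n)"
    using fan_eq[of n] by (intro mult_le_mono) auto
  then show ?thesis
    using times_div_less_eq_dividend order_trans by blast
qed

text \<open>For finite measure \<open>N n * w n / N (n + 2)\<close> is the quotient of two masses of
  the same side. As masses are at least 1, its distance from 1 is at most their difference, and the
  differences telescope.\<close>

lemma summable_loss_stages:
  assumes bound: "fin \<Longrightarrow> \<exists>B. \<forall>n k. valid_table.mass (side t n) k \<le> B"
  shows "summable (\<lambda>n. 1 - real (fan n * fan (Suc n)) / words n)"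
proof (rule summable_loss[where N = size_F])
  show "0 < fan n" for n
    by (rule fan_pos)
  show "0 < size_F n" "0 < words n" for n
    using valid_table.num_F_pos[OF valid] valid_table.num_words_pos[OF valid]
    by (simp_all add: size_F_def words_def)
  show "fan (Suc n) = min (words n div fan n) (size_F (Suc (Suc n)) div size_F (Suc n))" for n
    by (rule fan_eq)
  show "2 ^ n \<le> fan (Suc n)" for n
    by (rule fan_ge)
  show "fan 0 * size_F 0 \<le> size_F 1"
    using valid_table.num_F_0[OF valid] by (simp add: size_F_def fan_0)
  have L: "level (Suc (Suc n)) = level n + (level (Suc (Suc n)) - level n)" for n
    using level_less[of n] by simp
  show "size_F n * words n \<le> size_F (Suc (Suc n))" for n
    using valid_table.num_F_mult_le[OF valid, of n "level n" "level (Suc (Suc n)) - level n"]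
    by (simp add: size_F_def words_def L[of n, symmetric] )
  show "(\<forall>n. words n div fan n \<le> size_F (Suc (Suc n)) div size_F (Suc n)) \<or>
      summable (\<lambda>n. 1 - real (size_F n * words n) / size_F (Suc (Suc n)))"
  proof (cases fin)
    case True
    then obtain B where B: "\<And>n k. valid_table.mass (side t n) k \<le> B"
      using bound by blast
    define a where "a n = valid_table.mass (side t n) (level n)" for n
    have a1: "1 \<le> a n" for n
      unfolding a_def by (rule valid_table.mass_ge_1[OF valid])
    have mono: "a n \<le> a (Suc (Suc n))" for n
      using valid_table.mass_mono[OF valid, of "level n" "level (Suc (Suc n))" n] level_less[of n]
      by (simp add: a_def)
    have t: "real (size_F n * words n) / size_F (Suc (Suc n)) = a n / a (Suc (Suc n))" for n
      using valid_table.mass_step[OF valid, of n "level n" "level (Suc (Suc n)) - level n"]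
      by (simp add: size_F_def words_def a_def L[of n, symmetric])
    have sum_a: "summable (\<lambda>n. a (Suc (Suc n)) - a n)"
    proof (rule bounded_imp_summable)
      \<comment> \<open>Telescoping in steps of 2 leaves two terms at either end; each of the upper
        ones is at most \<open>B\<close>, which gives the bound \<open>2 * B\<close>.\<close>
      have "(\<Sum>k\<le>n. a (Suc (Suc k)) - a k) = a (Suc (Suc n)) + a (Suc n) - a 0 - a 1" for n
        by (induction n) simp_all
      then show "(\<Sum>k\<le>n. a (Suc (Suc k)) - a k) \<le> 2 * B" for n
        using B[of "Suc (Suc n)" "level (Suc (Suc n))"] B[of "Suc n" "level (Suc n)"] a1[of 0] a1[of 1]
        by (simp add: a_def)
    qed (use mono in simp)
    have norm_le: "norm (1 - a n / a (Suc (Suc n))) \<le> a (Suc (Suc n)) - a n" for n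
    proof -
      have "1 - a n / a (Suc (Suc n)) = (a (Suc (Suc n)) - a n) / a (Suc (Suc n))"
        using a1[of "Suc (Suc n)"] by (simp add: field_simps)
      also have "\<dots> \<le> a (Suc (Suc n)) - a n"
        using a1[of "Suc (Suc n)"] mono[of n] by (simp add: divide_le_eq mult_le_cancel_left1)
      finally show ?thesis
        using mono[of n] a1[of "Suc (Suc n)"] by simp
    qed
    have "summable (\<lambda>n. 1 - a n / a (Suc (Suc n)))"
      by (rule summable_comparison_test'[OF sum_a norm_le])
    then show ?thesis
      by (simp only: t) simp
  next
    case False
    then show ?thesis
      using infinite_case by blast
  qed
qed

end

section \<open>Computability of the stages\<close>

lemma computable_compose2:
  assumes "computable S (\<lambda>t z. h t (lt z) (rt z))" "computable S f" "computable S g"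
  shows "computable S (\<lambda>t a. h t (f t a) (g t a))"
  using computable_compose[OF assms(1) computable_pair[OF assms(2,3)]] by simp

lemma computable_compose3:
  assumes "computable S (\<lambda>t z. h t (lt z) (lt (rt z)) (rt (rt z)))"
    "computable S f" "computable S g" "computable S k"
  shows "computable S (\<lambda>t a. h t (f t a) (g t a) (k t a))"
  using computable_compose[OF assms(1) computable_pair[OF assms(2) computable_pair[OF assms(3,4)]]] by simp

lemma computable_side [computable_intros]:
  assumes "computable S f" "computable S g"
  shows "computable S (\<lambda>t a. side t (f t a) (g t a))"
proof -
  have *: "side t n x = (if even n then snd t x else fst t x)" for t n x
    by (simp add: side_def)
  show ?thesis
    unfolding * by (intro computable_intros assms)
qed

lemma computable_entry [computable_intros]:
  assumes "computable S f" "computable S g"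
  shows "computable S (\<lambda>t a. entry (f t a) (g t a))"
proof (rule computable_compose2[OF _ assms])
  show "computable S (\<lambda>t z. entry (lt z) (rt z))"
    unfolding entry_def by (intro computable_intros)
qed

lemma computable_state_components [computable_intros]:
  assumes "computable S f"
  shows "computable S (\<lambda>t a. st_L (f t a))" "computable S (\<lambda>t a. st_K (f t a))"
    "computable S (\<lambda>t a. st_D (f t a))" "computable S (\<lambda>t a. st_e (f t a))"
  unfolding st_L_def st_K_def st_D_def st_e_def by (intro computable_intros assms)+

locale stage_computation =
  fixes fin :: bool and S :: "oracles set"
  assumes stages: "t \<in> S \<Longrightarrow> stages t fin"
begin

lemma valid_side: "t \<in> S \<Longrightarrow> valid_table (side t n)"
  using stages valid_tables.valid stages.axioms(1) by blast

lemma computable_num_F [computable_intros]: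
  assumes "computable S f" "computable S g"
  shows "computable S (\<lambda>t a. num_F (side t (f t a)) (g t a))"
proof (rule computable_compose2[where h = "\<lambda>t x y. num_F (side t x) y", OF _ assms])
  show "computable S (\<lambda>t z. num_F (side t (lt z)) (rt z))"
    unfolding num_F_def
    by (intro computable_Least valid_table.zero_F valid_side) (intro computable_intros)
qed

lemma computable_num_C [computable_intros]:
  assumes "computable S f" "computable S g"
  shows "computable S (\<lambda>t a. num_C (side t (f t a)) (g t a))"
proof (rule computable_compose2[where h = "\<lambda>t x y. num_C (side t x) y", OF _ assms])
  show "computable S (\<lambda>t z. num_C (side t (lt z)) (rt z))"
    unfolding num_C_def
    by (intro computable_Least valid_table.zero_C valid_side) (intro computable_intros)
qed

lemma computable_num_words [computable_intros]:
  assumes "computable S f" "computable S g" "computable S h"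
  shows "computable S (\<lambda>t a. num_words (side t (f t a)) (g t a) (h t a))"
proof (rule computable_compose3[where h = "\<lambda>t x y z. num_words (side t x) y z", OF _ assms])
  show "computable S (\<lambda>t z. num_words (side t (lt z)) (lt (rt z)) (rt (rt z)))"
    unfolding num_words_def by (intro computable_intros)
qed

lemma computable_extend [computable_intros]:
  assumes "computable S f" "computable S g" "computable S h" "computable S k" "computable S l"
  shows "computable S (\<lambda>t a. extend (side t (f t a)) (g t a) (h t a) (k t a) (l t a))"
proof -
  have "computable S (\<lambda>t z. extend (side t (lt z)) (lt (rt z)) (lt (rt (rt z))) (lt (rt (rt (rt z)))) (rt (rt (rt (rt z)))))"
    unfolding extend_def mult_pos_def by (intro computable_intros)
  from computable_compose[OF this computable_pair[OF assms(1) computable_pair[OF assms(2)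
        computable_pair[OF assms(3) computable_pair[OF assms(4,5)]]]]]
  show ?thesis
    by simp
qed

lemma computable_next_words [computable_intros]:
  assumes "computable S f" "computable S g" "computable S h"
  shows "computable S (\<lambda>t a. next_words t (f t a) (g t a) (h t a))"
  unfolding next_words_def by (intro computable_intros assms)

lemma computable_next_room [computable_intros]:
  assumes "computable S f" "computable S g" "computable S h"
  shows "computable S (\<lambda>t a. next_room t (f t a) (g t a) (h t a))"
  unfolding next_room_def by (intro computable_intros assms)

lemma computable_next_D [computable_intros]:
  assumes "computable S f" "computable S g" "computable S h"
  shows "computable S (\<lambda>t a. next_D t (f t a) (g t a) (h t a))"
  unfolding next_D_def by (intro computable_intros assms)

lemma computable_next_L [computable_intros]:
  assumes "computable S f" "computable S g"
  shows "computable S (\<lambda>t a. next_L fin t (f t a) (g t a))"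
proof (rule computable_compose2[where h = "next_L fin", OF _ assms])
  \<comment> \<open>\<open>level_exists\<close> speaks of arbitrary numbers \<open>s\<close> with
    \<open>st_D s > 0\<close>, reachable or not; for the others the condition is vacuous.\<close>
  have "\<exists>L. 0 < st_D s \<longrightarrow> level_ok fin t n s L" if "t \<in> S" for t n s
    using valid_tables.level_exists[OF stages.axioms(1), OF stages[OF that], of s fin n]
      stages.fin[OF stages[OF that]] by (cases "0 < st_D s") auto
  then show "computable S (\<lambda>t z. next_L fin t (lt z) (rt z))"
    unfolding next_L_def level_ok_def by (intro computable_Least) (intro computable_intros)
qed

lemma decidable_code_ok [computable_intros]:
  assumes "computable S f" "computable S g" "computable S h"
  shows "decidable S (\<lambda>t a. code_ok (f t a) (g t a) (h t a))"
proof -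
  have "computable S (\<lambda>t z. of_bool (code_ok (lt z) (lt (rt z)) (rt (rt z))))"
    unfolding decidable_def[symmetric] code_ok_def by (intro computable_intros)
  from computable_compose3[OF this assms] show ?thesis
    unfolding decidable_def .
qed

lemma decidable_state_ok [computable_intros]:
  assumes "computable S f" "computable S g"
  shows "decidable S (\<lambda>t a. state_ok t (f t a) (g t a))"
  unfolding state_ok_def by (intro computable_intros assms)

lemma decidable_compatible:
  "decidable S (\<lambda>t z. compatible t (lt z) (lt (rt z)) (lt (rt (rt z))) (lt (rt (rt (rt z)))) (rt (rt (rt (rt z)))))"
  unfolding compatible_def by (intro computable_intros)

lemma decidable_compatible' [computable_intros]:
  assumes "computable S f" "computable S g" "computable S h" "computable S k" "computable S l"
  shows "decidable S (\<lambda>t a. compatible t (f t a) (g t a) (h t a) (k t a) (l t a))"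
  using computable_compose[OF decidable_compatible[unfolded decidable_def]
      computable_pair[OF assms(1) computable_pair[OF assms(2)
        computable_pair[OF assms(3) computable_pair[OF assms(4,5)]]]]]
  by (simp add: decidable_def)

lemma computable_next_e [computable_intros]:
  assumes "computable S f" "computable S g" "computable S h"
  shows "computable S (\<lambda>t a. next_e t (f t a) (g t a) (h t a))"
proof (rule computable_compose3[where h = next_e, OF _ assms])
  have "\<exists>e. state_ok t n s \<and> st_L s \<le> L \<longrightarrow>
      code_ok e (num_F (side t (Suc n)) (st_K s) * next_D t n s L) (num_F (side t n) L) \<and>
      compatible t n s L (next_D t n s L) e" if "t \<in> S" for t n s L
    using valid_tables.code_exists[OF stages.axioms(1), OF stages[OF that]] by blast
  then show "computable S (\<lambda>t z. next_e t (lt z) (lt (rt z)) (rt (rt z)))"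
    unfolding next_e_def by (intro computable_Least) (intro computable_intros)
qed

lemma computable_next_state [computable_intros]:
  assumes "computable S f" "computable S g"
  shows "computable S (\<lambda>t a. next_state fin t (f t a) (g t a))"
  unfolding next_state_def Let_def by (intro computable_intros assms)

lemma computable_state [computable_intros]:
  assumes "computable S f"
  shows "computable S (\<lambda>t a. state fin t (f t a))"
  unfolding state_def by (intro computable_intros assms)

lemma computable_stage: "computable S (stage fin)"
proof -
  have "computable S (\<lambda>t n. stage fin t n)"
    unfolding stage_def Let_def by (intro computable_intros)
  then show ?thesis .
qed

end

section \<open>The relations coded by the stages\<close>

context stages
begin

definition links :: "nat \<Rightarrow> (nat \<times> nat) set" where
  "links n = {(u, inject n u d) | u d. u < size_F n \<and> d < fan n}"

text \<open>The sum over distinct powers of 2 is \<open>set_encode\<close> of the coded relation,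
  which \<open>set_decode\<close> inverts on finite sets.\<close>

lemma stage_decode_stage:
  "stage_decode (stage fin t n) =
    (if even n then (level (Suc n), level n, (links n)\<inverse>) else (level n, level (Suc n), links n))"
proof -
  define M where "M = size_F n * fan n"
  define lk where "lk p = (p div fan n, entry (st_e (state fin t n)) p)" for p
  have lk: "lk ` {..<M} = links n"
  proof (intro equalityI subsetI)
    fix x assume "x \<in> lk ` {..<M}"
    then obtain p where p: "p < M" "x = lk p"
      by blast
    then have "p div fan n < size_F n" "p mod fan n < fan n"
      using fan_pos[of n] by (auto simp: M_def less_mult_imp_div_less)
    then show "x \<in> links n"
      unfolding links_def inject_def p(2) lk_def
      by (intro CollectI exI[of _ "p div fan n"] exI[of _ "p mod fan n"]) simp
  next
    fix x assume "x \<in> links n"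
    then obtain u d where *: "u < size_F n" "d < fan n" "x = (u, inject n u d)"
      unfolding links_def by blast
    then have "x = lk (u * fan n + d)"
      by (simp add: lk_def inject_def)
    with index_less[OF *(1,2)] show "x \<in> lk ` {..<M}"
      by (auto simp: M_def)
  qed
  \<comment> \<open>The second components alone are distinct, since the entries of the code
    are.\<close>
  have inj: "inj_on lk {..<M}"
    using code_ok[of n] by (auto simp: inj_on_def lk_def code_ok_def M_def)
  have 1: "(\<Sum>p<M. 2 ^ pair (fst (lk p)) (snd (lk p))) = set_encode (prod_encode ` links n)"
    unfolding set_encode_def lk[symmetric] image_image
    by (subst sum.reindex) (use inj in \<open>auto simp: inj_on_def prod_eq_iff\<close>)
  have conv: "(links n)\<inverse> = (\<lambda>p. (snd (lk p), fst (lk p))) ` {..<M}"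
    unfolding lk[symmetric] by (auto simp: set_eq_iff image_iff prod_eq_iff)
  have 2: "(\<Sum>p<M. 2 ^ pair (snd (lk p)) (fst (lk p))) = set_encode (prod_encode ` (links n)\<inverse>)"
    unfolding set_encode_def conv image_image
    by (subst sum.reindex) (use inj in \<open>auto simp: inj_on_def prod_eq_iff\<close>)
  have fin: "finite (links n)"
    unfolding lk[symmetric] by simp
  have "set_decode (set_encode (prod_encode ` links n)) = prod_encode ` links n"
    "set_decode (set_encode (prod_encode ` (links n)\<inverse>)) = prod_encode ` (links n)\<inverse>"
    using fin by simp_all
  then show ?thesis
    using 1 2 unfolding stage_def Let_def stage_decode_def
    by (simp add: lk_def level_def[of n, symmetric] fan_def[of n, symmetric] size_F_def[of n, symmetric] M_def[symmetric]
        st_K_state image_image)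
qed

end

section \<open>Interlaced sequences of partitions\<close>

text \<open>A family whose members are pairwise nested or disjoint becomes closed under
  intersections once the empty set is added. Cylinders form such a family.\<close>

lemma measure_eqI_nested:
  assumes E: "E \<subseteq> Pow \<Omega>" "countable E" "\<Union>E = \<Omega>"
    and nested: "\<And>A B. A \<in> E \<Longrightarrow> B \<in> E \<Longrightarrow> A \<inter> B = {} \<or> A \<subseteq> B \<or> B \<subseteq> A"
    and sets: "sets M = sigma_sets \<Omega> E" "sets M' = sigma_sets \<Omega> E"
    and eq: "\<And>A. A \<in> E \<Longrightarrow> emeasure M A = emeasure M' A"
    and fin: "\<And>A. A \<in> E \<Longrightarrow> emeasure M A \<noteq> \<infinity>"
  shows "M = M'"
proof (rule measure_eqI_generator_eq_countable)
  have "sigma_sets \<Omega> E = sigma_sets \<Omega> (insert {} E)"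
    by (rule sigma_sets_eqI) (auto intro: sigma_sets.Empty)
  then show "sets M = sigma_sets \<Omega> (insert {} E)" "sets M' = sigma_sets \<Omega> (insert {} E)"
    using sets by auto
  show "Int_stable (insert {} E)"
    unfolding Int_stable_def
  proof (intro ballI)
    fix A B assume "A \<in> insert {} E" "B \<in> insert {} E"
    then show "A \<inter> B \<in> insert {} E"
      using nested[of A B] by (auto simp: Int_absorb1 Int_absorb2)
  qed
qed (use E eq fin in auto)

text \<open>Even indices refer to the second space and odd indices to the first one, so that the roles of
  the two spaces are exchanged by a shift of the index. The maps \<open>ex n\<close> stay on one side, the maps
  \<open>io n\<close> change the side.\<close>

locale interlaced =
  fixes M :: "nat \<Rightarrow> 'p measure" and cy :: "nat \<Rightarrow> nat \<Rightarrow> 'p set"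
    and N w D P :: "nat \<Rightarrow> nat" and ex io :: "nat \<Rightarrow> nat \<Rightarrow> nat \<Rightarrow> nat"
  assumes M_period: "M (Suc (Suc n)) = M n"
    and N_pos: "0 < N n" and w_pos: "0 < w n" and D_pos: "0 < D n" and P_pos: "0 < P n"
    and cy_sets: "u < N n \<Longrightarrow> cy n u \<in> sets (M n)"
    and cy_cover: "x \<in> space (M n) \<Longrightarrow> \<exists>k. \<exists>u<N (n + 2 * k). x \<in> cy (n + 2 * k) u"
    and cy_disjoint: "u < N n \<Longrightarrow> v < N n \<Longrightarrow> x \<in> cy n u \<Longrightarrow> x \<in> cy n v \<Longrightarrow> u = v"
    and cy_split: "u < N n \<Longrightarrow> x \<in> cy n u \<Longrightarrow> \<exists>b<w n. x \<in> cy (Suc (Suc n)) (ex n u b)"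
    and ex_less: "u < N n \<Longrightarrow> b < w n \<Longrightarrow> ex n u b < N (Suc (Suc n))"
    and ex_subset: "u < N n \<Longrightarrow> b < w n \<Longrightarrow> cy (Suc (Suc n)) (ex n u b) \<subseteq> cy n u"
    and ex_inj: "u < N n \<Longrightarrow> b < w n \<Longrightarrow> u' < N n \<Longrightarrow> b' < w n \<Longrightarrow> ex n u b = ex n u' b' \<Longrightarrow>
      u = u' \<and> b = b'"
    and cy_limit: "(\<And>k. f k < N (n + 2 * k)) \<Longrightarrow> (\<And>k. g k < w (n + 2 * k)) \<Longrightarrow>
      (\<And>k. f (Suc k) = ex (n + 2 * k) (f k) (g k)) \<Longrightarrow> \<exists>x. \<forall>k. x \<in> cy (n + 2 * k) (f k)"
    and cy_separate: "(\<And>k. \<exists>u<N (n + 2 * k). x \<in> cy (n + 2 * k) u \<and> y \<in> cy (n + 2 * k) u) \<Longrightarrow> x = y"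
    and emeasure_cy: "u < N n \<Longrightarrow> emeasure (M n) (cy n u) = ennreal (1 / P n)"
    and P_Suc: "P (Suc (Suc n)) = P n * w n"
    and sets_M: "sets (M n) = sigma_sets (space (M n)) {cy (n + 2 * k) u | k u. u < N (n + 2 * k)}"
    and io_less: "u < N n \<Longrightarrow> d < D n \<Longrightarrow> io n u d < N (Suc n)"
    and io_inj: "u < N n \<Longrightarrow> d < D n \<Longrightarrow> u' < N n \<Longrightarrow> d' < D n \<Longrightarrow> io n u d = io n u' d' \<Longrightarrow> u = u' \<and> d = d'"
    and io_io: "u < N n \<Longrightarrow> d < D n \<Longrightarrow> d' < D (Suc n) \<Longrightarrow>
      io (Suc n) (io n u d) d' = ex n u (d + D n * d')"
    and DD_le: "D n * D (Suc n) \<le> w n"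
    and summable_loss: "summable (\<lambda>n. 1 - real (D n * D (Suc n)) / w n)"
begin

lemma M_period' [simp]: "M (n + 2 * k) = M n"
  by (induction k) (simp_all add: M_period)

text \<open>This exchanges the two spaces, so that every result proved for the even side, such as
  uniqueness of partners, is also available for the odd side.\<close>

lemma shift: "interlaced (\<lambda>n. M (Suc n)) (\<lambda>n. cy (Suc n)) (\<lambda>n. N (Suc n)) (\<lambda>n. w (Suc n))
  (\<lambda>n. D (Suc n)) (\<lambda>n. P (Suc n)) (\<lambda>n. ex (Suc n)) (\<lambda>n. io (Suc n))"
proof
  fix n x y
  show "x = y" if "\<And>k. \<exists>u<N (Suc (n + 2 * k)). x \<in> cy (Suc (n + 2 * k)) u \<and> y \<in> cy (Suc (n + 2 * k)) u"
    using cy_separate[of "Suc n"] that by simp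
next
  fix n and v b :: "nat \<Rightarrow> nat"
  assume "\<And>k. v k < N (Suc (n + 2 * k))" "\<And>k. b k < w (Suc (n + 2 * k))"
    "\<And>k. v (Suc k) = ex (Suc (n + 2 * k)) (v k) (b k)"
  then show "\<exists>x. \<forall>k. x \<in> cy (Suc (n + 2 * k)) (v k)"
    using cy_limit[of v "Suc n" b] by simp
next
  fix n x assume "x \<in> space (M (Suc n))"
  then show "\<exists>k. \<exists>u<N (Suc (n + 2 * k)). x \<in> cy (Suc (n + 2 * k)) u"
    using cy_cover[of x "Suc n"] by simp
next
  fix n
  show "sets (M (Suc n)) = sigma_sets (space (M (Suc n))) {cy (Suc (n + 2 * k)) u |k u. u < N (Suc (n + 2 * k))}"
    using sets_M[of "Suc n"] by simp
next
  show "summable (\<lambda>n. 1 - real (D (Suc n) * D (Suc (Suc n))) / real (w (Suc n)))"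
    using summable_loss summable_Suc_iff[of "\<lambda>n. 1 - real (D n * D (Suc n)) / w n"] by simp
qed (fact M_period N_pos w_pos D_pos P_pos cy_sets cy_disjoint cy_split ex_less ex_subset ex_inj emeasure_cy
    P_Suc io_less io_inj io_io DD_le)+

lemma cy_subset_space: "u < N n \<Longrightarrow> cy n u \<subseteq> space (M n)"
  using cy_sets sets.sets_into_space by blast

lemma cy_refine:
  assumes "u < N n" "x \<in> cy n u"
  shows "\<exists>v<N (n + 2 * k). x \<in> cy (n + 2 * k) v \<and> cy (n + 2 * k) v \<subseteq> cy n u"
proof (induction k)
  case (Suc k)
  then obtain v where v: "v < N (n + 2 * k)" "x \<in> cy (n + 2 * k) v" "cy (n + 2 * k) v \<subseteq> cy n u"
    by blast
  then obtain b where "b < w (n + 2 * k)" "x \<in> cy (Suc (Suc (n + 2 * k))) (ex (n + 2 * k) v b)"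
    using cy_split by blast
  then show ?case
    using v(3) ex_less[OF v(1)] ex_subset[OF v(1)]
      by (intro exI[of _ "ex (n + 2 * k) v b"]) (auto dest: subsetD)
qed (use assms in auto)

lemma cy_nested:
  assumes "u < N n" "v < N (n + 2 * k)" "x \<in> cy n u" "x \<in> cy (n + 2 * k) v"
  shows "cy (n + 2 * k) v \<subseteq> cy n u"
  using cy_refine[OF assms(1,3), of k] cy_disjoint[OF assms(2) _ assms(4)] by blast


subsection \<open>Threads\<close>

text \<open>The address of a matched pair from stage \<open>m\<close> on: entries at even
  \<open>n\<close> locate the point of \<open>M 0\<close>, entries at odd \<open>n\<close> the point
  of \<open>M 1\<close>.\<close>

definition thread :: "nat \<Rightarrow> (nat \<Rightarrow> nat) \<Rightarrow> (nat \<Rightarrow> nat) \<Rightarrow> bool" where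
  "thread m v \<delta> \<longleftrightarrow> (\<forall>n\<ge>m. v n < N n \<and> \<delta> n < D n \<and> v (Suc n) = io n (v n) (\<delta> n))"

text \<open>The number of the word that a thread reads between \<open>n\<close> and
  \<open>n + 2\<close>, hence on one side only.\<close>

definition block :: "(nat \<Rightarrow> nat) \<Rightarrow> nat \<Rightarrow> nat" where
  "block \<delta> n = \<delta> n + D n * \<delta> (Suc n)"

lemma thread_mono: "thread m v \<delta> \<Longrightarrow> m \<le> n \<Longrightarrow> thread n v \<delta>"
  by (auto simp: thread_def)

lemma block_less:
  assumes "thread m v \<delta>" "m \<le> n"
  shows "block \<delta> n < D n * D (Suc n)" "block \<delta> n < w n"
proof -
  have "\<delta> n < D n" "\<delta> (Suc n) < D (Suc n)"
    using assms by (auto simp: thread_def)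
  from mixed_radix_less[OF this] DD_le[of n] show "block \<delta> n < D n * D (Suc n)" "block \<delta> n < w n"
    unfolding block_def by linarith+
qed

lemma thread_step: "thread m v \<delta> \<Longrightarrow> m \<le> n \<Longrightarrow> v (Suc (Suc n)) = ex n (v n) (block \<delta> n)"
  unfolding thread_def block_def using io_io by simp

lemma thread_limit:
  assumes "thread m v \<delta>" "m \<le> n"
  shows "\<exists>x. \<forall>k. x \<in> cy (n + 2 * k) (v (n + 2 * k))"
proof (rule cy_limit[of "\<lambda>k. v (n + 2 * k)" n "\<lambda>k. block \<delta> (n + 2 * k)"])
  show "v (n + 2 * Suc k) = ex (n + 2 * k) (v (n + 2 * k)) (block \<delta> (n + 2 * k))" for k
    using thread_step[OF assms(1), of "n + 2 * k"] assms(2) by simp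
qed (use assms block_less(2)[OF assms(1)] in \<open>auto simp: thread_def\<close>)

text \<open>\<open>cell m u\<close> consists of the points of \<open>cy m u\<close> whose blocks from \<open>m\<close> on are all of the form
  \<open>d + D n * d'\<close>.\<close>

primrec cell_approx :: "nat \<Rightarrow> nat \<Rightarrow> nat \<Rightarrow> 'p set" where
  "cell_approx 0 m u = cy m u"
| "cell_approx (Suc K) m u = (\<Union>b<D m * D (Suc m). cell_approx K (Suc (Suc m)) (ex m u b))"

definition cell :: "nat \<Rightarrow> nat \<Rightarrow> 'p set" where
  "cell m u = (\<Inter>K. cell_approx K m u)"

lemma less_DD_less_w: "b < D n * D (Suc n) \<Longrightarrow> b < w n"
  using DD_le[of n] by linarith

lemma cell_approx_subset: "u < N m \<Longrightarrow> cell_approx K m u \<subseteq> cy m u"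
proof (induction K arbitrary: m u)
  case (Suc K)
  have "cell_approx K (Suc (Suc m)) (ex m u b) \<subseteq> cy m u" if "b < D m * D (Suc m)" for b
    using Suc.IH[OF ex_less[OF Suc.prems]] ex_subset[OF Suc.prems] less_DD_less_w[OF that]
    by (meson subset_trans)
  then show ?case
    by (auto simp del: cell_approx.simps(1))
qed simp

lemma cell_approx_decreasing: "u < N m \<Longrightarrow> cell_approx (Suc K) m u \<subseteq> cell_approx K m u"
proof (induction K arbitrary: m u)
  case 0
  then show ?case
    using cell_approx_subset[of u m "Suc 0"] by simp
next
  case (Suc K)
  have "cell_approx (Suc K) (Suc (Suc m)) (ex m u b) \<subseteq> cell_approx K (Suc (Suc m)) (ex m u b)"
    if "b < D m * D (Suc m)" for b
    using Suc.IH[OF ex_less] Suc.prems less_DD_less_w that by blast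
  then show ?case
    unfolding cell_approx.simps(2)[of "Suc K"] cell_approx.simps(2)[of K m] by blast
qed

lemma cell_subset: "cell m u \<subseteq> cy m u"
  unfolding cell_def using cell_approx.simps(1) by blast

text \<open>The union over \<open>b\<close> commutes with the intersection over \<open>K\<close>,
  because disjointness of the cylinders forces the same \<open>b\<close> at every depth.\<close>

lemma cell_unfold:
  assumes u: "u < N m"
  shows "cell m u = (\<Union>b<D m * D (Suc m). cell (Suc (Suc m)) (ex m u b))"
proof (intro equalityI subsetI)
  fix x assume x: "x \<in> cell m u"
  then have "x \<in> cell_approx (Suc 0) m u"
    unfolding cell_def by blast
  then obtain b where b: "b < D m * D (Suc m)" "x \<in> cy (Suc (Suc m)) (ex m u b)"
    by auto
  have "x \<in> cell_approx K (Suc (Suc m)) (ex m u b)" for K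
  proof -
    have "x \<in> cell_approx (Suc K) m u"
      using x unfolding cell_def by blast
    then obtain b' where b': "b' < D m * D (Suc m)" "x \<in> cell_approx K (Suc (Suc m)) (ex m u b')"
      by auto
    then have "x \<in> cy (Suc (Suc m)) (ex m u b')"
      using cell_approx_subset ex_less[OF u] less_DD_less_w by blast
    then have "ex m u b' = ex m u b"
      using b b'(1) ex_less[OF u] less_DD_less_w cy_disjoint by blast
    with b' show ?thesis
      by simp
  qed
  with b show "x \<in> (\<Union>b<D m * D (Suc m). cell (Suc (Suc m)) (ex m u b))"
    unfolding cell_def by blast
next
  fix x assume "x \<in> (\<Union>b<D m * D (Suc m). cell (Suc (Suc m)) (ex m u b))"
  then obtain b where b: "b < D m * D (Suc m)" "x \<in> cell (Suc (Suc m)) (ex m u b)"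
    by blast
  have "x \<in> cell_approx K m u" for K
  proof (cases K)
    case 0
    then show ?thesis
      using b(2) subsetD[OF cell_subset] subsetD[OF ex_subset[OF u less_DD_less_w[OF b(1)]]] by simp
  next
    case (Suc K')
    then show ?thesis
      using b unfolding cell_def by auto
  qed
  then show "x \<in> cell m u"
    unfolding cell_def by blast
qed

lemma thread_cell:
  assumes "thread m v \<delta>" and x: "\<And>k. x \<in> cy (m + 2 * k) (v (m + 2 * k))"
  shows "x \<in> cell m (v m)"
proof -
  have "x \<in> cell_approx K (m + 2 * k) (v (m + 2 * k))" for K k
  proof (induction K arbitrary: k)
    case (Suc K)
    have "x \<in> cell_approx K (Suc (Suc (m + 2 * k))) (ex (m + 2 * k) (v (m + 2 * k)) (block \<delta> (m + 2 * k)))"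
      using Suc[of "Suc k"] thread_step[OF assms(1), of "m + 2 * k"] by simp
    then show ?case
      using block_less(1)[OF assms(1), of "m + 2 * k"] by auto
  qed (use x in simp)
  from this[of _ 0] show ?thesis
    by (simp add: cell_def)
qed

text \<open>Blocks below \<open>D n * D (Suc n)\<close> split into two digits. These digits also
  determine a path on the other side, so membership in a cell on one side already yields a full
  thread.\<close>

lemma cell_thread:
  assumes u: "u < N m" and x: "x \<in> cell m u"
  shows "\<exists>v \<delta>. thread m v \<delta> \<and> v m = u \<and> (\<forall>k. x \<in> cy (m + 2 * k) (v (m + 2 * k)))"
proof -
  have "\<exists>g. \<forall>k. (g k < N (m + 2 * k) \<and> x \<in> cell (m + 2 * k) (g k) \<and> (k = 0 \<longrightarrow> g k = u)) \<and>
      (\<exists>b<D (m + 2 * k) * D (Suc (m + 2 * k)). g (Suc k) = ex (m + 2 * k) (g k) b)"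
  proof (rule dependent_nat_choice)
    show "\<exists>y. y < N (m + 2 * 0) \<and> x \<in> cell (m + 2 * 0) y \<and> (0 = (0::nat) \<longrightarrow> y = u)"
      using u x by auto
  next
    fix y k assume y: "y < N (m + 2 * k) \<and> x \<in> cell (m + 2 * k) y \<and> (k = 0 \<longrightarrow> y = u)"
    then obtain b where b: "b < D (m + 2 * k) * D (Suc (m + 2 * k))"
      "x \<in> cell (Suc (Suc (m + 2 * k))) (ex (m + 2 * k) y b)"
      using cell_unfold[of y "m + 2 * k"] by auto
    then show "\<exists>y'. (y' < N (m + 2 * Suc k) \<and> x \<in> cell (m + 2 * Suc k) y' \<and> (Suc k = 0 \<longrightarrow> y' = u)) \<and>
        (\<exists>b<D (m + 2 * k) * D (Suc (m + 2 * k)). y' = ex (m + 2 * k) y b)"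
      using y ex_less less_DD_less_w by (intro exI[of _ "ex (m + 2 * k) y b"]) auto
  qed
  then obtain g where g: "\<And>k. g k < N (m + 2 * k)" "\<And>k. x \<in> cell (m + 2 * k) (g k)" "g 0 = u"
    "\<And>k. \<exists>b<D (m + 2 * k) * D (Suc (m + 2 * k)). g (Suc k) = ex (m + 2 * k) (g k) b"
    by blast
  from g(4) obtain \<beta> where \<beta>: "\<And>k. \<beta> k < D (m + 2 * k) * D (Suc (m + 2 * k))"
    "\<And>k. g (Suc k) = ex (m + 2 * k) (g k) (\<beta> k)"
    by metis
  \<comment> \<open>At distance \<open>2 * k\<close> from \<open>m\<close> the digit is the
    remainder of the \<open>k\<close>-th block, one step later it is the quotient. The entries of
    \<open>v\<close> on the other side are obtained by applying \<open>io\<close> to those of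
    \<open>g\<close>.\<close>
  define \<delta> where "\<delta> n = (let k = (n - m) div 2 in
    if even (n - m) then \<beta> k mod D (m + 2 * k) else \<beta> k div D (m + 2 * k))" for n
  define v where "v n = (let k = (n - m) div 2 in
    if even (n - m) then g k else io (m + 2 * k) (g k) (\<beta> k mod D (m + 2 * k)))" for n
  have v: "v (m + 2 * k) = g k" "v (Suc (m + 2 * k)) = io (m + 2 * k) (g k) (\<delta> (m + 2 * k))"
    "\<delta> (m + 2 * k) = \<beta> k mod D (m + 2 * k)" "\<delta> (Suc (m + 2 * k)) = \<beta> k div D (m + 2 * k)" for k
    by (simp_all add: v_def \<delta>_def Let_def)
  have \<delta>: "\<delta> (m + 2 * k) < D (m + 2 * k)" "\<delta> (Suc (m + 2 * k)) < D (Suc (m + 2 * k))" for k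
    using \<beta>(1)[of k] D_pos[of "m + 2 * k"] unfolding v(3,4) by (simp_all add: less_mult_imp_div_less mult.commute)
  have "thread m v \<delta>"
    unfolding thread_def
  proof (intro allI impI)
    fix n assume "m \<le> n"
    then obtain j where j: "n = m + j"
      using le_Suc_ex by blast
    show "v n < N n \<and> \<delta> n < D n \<and> v (Suc n) = io n (v n) (\<delta> n)"
    proof (cases "even j")
      case True
      then obtain k where k: "n = m + 2 * k"
        using j by (auto elim: evenE)
      show ?thesis
        unfolding k using g(1) \<delta> v by simp
    next
      case False
      then obtain k where k: "n = Suc (m + 2 * k)"
        using j by (auto elim: oddE)
      have "v (Suc (Suc (m + 2 * k))) = g (Suc k)"
        using v(1)[of "Suc k"] by simp
      also have "\<dots> = ex (m + 2 * k) (g k) (\<delta> (m + 2 * k) + D (m + 2 * k) * \<delta> (Suc (m + 2 * k)))"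
        by (simp add: \<beta>(2) v)
      also have "\<dots> = io n (v n) (\<delta> n)"
        unfolding k v(2) by (rule io_io[symmetric]) (use g(1) \<delta> in auto)
      finally show ?thesis
        unfolding k using io_less[OF g(1) \<delta>(1)] \<delta>(2) v(2) by simp
    qed
  qed
  moreover have "v m = u"
    using v(1)[of 0] g(3) by simp
  moreover have "x \<in> cy (m + 2 * k) (v (m + 2 * k))" for k
    using g(2) cell_subset v(1) by auto
  ultimately show ?thesis
    by blast
qed


subsection \<open>Measures of cells\<close>

lemma cell_approx_sets: "u < N m \<Longrightarrow> cell_approx K m u \<in> sets (M m)"
proof (induction K arbitrary: m u)
  case (Suc K)
  have "cell_approx K (Suc (Suc m)) (ex m u b) \<in> sets (M m)" if "b < D m * D (Suc m)" for b
    using Suc.IH[OF ex_less] Suc.prems that less_DD_less_w M_period by metis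
  then show ?case
    by auto
qed (simp add: cy_sets)

lemma cell_sets: "u < N m \<Longrightarrow> cell m u \<in> sets (M m)"
  unfolding cell_def using cell_approx_sets by (intro sets.countable_INT) auto

lemma ex_disjoint:
  assumes u: "u < N m" and A: "\<And>v. v < N (Suc (Suc m)) \<Longrightarrow> A v \<subseteq> cy (Suc (Suc m)) v"
  shows "disjoint_family_on (\<lambda>b. A (ex m u b)) {..<w m}"
  unfolding disjoint_family_on_def
proof (intro ballI impI)
  fix b b' assume *: "b \<in> {..<w m}" "b' \<in> {..<w m}" "b \<noteq> b'"
  then have "ex m u b \<noteq> ex m u b'"
    using ex_inj[OF u _ u] by blast
  then show "A (ex m u b) \<inter> A (ex m u b') = {}"
    using A[OF ex_less[OF u, of b]] A[OF ex_less[OF u, of b']] *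
      cy_disjoint[OF ex_less[OF u, of b] ex_less[OF u, of b']]
    by blast
qed

text \<open>No \<open>u\<close> enters: each step has the same number of admissible blocks in all
  cylinders of a level.\<close>

primrec weight_approx :: "nat \<Rightarrow> nat \<Rightarrow> ennreal" where
  "weight_approx 0 m = ennreal (1 / P m)"
| "weight_approx (Suc K) m = of_nat (D m * D (Suc m)) * weight_approx K (Suc (Suc m))"

lemma emeasure_cell_approx: "u < N m \<Longrightarrow> emeasure (M m) (cell_approx K m u) = weight_approx K m"
proof (induction K arbitrary: m u)
  case (Suc K)
  let ?A = "\<lambda>b. cell_approx K (Suc (Suc m)) (ex m u b)"
  have "disjoint_family_on ?A {..<w m}"
    by (rule ex_disjoint[OF Suc.prems cell_approx_subset])
  then have "disjoint_family_on ?A {..<D m * D (Suc m)}"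
    by (rule disjoint_family_on_mono[rotated]) (use DD_le[of m] in auto)
  moreover have "?A ` {..<D m * D (Suc m)} \<subseteq> sets (M m)"
    using cell_approx_sets[OF ex_less[OF Suc.prems less_DD_less_w]] by (auto simp: M_period)
  ultimately have "emeasure (M m) (cell_approx (Suc K) m u) = (\<Sum>b<D m * D (Suc m). emeasure (M m) (?A b))"
    by (simp add: sum_emeasure)
  also have "\<dots> = (\<Sum>b<D m * D (Suc m). weight_approx K (Suc (Suc m)))"
    using Suc.IH[OF ex_less[OF Suc.prems]] less_DD_less_w M_period by (intro sum.cong) auto
  finally show ?case
    by simp
qed (simp add: emeasure_cy)

text \<open>Position 0 merely serves as a representative; all cells of the level have this
  measure.\<close>

definition weight :: "nat \<Rightarrow> ennreal" where
  "weight m = emeasure (M m) (cell m 0)"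

text \<open>Continuity from above along the approximations, whose measures depend on
  \<open>m\<close> and \<open>K\<close> only.\<close>

lemma emeasure_cell: "u < N m \<Longrightarrow> emeasure (M m) (cell m u) = weight m"
proof -
  have *: "emeasure (M m) (cell m u) = (INF K. weight_approx K m)" if "u < N m" for u
  proof -
    have "emeasure (M m) (cell m u) = (INF K. emeasure (M m) (cell_approx K m u))"
      unfolding cell_def
    proof (rule INF_emeasure_decseq[symmetric])
      show "emeasure (M m) (cell_approx K m u) \<noteq> \<infinity>" for K
        using emeasure_mono[OF cell_approx_subset[OF that] cy_sets[OF that]] emeasure_cy[OF that]
        by (metis ennreal_neq_top infinity_ennreal_def top.extremum_uniqueI)
    qed (use cell_approx_sets[OF that] cell_approx_decreasing[OF that] in \<open>auto intro!: decseq_SucI simp del: cell_approx.simps\<close>)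
    then show ?thesis
      by (simp add: emeasure_cell_approx[OF that])
  qed
  assume "u < N m"
  then show ?thesis
    using *[of u] *[OF N_pos] by (simp add: weight_def)
qed

lemma weight_step: "weight m = of_nat (D m * D (Suc m)) * weight (Suc (Suc m))"
proof -
  let ?A = "\<lambda>b. cell (Suc (Suc m)) (ex m 0 b)"
  have "disjoint_family_on ?A {..<w m}"
    by (rule ex_disjoint[OF N_pos cell_subset])
  then have "disjoint_family_on ?A {..<D m * D (Suc m)}"
    by (rule disjoint_family_on_mono[rotated]) (use DD_le[of m] in auto)
  moreover have "?A ` {..<D m * D (Suc m)} \<subseteq> sets (M m)"
    using cell_sets[OF ex_less[OF N_pos less_DD_less_w]] by (auto simp: M_period)
  ultimately have "weight m = (\<Sum>b<D m * D (Suc m). emeasure (M m) (?A b))"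
    unfolding weight_def cell_unfold[OF N_pos] by (simp add: sum_emeasure)
  also have "\<dots> = (\<Sum>b<D m * D (Suc m). weight (Suc (Suc m)))"
    using emeasure_cell[OF ex_less[OF N_pos]] less_DD_less_w M_period by (intro sum.cong) auto
  finally show ?thesis
    by simp
qed

lemma weight_finite: "weight m < \<infinity>"
proof -
  have "weight m \<le> emeasure (M m) (cy m 0)"
    unfolding weight_def by (rule emeasure_mono[OF cell_subset cy_sets[OF N_pos]])
  also have "\<dots> < \<infinity>"
    by (simp add: emeasure_cy N_pos)
  finally show ?thesis .
qed

text \<open>The points lost at \<open>n\<close>: their block is too large to be split into two
  digits.\<close>

definition bad :: "nat \<Rightarrow> 'p set" where
  "bad n = (\<Union>u<N n. \<Union>b\<in>{D n * D (Suc n)..<w n}. cy (Suc (Suc n)) (ex n u b))"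

lemma bad_sets: "bad n \<in> sets (M n)"
proof -
  have "cy (Suc (Suc n)) (ex n u b) \<in> sets (M n)" if "u < N n" "b < w n" for u b
    using cy_sets[OF ex_less[OF that]] by (simp add: M_period)
  then show ?thesis
    unfolding bad_def by (intro sets.finite_UN) auto
qed

text \<open>In every cylinder of level \<open>n\<close> the bad part has the proportion
  \<open>1 - D n * D (Suc n) / w n\<close>. The induction passes this on to cylinders of earlier
  levels, which are disjoint unions of later ones.\<close>

lemma emeasure_bad:
  "v < N j \<Longrightarrow> emeasure (M j) (cy j v \<inter> bad (j + 2 * k)) =
    ennreal ((1 / P j) * (1 - real (D (j + 2 * k) * D (Suc (j + 2 * k))) / w (j + 2 * k)))"
proof (induction k arbitrary: j v)
  case 0
  let ?A = "\<lambda>b. cy (Suc (Suc j)) (ex j v b)" and ?I = "{D j * D (Suc j)..<w j}"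
  have eq: "cy j v \<inter> bad j = (\<Union>b\<in>?I. ?A b)"
  proof (intro equalityI subsetI)
    fix x assume "x \<in> cy j v \<inter> bad j"
    then obtain u b where "x \<in> cy j v" "u < N j" "b \<in> ?I" "x \<in> cy (Suc (Suc j)) (ex j u b)"
      unfolding bad_def by auto
    moreover from this have "u = v"
      using ex_subset[of u j b] cy_disjoint[OF _ 0] by auto
    ultimately show "x \<in> (\<Union>b\<in>?I. ?A b)"
      by blast
  next
    fix x assume "x \<in> (\<Union>b\<in>?I. ?A b)"
    then show "x \<in> cy j v \<inter> bad j"
    proof -
      obtain b where b: "b \<in> ?I" "x \<in> ?A b"
        using \<open>x \<in> (\<Union>b\<in>?I. ?A b)\<close> by blast
      then have "x \<in> cy j v"
        using ex_subset[OF 0, of b] by auto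
      moreover have "x \<in> bad j"
        unfolding bad_def using 0 b by blast
      ultimately show ?thesis
        by blast
    qed
  qed
  have "disjoint_family_on ?A ?I"
    using ex_disjoint[OF 0 order_refl] by (rule disjoint_family_on_mono[rotated]) auto
  moreover have "?A ` ?I \<subseteq> sets (M j)"
    using cy_sets[OF ex_less[OF 0]] by (auto simp: M_period)
  ultimately have "emeasure (M j) (cy j v \<inter> bad j) = (\<Sum>b\<in>?I. emeasure (M j) (?A b))"
    by (simp add: eq sum_emeasure)
  also have "\<dots> = (\<Sum>b\<in>?I. ennreal (1 / (P j * w j)))"
    using emeasure_cy[OF ex_less[OF 0]] M_period P_Suc by (intro sum.cong) auto
  also have "\<dots> = ennreal (real (w j - D j * D (Suc j)) * (1 / (P j * w j)))"
    by (subst ennreal_mult) (simp_all add: ennreal_of_nat_eq_real_of_nat)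
  also have "real (w j - D j * D (Suc j)) * (1 / (P j * w j)) =
      (1 / P j) * (1 - real (D j * D (Suc j)) / w j)"
  proof -
    have "real (P j * w j) = real (P j) * real (w j)"
      by simp
    then show ?thesis
      using w_pos[of j] DD_le[of j] by (simp add: of_nat_diff field_simps del: of_nat_mult)
  qed
  finally show ?case
    by simp
next
  case (Suc k)
  let ?n = "Suc (Suc j) + 2 * k"
  let ?A = "\<lambda>b. cy (Suc (Suc j)) (ex j v b) \<inter> bad ?n"
  let ?r = "1 - real (D ?n * D (Suc ?n)) / w ?n"
  have "cy j v = (\<Union>b<w j. cy (Suc (Suc j)) (ex j v b))"
    using cy_split[OF Suc.prems] ex_subset[OF Suc.prems] by (auto dest!: subsetD)
  then have "cy j v \<inter> bad ?n = (\<Union>b<w j. ?A b)"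
    by blast
  moreover have "disjoint_family_on ?A {..<w j}"
    using ex_disjoint[OF Suc.prems, of "\<lambda>u. cy (Suc (Suc j)) u \<inter> bad ?n"] by auto
  moreover have "?A ` {..<w j} \<subseteq> sets (M j)"
  proof -
    have "bad ?n \<in> sets (M j)"
      using bad_sets[of ?n] M_period'[of "Suc (Suc j)" k] M_period[of j] by simp
    then show ?thesis
      using cy_sets[OF ex_less[OF Suc.prems]] by (auto simp: M_period)
  qed
  ultimately have "emeasure (M j) (cy j v \<inter> bad ?n) = (\<Sum>b<w j. emeasure (M j) (?A b))"
    by (simp add: sum_emeasure)
  also have "\<dots> = (\<Sum>b<w j. ennreal ((1 / P (Suc (Suc j))) * ?r))"
    using Suc.IH[OF ex_less[OF Suc.prems]] M_period[of j] by (intro sum.cong) auto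
  also have "\<dots> = ennreal (real (w j) * ((1 / P (Suc (Suc j))) * ?r))"
    using DD_le[of ?n] w_pos[of ?n]
    by (subst ennreal_mult) (auto simp: ennreal_of_nat_eq_real_of_nat divide_le_eq simp del: of_nat_mult)
  also have "real (w j) * ((1 / P (Suc (Suc j))) * ?r) = (1 / P j) * ?r"
    using w_pos[of j] by (simp add: P_Suc)
  finally show ?case
    by simp
qed

text \<open>Borel-Cantelli inside each cylinder: the bad parts have summable measures, so almost
  every point is bad only finitely often, and after the last time it lies in a cell.\<close>

lemma AE_cell: "AE x in M n. \<exists>k. \<exists>u<N (n + 2 * k). x \<in> cell (n + 2 * k) u"
proof -
  let ?G = "\<lambda>x. \<exists>k. \<exists>u<N (n + 2 * k). x \<in> cell (n + 2 * k) u"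
  have "AE x in M n. x \<in> cy (n + 2 * j) v \<longrightarrow> ?G x" if v: "v < N (n + 2 * j)" for j v
  proof -
    let ?m = "n + 2 * j"
    let ?B = "\<lambda>k. cy ?m v \<inter> bad (?m + 2 * k)"
    let ?r = "\<lambda>k. (1 / P ?m) * (1 - real (D (?m + 2 * k) * D (Suc (?m + 2 * k))) / w (?m + 2 * k))"
    have B: "?B k \<in> sets (M n)" for k
      using bad_sets[of "?m + 2 * k"] cy_sets[OF v] by (simp flip: M_period'[of ?m k])
    have eB: "emeasure (M n) (?B k) = ennreal (?r k)" for k
      using emeasure_bad[OF v, of k] by simp
    have r0: "0 \<le> ?r k" for k
      using DD_le[of "?m + 2 * k"] w_pos[of "?m + 2 * k"] P_pos[of ?m] by (simp add: divide_le_eq del: of_nat_mult)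
    have mB: "measure (M n) (?B k) = ?r k" for k
      using eB r0 by (simp add: measure_def)
    have "strict_mono (\<lambda>k. ?m + 2 * k)"
      by (simp add: strict_mono_def)
    then have inj: "inj (\<lambda>k. ?m + 2 * k)"
      by (rule strict_mono_imp_inj_on)
    \<comment> \<open>Unconditional summability is inherited by the indices of one parity.\<close>
    have "(\<lambda>n. 1 - real (D n * D (Suc n)) / w n) summable_on UNIV"
      using summable_loss DD_le w_pos
      by (intro summable_nonneg_imp_summable_on) (auto simp: divide_le_eq simp del: of_nat_mult)
    then have "(\<lambda>n. 1 - real (D n * D (Suc n)) / w n) summable_on range (\<lambda>k. ?m + 2 * k)"
      by (rule summable_on_subset_banach) simp
    then have "(\<lambda>k. 1 - real (D (?m + 2 * k) * D (Suc (?m + 2 * k))) / w (?m + 2 * k)) summable_on UNIV"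
      unfolding summable_on_reindex[OF inj] o_def .
    then have "summable ?r"
      by (intro summable_mult summable_on_imp_summable)
    then have "AE x in M n. eventually (\<lambda>k. x \<in> space (M n) - ?B k) sequentially"
      using B by (intro borel_cantelli_AE1) (simp_all only: mB eB ennreal_less_top infinity_ennreal_def)
    then show ?thesis
    proof eventually_elim
      case (elim x)
      show ?case
      proof
        assume x: "x \<in> cy ?m v"
        obtain K where K: "\<And>k. K \<le> k \<Longrightarrow> x \<notin> bad (?m + 2 * k)"
          using elim x unfolding eventually_sequentially by blast
        obtain u where u: "u < N (?m + 2 * K)" "x \<in> cy (?m + 2 * K) u"
          using cy_refine[OF v x] by blast
        have "x \<in> cell_approx L (?m + 2 * k) u" if "K \<le> k" "u < N (?m + 2 * k)" "x \<in> cy (?m + 2 * k) u" for L k u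
          using that
        proof (induction L arbitrary: k u)
          case (Suc L)
          let ?n = "?m + 2 * k"
          obtain b where b: "b < w ?n" "x \<in> cy (Suc (Suc ?n)) (ex ?n u b)"
            using cy_split[OF Suc.prems(2,3)] by blast
          have "b < D ?n * D (Suc ?n)"
          proof (rule ccontr)
            assume "\<not> b < D ?n * D (Suc ?n)"
            then have "x \<in> bad ?n"
              unfolding bad_def using b Suc.prems(2) by (intro UN_I[of u] UN_I[of b]) auto
            with K[OF Suc.prems(1)] show False
              by simp
          qed
          moreover have "x \<in> cell_approx L (Suc (Suc ?n)) (ex ?n u b)"
            using Suc.IH[of "Suc k" "ex ?n u b"] Suc.prems(1) b ex_less[OF Suc.prems(2) b(1)] by simp
          ultimately show ?case
            by auto
        qed simp
        then have "x \<in> cell (?m + 2 * K) u"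
          using u unfolding cell_def by blast
        then show "?G x" using u(1)
          by - (rule exI[of _ "j + K"], rule exI[of _ u], simp add: algebra_simps)
      qed
    qed
  qed
  then have "AE x in M n. \<forall>j. \<forall>v\<in>{..<N (n + 2 * j)}. x \<in> cy (n + 2 * j) v \<longrightarrow> ?G x"
    unfolding AE_all_countable by (intro allI AE_ball_countable[THEN iffD2] ballI) auto
  then show ?thesis
  proof (rule AE_mp, intro AE_I2 impI)
    fix x assume "x \<in> space (M n)" "\<forall>j. \<forall>v\<in>{..<N (n + 2 * j)}. x \<in> cy (n + 2 * j) v \<longrightarrow> ?G x"
    then show "?G x"
      using cy_cover[of x n] by blast
  qed
qed

text \<open>If one weight were 0, \<open>weight_step\<close> would annihilate all later weights of
  the same parity, so all cells from there on would be null sets, against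
  \<open>AE_cell\<close>.\<close>

lemma weight_pos: "0 < weight m"
proof (rule ccontr)
  assume "\<not> 0 < weight m"
  then have zero: "weight (m + 2 * k) = 0" for k
  proof (induction k)
    case (Suc k)
    then show ?case
      using weight_step[of "m + 2 * k"] D_pos[of "m + 2 * k"] D_pos[of "Suc (m + 2 * k)"] by auto
  qed simp
  have "AE x in M m. \<forall>k. \<forall>u\<in>{..<N (m + 2 * k)}. x \<notin> cell (m + 2 * k) u"
    unfolding AE_all_countable
  proof (intro allI AE_ball_countable[THEN iffD2] ballI)
    fix k u assume "u \<in> {..<N (m + 2 * k)}"
    then show "AE x in M m. x \<notin> cell (m + 2 * k) u"
      using emeasure_cell[of u "m + 2 * k"] zero[of k] cell_sets[of u "m + 2 * k"]
      by (intro AE_not_in) (auto intro: null_setsI)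
  qed simp
  with AE_cell[of m] have "AE x in M m. False"
    by eventually_elim blast
  then have "emeasure (M m) (space (M m)) = 0"
    by (simp add: AE_iff_null null_sets_def)
  then have "emeasure (M m) (cy m 0) = 0"
    by (metis cy_subset_space N_pos emeasure_mono le_zero_eq sets.top)
  then show False
    using emeasure_cy[OF N_pos, of m] P_pos[of m] by simp
qed

subsection \<open>The matching of points\<close>

definition match :: "'p \<Rightarrow> 'p \<Rightarrow> bool" where
  "match x y \<longleftrightarrow> (\<exists>m v \<delta>. thread m v \<delta> \<and> (\<forall>n\<ge>m. (if even n then x else y) \<in> cy n (v n)))"

text \<open>The two points read the same word numbers \<open>b\<close> from some level on, that is,
  they have representatives with a common tail.\<close>

definition tail :: "nat \<Rightarrow> 'p \<Rightarrow> 'p \<Rightarrow> bool" where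
  "tail n x x' \<longleftrightarrow> (\<exists>k v v' b. \<forall>l\<ge>k. v l < N (n + 2 * l) \<and> v' l < N (n + 2 * l) \<and> b l < w (n + 2 * l) \<and>
     x \<in> cy (n + 2 * l) (v l) \<and> x' \<in> cy (n + 2 * l) (v' l) \<and>
     v (Suc l) = ex (n + 2 * l) (v l) (b l) \<and> v' (Suc l) = ex (n + 2 * l) (v' l) (b l))"

text \<open>Two threads through \<open>x\<close> agree at even levels since cylinders are disjoint.
  By \<open>ex_inj\<close> they then have equal blocks, hence equal digits, hence equal entries at
  odd levels, and these separate points.\<close>

lemma match_unique_right:
  assumes "match x y" "match x y'"
  shows "y = y'"
proof -
  obtain m v \<delta> where t: "thread m v \<delta>" and 1: "\<And>n. m \<le> n \<Longrightarrow> (if even n then x else y) \<in> cy n (v n)"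
    using assms(1) unfolding match_def by blast
  obtain m' v' \<delta>' where t': "thread m' v' \<delta>'"
    and 2: "\<And>n. m' \<le> n \<Longrightarrow> (if even n then x else y') \<in> cy n (v' n)"
    using assms(2) unfolding match_def by blast
  have eq: "v n = v' n" if "even n" "m \<le> n" "m' \<le> n" for n
    using 1[of n] 2[of n] t t' that cy_disjoint[of "v n" n "v' n" x] by (simp add: thread_def)
  have "v (Suc n) = v' (Suc n)" if n: "even n" "m \<le> n" "m' \<le> n" for n
  proof -
    have "ex n (v n) (block \<delta> n) = ex n (v n) (block \<delta>' n)"
      using eq[of n] eq[of "Suc (Suc n)"] n thread_step[OF t, of n] thread_step[OF t', of n] by simp
    then have "block \<delta> n = block \<delta>' n"
      using ex_inj[of "v n" n "block \<delta> n" "v n" "block \<delta>' n"] t n block_less[OF t n(2)] block_less[OF t' n(3)]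
      by (simp add: thread_def)
    \<comment> \<open>The digit at \<open>n\<close> is the remainder of the block, and it alone
      determines the entry at \<open>n + 1\<close>.\<close>
    then have "block \<delta> n mod D n = block \<delta>' n mod D n"
      by simp
    then have "\<delta> n = \<delta>' n"
      using t t' n by (simp add: block_def thread_def)
    then show ?thesis
      using t t' n eq[OF n] by (simp add: thread_def)
  qed
  then have odd: "v n = v' n" if "odd n" "m < n" "m' < n" for n
    using that by (cases n) auto
  let ?n = "Suc (2 * (m + m'))"
  show ?thesis
  proof (rule cy_separate[of ?n])
    fix k
    let ?j = "?n + 2 * k"
    have "v ?j < N ?j" "y \<in> cy ?j (v ?j)" "y' \<in> cy ?j (v ?j)"
      using t[unfolded thread_def, rule_format, of ?j] 1[of ?j] 2[of ?j] odd[of ?j] by auto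
    then show "\<exists>u<N ?j. y \<in> cy ?j u \<and> y' \<in> cy ?j u"
      by blast
  qed
qed

lemma match_thread_even:
  assumes "thread m v \<delta>" "even m" and x: "\<And>k. x \<in> cy (m + 2 * k) (v (m + 2 * k))"
    and y: "\<And>k. y \<in> cy (Suc m + 2 * k) (v (Suc m + 2 * k))"
  shows "match x y"
  unfolding match_def
proof (intro exI conjI allI impI)
  show "thread m v \<delta>" by fact
  fix n assume "m \<le> n"
  show "(if even n then x else y) \<in> cy n (v n)"
  proof (cases "even n")
    case True
    then obtain k where "n = m + 2 * k"
      using \<open>m \<le> n\<close> \<open>even m\<close> by (metis le_Suc_ex even_add evenE)
    with True x show ?thesis by simp
  next
    case False
    then obtain k where "n = Suc m + 2 * k"
      using \<open>m \<le> n\<close> \<open>even m\<close> by (metis le_Suc_ex even_add oddE add_Suc_right add_Suc Suc_eq_plus1)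
    with False y[of k] show ?thesis by simp
  qed
qed

lemma match_thread_odd:
  assumes t: "thread m v \<delta>" "odd m" and y: "\<And>k. y \<in> cy (m + 2 * k) (v (m + 2 * k))"
    and x: "\<And>k. x \<in> cy (Suc m + 2 * k) (v (Suc m + 2 * k))"
  shows "match x y"
proof (rule match_thread_even[OF thread_mono[OF t(1), of "Suc m"]])
  show "y \<in> cy (Suc (Suc m) + 2 * k) (v (Suc (Suc m) + 2 * k))" for k
    using y[of "Suc k"] by simp
qed (use t x in auto)

text \<open>Moving the index of a thread by one exchanges the parities.\<close>

lemma match_swap:
  "interlaced.match (\<lambda>n. cy (Suc n)) (\<lambda>n. N (Suc n)) (\<lambda>n. D (Suc n)) (\<lambda>n. io (Suc n)) y x \<longleftrightarrow> match x y"
proof -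
  interpret s: interlaced "\<lambda>n. M (Suc n)" "\<lambda>n. cy (Suc n)" "\<lambda>n. N (Suc n)" "\<lambda>n. w (Suc n)"
    "\<lambda>n. D (Suc n)" "\<lambda>n. P (Suc n)" "\<lambda>n. ex (Suc n)" "\<lambda>n. io (Suc n)"
    by (rule shift)
  show ?thesis
  proof
    assume "s.match y x"
    then obtain m v \<delta> where *: "s.thread m v \<delta>" "\<And>n. m \<le> n \<Longrightarrow> (if even n then y else x) \<in> cy (Suc n) (v n)"
      unfolding s.match_def by blast
    have "thread (Suc m) (\<lambda>n. v (n - 1)) (\<lambda>n. \<delta> (n - 1))"
      unfolding thread_def
    proof (intro allI impI)
      fix n assume "Suc m \<le> n"
      then obtain i where "n = Suc i" "m \<le> i"
        by (cases n) auto
      then show "v (n - 1) < N n \<and> \<delta> (n - 1) < D n \<and> v (Suc n - 1) = io n (v (n - 1)) (\<delta> (n - 1))"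
        using *(1) unfolding s.thread_def by simp
    qed
    moreover have "(if even n then x else y) \<in> cy n (v (n - 1))" if "Suc m \<le> n" for n
      using that *(2)[of "n - 1"] by (cases n) auto
    ultimately show "match x y"
      unfolding match_def by blast
  next
    assume "match x y"
    then obtain m v \<delta> where *: "thread m v \<delta>" "\<And>n. m \<le> n \<Longrightarrow> (if even n then x else y) \<in> cy n (v n)"
      unfolding match_def by blast
    have "s.thread m (\<lambda>n. v (Suc n)) (\<lambda>n. \<delta> (Suc n))"
      unfolding s.thread_def
    proof (intro allI impI)
      fix n assume "m \<le> n"
      then show "v (Suc n) < N (Suc n) \<and> \<delta> (Suc n) < D (Suc n) \<and>
          v (Suc (Suc n)) = io (Suc n) (v (Suc n)) (\<delta> (Suc n))"
        using *(1)[unfolded thread_def, rule_format, of "Suc n"] by simp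
    qed
    moreover have "(if even n then y else x) \<in> cy (Suc n) (v (Suc n))" if "m \<le> n" for n
      using that *(2)[of "Suc n"] by auto
    ultimately show "s.match y x"
      unfolding s.match_def by blast
  qed
qed

lemma match_unique_left:
  assumes "match x y" "match x' y"
  shows "x = x'"
  using interlaced.match_unique_right[OF shift] assms by (metis match_swap)

lemma match_in_space:
  assumes "match x y"
  shows "x \<in> space (M 0)" "y \<in> space (M 1)"
proof -
  obtain m v \<delta> where *: "thread m v \<delta>" "\<And>n. m \<le> n \<Longrightarrow> (if even n then x else y) \<in> cy n (v n)"
    using assms unfolding match_def by blast
  have "v n < N n" if "m \<le> n" for n
    using *(1) that by (simp add: thread_def)
  then have "x \<in> space (M (0 + 2 * m))" "y \<in> space (M (1 + 2 * m))"
    using *(2)[of "0 + 2 * m"] *(2)[of "1 + 2 * m"] cy_subset_space[of "v (0 + 2 * m)" "0 + 2 * m"]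
      cy_subset_space[of "v (1 + 2 * m)" "1 + 2 * m"] by auto
  then show "x \<in> space (M 0)" "y \<in> space (M 1)"
    by (simp_all only: M_period')
qed

text \<open>A thread through \<open>v\<close> at \<open>m\<close> goes on with one of
  \<open>D m\<close> digits, and each digit can be put in front of a thread of the next level. So a
  cell is matched with a union of \<open>D m\<close> cells of the other side.\<close>

lemma matched_cell:
  assumes m: "odd m" and v: "v < N m"
  shows "{x. \<exists>y\<in>cell m v. match x y} = (\<Union>d<D m. cell (Suc m) (io m v d))"
proof (intro equalityI subsetI)
  fix x assume "x \<in> {x. \<exists>y\<in>cell m v. match x y}"
  then obtain y where y: "y \<in> cell m v" "match x y"
    by blast
  obtain p \<delta> where p: "thread m p \<delta>" "p m = v" "\<And>k. y \<in> cy (m + 2 * k) (p (m + 2 * k))"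
    using cell_thread[OF v y(1)] by blast
  obtain x' where x': "\<And>k. x' \<in> cy (Suc m + 2 * k) (p (Suc m + 2 * k))"
    using thread_limit[OF p(1), of "Suc m"] by auto
  have "match x' y"
    using match_thread_odd[OF p(1) m p(3) x'] .
  then have "x' = x"
    using y(2) match_unique_left by blast
  then have "x \<in> cell (Suc m) (p (Suc m))"
    using thread_cell[OF thread_mono[OF p(1), of "Suc m"]] x' by simp
  moreover have "p (Suc m) = io m v (\<delta> m)" "\<delta> m < D m"
    using p(1,2) by (auto simp: thread_def)
  ultimately show "x \<in> (\<Union>d<D m. cell (Suc m) (io m v d))"
    by auto
next
  fix x assume "x \<in> (\<Union>d<D m. cell (Suc m) (io m v d))"
  then obtain d where d: "d < D m" "x \<in> cell (Suc m) (io m v d)"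
    by blast
  then obtain p \<delta> where p: "thread (Suc m) p \<delta>" "p (Suc m) = io m v d" "\<And>k. x \<in> cy (Suc m + 2 * k) (p (Suc m + 2 * k))"
    using cell_thread[OF io_less[OF v d(1)] d(2)] by blast
  \<comment> \<open>The thread is lengthened by one entry at the front; its values from
    \<open>Suc m\<close> on are untouched.\<close>
  define p' \<delta>' where "p' = p(m := v)" and "\<delta>' = \<delta>(m := d)"
  have p': "thread m p' \<delta>'"
    using p(1,2) d v by (auto simp: thread_def p'_def \<delta>'_def)
  obtain y where y: "\<And>k. y \<in> cy (m + 2 * k) (p' (m + 2 * k))"
    using thread_limit[OF p', of m] by auto
  have "match x y"
    by (rule match_thread_odd[OF p' m y]) (use p(3) in \<open>simp add: p'_def\<close>)
  moreover have "y \<in> cell m v"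
    using thread_cell[OF p' y] by (simp add: p'_def)
  ultimately show "x \<in> {x. \<exists>y\<in>cell m v. match x y}"
    by blast
qed

lemma match_cells:
  assumes "match x y"
  shows "\<exists>k0. \<forall>k\<ge>k0. \<exists>v<N (1 + 2 * k). y \<in> cell (1 + 2 * k) v" (is ?y)
    and "\<exists>k0. \<forall>k\<ge>k0. \<exists>v<N (2 * k). x \<in> cell (2 * k) v" (is ?x)
proof -
  obtain m v \<delta> where *: "thread m v \<delta>" "\<And>n. m \<le> n \<Longrightarrow> (if even n then x else y) \<in> cy n (v n)"
    using assms unfolding match_def by blast
  have v: "v n < N n" if "m \<le> n" for n
    using *(1) that by (simp add: thread_def)
  have "y \<in> cell (1 + 2 * k) (v (1 + 2 * k))" if "m \<le> k" for k
  proof (rule thread_cell[OF thread_mono[OF *(1)]])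
    show "y \<in> cy (1 + 2 * k + 2 * i) (v (1 + 2 * k + 2 * i))" for i
      using *(2)[of "1 + 2 * k + 2 * i"] that by simp
  qed (use that in simp)
  moreover have "v (1 + 2 * k) < N (1 + 2 * k)" "v (2 * k) < N (2 * k)" if "m \<le> k" for k
    using v that by simp_all
  ultimately show ?y
    by (meson order_refl)
  have "x \<in> cell (2 * k) (v (2 * k))" if "m \<le> k" for k
  proof (rule thread_cell[OF thread_mono[OF *(1)]])
    show "x \<in> cy (2 * k + 2 * i) (v (2 * k + 2 * i))" for i
      using *(2)[of "2 * k + 2 * i"] that by simp
  qed (use that in simp)
  moreover have "v (2 * k) < N (2 * k)" if "m \<le> k" for k
    using v that by simp_all
  ultimately show ?x
    by (meson order_refl)
qed

section \<open>The partner map\<close>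

definition good :: "'p set" where
  "good = {x. \<exists>y. match x y}"

lemma good_eq: "good = (\<Union>k. \<Union>u<N (2 * k). cell (2 * k) u)"
proof (intro equalityI subsetI)
  fix x assume "x \<in> (\<Union>k. \<Union>u<N (2 * k). cell (2 * k) u)"
  then obtain k u where *: "u < N (2 * k)" "x \<in> cell (2 * k) u"
    by blast
  obtain v \<delta> where v: "thread (2 * k) v \<delta>" "\<And>i. x \<in> cy (2 * k + 2 * i) (v (2 * k + 2 * i))"
    using cell_thread[OF *] by blast
  obtain y where "\<And>i. y \<in> cy (Suc (2 * k) + 2 * i) (v (Suc (2 * k) + 2 * i))"
    using thread_limit[OF v(1), of "Suc (2 * k)"] by auto
  from match_thread_even[OF v(1) _ v(2) this] show "x \<in> good"
    unfolding good_def by auto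
next
  fix x assume "x \<in> good"
  then obtain y where "match x y"
    unfolding good_def by blast
  from match_cells(2)[OF this] show "x \<in> (\<Union>k. \<Union>u<N (2 * k). cell (2 * k) u)"
    by blast
qed

lemma good_sets: "good \<in> sets (M 0)"
proof -
  have "cell (2 * k) u \<in> sets (M 0)" if "u < N (2 * k)" for k u
    using cell_sets[OF that] M_period'[of 0 k] by simp
  then show ?thesis
    unfolding good_eq by (intro sets.countable_UN' sets.finite_UN) auto
qed

lemma AE_good: "AE x in M 0. x \<in> good"
  using AE_cell[of 0] by eventually_elim (auto simp: good_eq)

text \<open>Off \<open>good\<close> the value is one fixed point of the space, which makes the map
  measurable on the whole space.\<close>

definition partner :: "'p \<Rightarrow> 'p" where
  "partner x = (if x \<in> good then THE y. match x y else SOME y. y \<in> space (M 1))"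

lemma match_iff: "match x y \<longleftrightarrow> x \<in> good \<and> partner x = y"
proof
  assume "match x y"
  then show "x \<in> good \<and> partner x = y"
    unfolding good_def partner_def using match_unique_right by (auto intro!: the_equality)
next
  assume *: "x \<in> good \<and> partner x = y"
  then obtain y' where "match x y'"
    unfolding good_def by blast
  moreover from this have "partner x = y'"
    using * match_unique_right unfolding partner_def by (auto intro!: the_equality)
  ultimately show "match x y"
    using * by simp
qed

text \<open>The cylinder of a point \<open>y\<close> is an increasing union of cells, up to the points without partner.\<close>

definition subcells :: "nat \<Rightarrow> nat \<Rightarrow> nat \<Rightarrow> nat set" where
  "subcells m v k = {u. u < N (m + 2 * k) \<and> cy (m + 2 * k) u \<subseteq> cy m v}"

definition fill :: "nat \<Rightarrow> nat \<Rightarrow> nat \<Rightarrow> 'p set" where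
  "fill m v k = (\<Union>u\<in>subcells m v k. cell (m + 2 * k) u)"

lemma finite_subcells: "finite (subcells m v k)"
  unfolding subcells_def by (rule finite_subset[of _ "{..<N (m + 2 * k)}"]) auto

lemma fill_incseq: "incseq (fill m v)"
proof (rule incseq_SucI, rule subsetI)
  fix k x assume "x \<in> fill m v k"
  then obtain u where u: "u < N (m + 2 * k)" "cy (m + 2 * k) u \<subseteq> cy m v" "x \<in> cell (m + 2 * k) u"
    unfolding fill_def subcells_def by blast
  obtain b where b: "b < D (m + 2 * k) * D (Suc (m + 2 * k))" "x \<in> cell (Suc (Suc (m + 2 * k))) (ex (m + 2 * k) u b)"
    using u(3) unfolding cell_unfold[OF u(1)] by blast
  have "ex (m + 2 * k) u b \<in> subcells m v (Suc k)"
    using subset_trans[OF ex_subset[OF u(1) less_DD_less_w[OF b(1)]] u(2)]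
      ex_less[OF u(1) less_DD_less_w[OF b(1)]] by (simp add: subcells_def)
  then show "x \<in> fill m v (Suc k)"
    using b(2) unfolding fill_def by (intro UN_I) simp_all
qed

lemma fill_union:
  assumes v: "v < N m"
  shows "(\<Union>k. fill m v k) = cy m v \<inter> (\<Union>k. \<Union>u<N (m + 2 * k). cell (m + 2 * k) u)"
proof (intro equalityI subsetI)
  fix x assume "x \<in> (\<Union>k. fill m v k)"
  then show "x \<in> cy m v \<inter> (\<Union>k. \<Union>u<N (m + 2 * k). cell (m + 2 * k) u)"
    using cell_subset unfolding fill_def subcells_def by blast
next
  fix x assume "x \<in> cy m v \<inter> (\<Union>k. \<Union>u<N (m + 2 * k). cell (m + 2 * k) u)"
  then obtain k u where *: "x \<in> cy m v" "u < N (m + 2 * k)" "x \<in> cell (m + 2 * k) u"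
    by blast
  then have "u \<in> subcells m v k"
    unfolding subcells_def using cy_nested[OF v *(2,1)] cell_subset by blast
  with * show "x \<in> (\<Union>k. fill m v k)"
    unfolding fill_def by blast
qed

lemma fill_sets: "fill m v k \<in> sets (M m)"
proof -
  have "cell (m + 2 * k) u \<in> sets (M m)" if "u \<in> subcells m v k" for u
    using that cell_sets[of u "m + 2 * k"] by (simp add: subcells_def)
  then show ?thesis
    unfolding fill_def using finite_subcells by (intro sets.finite_UN) auto
qed

lemma emeasure_fill: "emeasure (M m) (fill m v k) = of_nat (card (subcells m v k)) * weight (m + 2 * k)"
proof -
  have "disjoint_family_on (cell (m + 2 * k)) (subcells m v k)"
    unfolding disjoint_family_on_def subcells_def using cell_subset cy_disjoint by blast
  moreover have "cell (m + 2 * k) ` subcells m v k \<subseteq> sets (M (m + 2 * k))"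
    using cell_sets by (auto simp: subcells_def simp del: M_period')
  ultimately have "emeasure (M (m + 2 * k)) (fill m v k) = (\<Sum>u\<in>subcells m v k. emeasure (M (m + 2 * k)) (cell (m + 2 * k) u))"
    unfolding fill_def by (intro sum_emeasure[symmetric] finite_subcells)
  also have "\<dots> = (\<Sum>u\<in>subcells m v k. weight (m + 2 * k))"
    by (intro sum.cong emeasure_cell) (auto simp: subcells_def)
  finally show ?thesis
    by simp
qed

section \<open>Preimages of cylinders under the partner map and their measures\<close>

definition fill' :: "nat \<Rightarrow> nat \<Rightarrow> nat \<Rightarrow> 'p set" where
  "fill' m v k = {x. \<exists>y\<in>fill m v k. match x y}"

lemma fill'_eq:
  assumes "odd m"
  shows "fill' m v k =
    (\<Union>(u, d)\<in>subcells m v k \<times> {..<D (m + 2 * k)}. cell (Suc (m + 2 * k)) (io (m + 2 * k) u d))"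
proof -
  have "fill' m v k = (\<Union>u\<in>subcells m v k. {x. \<exists>y\<in>cell (m + 2 * k) u. match x y})"
    unfolding fill'_def fill_def by blast
  also have "\<dots> = (\<Union>u\<in>subcells m v k. \<Union>d<D (m + 2 * k). cell (Suc (m + 2 * k)) (io (m + 2 * k) u d))"
    using assms by (intro SUP_cong refl matched_cell) (auto simp: subcells_def)
  finally show ?thesis
    by auto
qed

lemma M_odd: "odd m \<Longrightarrow> M (Suc m) = M 0" "odd m \<Longrightarrow> M m = M 1"
proof -
  assume "odd m"
  then obtain k where "m = 1 + 2 * k"
    by (auto elim: oddE)
  then show "M (Suc m) = M 0" "M m = M 1"
    using M_period'[of 0 "Suc k"] M_period'[of 1 k] by simp_all
qed

lemma fill'_sets: "odd m \<Longrightarrow> fill' m v k \<in> sets (M 0)"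
proof -
  assume m: "odd m"
  then have "cell (Suc (m + 2 * k)) (io (m + 2 * k) u d) \<in> sets (M 0)"
    if "u \<in> subcells m v k" "d < D (m + 2 * k)" for u d
    using that cell_sets[OF io_less[of u "m + 2 * k" d]] M_odd(1)[of "m + 2 * k"] by (simp add: subcells_def)
  then show ?thesis
    unfolding fill'_eq[OF m] using finite_subcells by (intro sets.finite_UN) auto
qed

lemma emeasure_fill':
  assumes m: "odd m"
  shows "emeasure (M 0) (fill' m v k) =
    of_nat (card (subcells m v k)) * (of_nat (D (m + 2 * k)) * weight (Suc (m + 2 * k)))"
proof -
  let ?n = "m + 2 * k"
  let ?I = "subcells m v k \<times> {..<D ?n}"
  let ?A = "\<lambda>(u, d). cell (Suc ?n) (io ?n u d)"
  have M: "M (Suc ?n) = M 0"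
    using m by (intro M_odd) simp
  have less: "io ?n (fst p) (snd p) < N (Suc ?n)" if "p \<in> ?I" for p
    using that io_less by (auto simp: subcells_def)
  have "disjoint_family_on ?A ?I"
    unfolding disjoint_family_on_def
  proof (intro ballI impI)
    fix p q assume pq: "p \<in> ?I" "q \<in> ?I" "p \<noteq> q"
    then have "io ?n (fst p) (snd p) \<noteq> io ?n (fst q) (snd q)"
      using io_inj[of "fst p" ?n "snd p" "fst q" "snd q"] by (auto simp: subcells_def prod_eq_iff)
    then show "?A p \<inter> ?A q = {}"
      using cy_disjoint[OF less[OF pq(1)] less[OF pq(2)]]
      by (auto simp: case_prod_beta dest!: subsetD[OF cell_subset])
  qed
  moreover have "?A ` ?I \<subseteq> sets (M 0)"
    using cell_sets[OF less] M by (auto simp: case_prod_beta)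
  ultimately have "emeasure (M 0) (fill' m v k) = (\<Sum>p\<in>?I. emeasure (M 0) (?A p))"
    unfolding fill'_eq[OF m] using finite_subcells by (intro sum_emeasure[symmetric]) auto
  also have "\<dots> = (\<Sum>p\<in>?I. weight (Suc ?n))"
    using emeasure_cell[OF less] M by (intro sum.cong) (auto simp: case_prod_beta)
  finally show ?thesis
    by (simp add: card_cartesian_product mult.assoc)
qed

text \<open>The value at \<open>m = 1\<close> of the quotient
  \<open>D m * weight (Suc m) / weight m\<close>, which is the same for all odd
  \<open>m\<close>.\<close>

definition ratio :: real where
  "ratio = D 1 * enn2real (weight 2) / enn2real (weight 1)"

lemma weight_real: "weight m = ennreal (enn2real (weight m))" "0 < enn2real (weight m)"
  using weight_finite[of m] weight_pos[of m] by (auto simp: enn2real_positive_iff)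

lemma ratio_pos: "0 < ratio"
  unfolding ratio_def using weight_real(2) D_pos by simp

lemma enn2real_weight_step:
  "enn2real (weight m) = D m * D (Suc m) * enn2real (weight (Suc (Suc m)))"
  by (subst weight_step) (simp add: enn2real_mult)

text \<open>In passing from \<open>m\<close> to \<open>m + 2\<close>, both
  \<open>D m * weight (Suc m)\<close> and \<open>weight m\<close> lose the factor
  \<open>D m * D (Suc m)\<close> by \<open>weight_step\<close>.\<close>

lemma ratio_eq: "odd m \<Longrightarrow> of_nat (D m) * weight (Suc m) = ennreal ratio * weight m"
proof -
  define \<rho> where "\<rho> n = enn2real (weight n)" for n
  have \<rho>: "0 < \<rho> n" "\<rho> n = D n * D (Suc n) * \<rho> (Suc (Suc n))" for n
    unfolding \<rho>_def by (fact weight_real enn2real_weight_step)+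
  have "D (1 + 2 * k) * \<rho> (Suc (1 + 2 * k)) = ratio * \<rho> (1 + 2 * k)" for k
  proof (induction k)
    case 0
    show ?case
      using \<rho>(1)[of 1] by (simp add: ratio_def \<rho>_def[symmetric] numeral_2_eq_2)
  next
    case (Suc k)
    let ?n = "1 + 2 * k"
    have "D ?n * D (Suc ?n) * (D (Suc (Suc ?n)) * \<rho> (Suc (Suc (Suc ?n)))) = D ?n * \<rho> (Suc ?n)"
      using \<rho>(2)[of "Suc ?n"] by simp
    also have "\<dots> = ratio * \<rho> ?n"
      by (rule Suc)
    also have "\<dots> = D ?n * D (Suc ?n) * (ratio * \<rho> (Suc (Suc ?n)))"
      using \<rho>(2)[of ?n] by simp
    finally show ?case
      using D_pos[of ?n] D_pos[of "Suc ?n"] by simp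
  qed
  moreover assume "odd m"
  then obtain k where "m = 1 + 2 * k"
    by (auto elim: oddE)
  ultimately have *: "D m * \<rho> (Suc m) = ratio * \<rho> m"
    by simp
  have "of_nat (D m) * weight (Suc m) = ennreal (D m * \<rho> (Suc m))"
    using weight_real(1)[of "Suc m"] by (simp add: \<rho>_def ennreal_mult ennreal_of_nat_eq_real_of_nat)
  also have "\<dots> = ennreal ratio * weight m"
    unfolding * using weight_real(1)[of m] ratio_pos \<rho>(1)[of m] by (simp add: \<rho>_def ennreal_mult)
  finally show ?thesis .
qed

text \<open>A point with a partner lies in cells at all late levels, so inside a cylinder such
  points are exhausted by the sets \<open>fill\<close>.\<close>

lemma matched_cy:
  assumes m: "odd m" and v: "v < N m"
  shows "{x \<in> good. partner x \<in> cy m v} = (\<Union>k. fill' m v k)"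
proof -
  have "y \<in> (\<Union>k. \<Union>u<N (m + 2 * k). cell (m + 2 * k) u)" if xy: "match x y" for x y
  proof -
    obtain j where j: "m = 1 + 2 * j"
      using m by (auto elim: oddE)
    obtain k0 where "\<And>k. k0 \<le> k \<Longrightarrow> \<exists>v<N (1 + 2 * k). y \<in> cell (1 + 2 * k) v"
      using match_cells(1)[OF xy] by blast
    from this[of "j + k0"] obtain u where "u < N (1 + 2 * (j + k0))" "y \<in> cell (1 + 2 * (j + k0)) u"
      by auto
    then have "u < N (m + 2 * k0)" "y \<in> cell (m + 2 * k0) u"
      unfolding j by (simp_all add: algebra_simps)
    then show ?thesis
      by blast
  qed
  then have "match x y \<Longrightarrow> y \<in> cy m v \<longleftrightarrow> y \<in> (\<Union>k. fill m v k)" for x y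
    unfolding fill_union[OF v] by blast
  then show ?thesis
    unfolding fill'_def by (auto simp: match_iff)
qed

lemma space_nonempty: "(SOME y. y \<in> space (M 1)) \<in> space (M 1)"
proof -
  have "cy 1 0 \<noteq> {}"
    using emeasure_cy[OF N_pos, of 1] P_pos[of 1] by auto
  then show ?thesis
    using cy_subset_space[OF N_pos, of 1] by (metis all_not_in_conv someI_ex subsetD)
qed

lemma odd_cy_subset_space: "u < N (1 + 2 * k) \<Longrightarrow> cy (1 + 2 * k) u \<subseteq> space (M 1)"
  using cy_subset_space[of u "1 + 2 * k"] M_period'[of 1 k] by simp

lemma partner_measurable: "partner \<in> M 0 \<rightarrow>\<^sub>M M 1"
proof (rule measurable_sigma_sets[OF sets_M[of 1]])
  show "{cy (1 + 2 * k) u |k u. u < N (1 + 2 * k)} \<subseteq> Pow (space (M 1))"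
    using odd_cy_subset_space by blast
  show "partner \<in> space (M 0) \<rightarrow> space (M 1)"
  proof
    fix x assume "x \<in> space (M 0)"
    show "partner x \<in> space (M 1)"
    proof (cases "x \<in> good")
      case True
      then have "match x (partner x)"
        by (simp add: match_iff)
      then show ?thesis
        by (rule match_in_space)
    qed (use space_nonempty in \<open>simp add: partner_def\<close>)
  qed
  fix A assume "A \<in> {cy (1 + 2 * k) u |k u. u < N (1 + 2 * k)}"
  then obtain k u where A: "A = cy (1 + 2 * k) u" and u: "u < N (1 + 2 * k)"
    by blast
  have 1: "{x \<in> good. partner x \<in> A} \<in> sets (M 0)"
    unfolding A using matched_cy[OF _ u] fill'_sets[of "1 + 2 * k" u] by auto
  \<comment> \<open>Off \<open>good\<close> the preimage is everything or nothing, according to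
    whether the default point lies in \<open>A\<close>.\<close>
  have "partner -` A \<inter> space (M 0) = {x \<in> good. partner x \<in> A} \<union>
      (if (SOME y. y \<in> space (M 1)) \<in> A then space (M 0) - good else {})"
    using sets.sets_into_space[OF good_sets] by (auto simp: partner_def split: if_splits)
  then show "partner -` A \<inter> space (M 0) \<in> sets (M 0)"
    using 1 good_sets by auto
qed

text \<open>Each \<open>fill\<close> and its set of partners consist of cells in constant proportion
  \<open>ratio\<close>. Continuity from below carries this to the cylinder, which the sets
  \<open>fill\<close> exhaust up to a null set by \<open>AE_cell\<close>.\<close>

lemma emeasure_matched_cy:
  assumes m: "odd m" and v: "v < N m"
  shows "emeasure (M 0) {x \<in> good. partner x \<in> cy m v} = ennreal ratio * emeasure (M 1) (cy m v)"
proof -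
  have "incseq (fill' m v)"
    using fill_incseq[of m v] unfolding fill'_def incseq_def by blast
  then have "emeasure (M 0) {x \<in> good. partner x \<in> cy m v} = (SUP k. emeasure (M 0) (fill' m v k))"
    unfolding matched_cy[OF assms] using fill'_sets[OF m] by (intro SUP_emeasure_incseq[symmetric]) auto
  also have "\<dots> = (SUP k. ennreal ratio * emeasure (M m) (fill m v k))"
    using m by (intro SUP_cong refl) (simp add: emeasure_fill'[OF m] emeasure_fill ratio_eq mult.left_commute)
  also have "\<dots> = ennreal ratio * (SUP k. emeasure (M m) (fill m v k))"
    by (simp add: SUP_mult_left_ennreal)
  also have "(SUP k. emeasure (M m) (fill m v k)) = emeasure (M m) (\<Union>k. fill m v k)"
    using fill_sets fill_incseq by (intro SUP_emeasure_incseq) auto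
  also have "\<dots> = emeasure (M m) (cy m v)"
    using AE_cell[of m] cy_sets[OF v] fill_sets
    by (intro emeasure_eq_AE sets.countable_UN) (auto simp: fill_union[OF v])
  finally show ?thesis
    using M_odd(2)[OF m] by simp
qed

text \<open>Proportionality on cylinders suffices by \<open>measure_eqI_nested\<close>.\<close>

theorem distr_partner: "distr (M 0) (M 1) partner = scale_measure (ennreal ratio) (M 1)"
proof (rule measure_eqI_nested)
  let ?Cy = "{cy (1 + 2 * k) u | k u. u < N (1 + 2 * k)}"
  show sub: "?Cy \<subseteq> Pow (space (M 1))"
    using odd_cy_subset_space by blast
  show "\<Union>?Cy = space (M 1)"
  proof (intro equalityI subsetI)
    fix x assume "x \<in> space (M 1)"
    then obtain k u where "u < N (1 + 2 * k)" "x \<in> cy (1 + 2 * k) u"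
      using cy_cover by blast
    then show "x \<in> \<Union>?Cy"
      by blast
  qed (use sub in blast)
  have "?Cy \<subseteq> range (\<lambda>(k, u). cy (1 + 2 * k) u)"
    by auto
  then show "countable ?Cy"
    by (rule countable_subset) simp
  show "sets (distr (M 0) (M 1) partner) = sigma_sets (space (M 1)) ?Cy"
    "sets (scale_measure (ennreal ratio) (M 1)) = sigma_sets (space (M 1)) ?Cy"
    using sets_M[of 1] by simp_all
next
  fix A B assume "A \<in> {cy (1 + 2 * k) u | k u. u < N (1 + 2 * k)}" "B \<in> {cy (1 + 2 * k) u | k u. u < N (1 + 2 * k)}"
  then obtain k u j v where *: "A = cy (1 + 2 * k) u" "u < N (1 + 2 * k)" "B = cy (1 + 2 * j) v" "v < N (1 + 2 * j)"
    by blast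
  have "cy (1 + 2 * k) u \<inter> cy (1 + 2 * j) v = {} \<or> cy (1 + 2 * j) v \<subseteq> cy (1 + 2 * k) u"
    if "k \<le> j" "u < N (1 + 2 * k)" "v < N (1 + 2 * j)" for k j u v
  proof -
    obtain i where "1 + 2 * j = 1 + 2 * k + 2 * i"
      using \<open>k \<le> j\<close> by (metis add.assoc add_mult_distrib2 le_Suc_ex)
    then show ?thesis
      using cy_nested[OF that(2), of v i] that(3) by auto
  qed
  from this[of k j u v] this[of j k v u] * show "A \<inter> B = {} \<or> A \<subseteq> B \<or> B \<subseteq> A"
    by (cases "k \<le> j") auto
next
  fix A assume "A \<in> {cy (1 + 2 * k) u | k u. u < N (1 + 2 * k)}"
  then obtain k u where A: "A = cy (1 + 2 * k) u" and u: "u < N (1 + 2 * k)"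
    by blast
  have AM: "A \<in> sets (M 1)"
    using cy_sets[OF u] M_period'[of 1 k] by (simp add: A)
  have meas: "partner -` A \<inter> space (M 0) \<in> sets (M 0)"
    using partner_measurable AM by (rule measurable_sets)
  have "emeasure (distr (M 0) (M 1) partner) A = emeasure (M 0) (partner -` A \<inter> space (M 0))"
    using partner_measurable AM by (rule emeasure_distr)
  also have "\<dots> = emeasure (M 0) {x \<in> good. partner x \<in> A}"
  proof (rule emeasure_eq_AE)
    show "AE x in M 0. x \<in> partner -` A \<inter> space (M 0) \<longleftrightarrow> x \<in> {x \<in> good. partner x \<in> A}"
      using AE_good AE_space by eventually_elim auto
    have "{x \<in> good. partner x \<in> A} = good \<inter> (partner -` A \<inter> space (M 0))"
      using sets.sets_into_space[OF good_sets] by auto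
    then show "{x \<in> good. partner x \<in> A} \<in> sets (M 0)"
      using meas good_sets by auto
  qed (rule meas)
  also have "\<dots> = ennreal ratio * emeasure (M 1) A"
    unfolding A by (rule emeasure_matched_cy) (use u in auto)
  finally show *: "emeasure (distr (M 0) (M 1) partner) A = emeasure (scale_measure (ennreal ratio) (M 1)) A"
    by simp
  have "emeasure (M 1) A = ennreal (1 / P (1 + 2 * k))"
    using emeasure_cy[OF u] M_period'[of 1 k] by (simp add: A)
  with * show "emeasure (distr (M 0) (M 1) partner) A \<noteq> \<infinity>"
    by (simp add: ennreal_mult_eq_top_iff)
qed

section \<open>Matching carries tail classes to tail classes\<close>

lemma match_tail:
  assumes xy: "match x y" and xx': "tail 0 x x'"
  shows "\<exists>y'. match x' y' \<and> tail 1 y y'"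
proof -
  obtain m v \<delta> where t: "thread m v \<delta>" and pt: "\<And>n. m \<le> n \<Longrightarrow> (if even n then x else y) \<in> cy n (v n)"
    using xy unfolding match_def by blast
  obtain k p p' b where tl: "\<And>l. k \<le> l \<Longrightarrow> p l < N (2 * l) \<and> p' l < N (2 * l) \<and> b l < w (2 * l) \<and>
     x \<in> cy (2 * l) (p l) \<and> x' \<in> cy (2 * l) (p' l) \<and>
     p (Suc l) = ex (2 * l) (p l) (b l) \<and> p' (Suc l) = ex (2 * l) (p' l) (b l)"
    using xx' unfolding tail_def by auto
  define l0 where "l0 = k + m"
  \<comment> \<open>The partner of \<open>x'\<close> is found by starting at the position of
    \<open>x'\<close> and continuing with the digits of \<open>x\<close>.\<close>
  define v' where "v' n = rec_nat (p' l0) (\<lambda>i u. io (2 * l0 + i) u (\<delta> (2 * l0 + i))) (n - 2 * l0)" for n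
  have v'0: "v' (2 * l0) = p' l0"
    by (simp add: v'_def)
  have v'_Suc: "v' (Suc n) = io n (v' n) (\<delta> n)" if "2 * l0 \<le> n" for n
    using that by (simp add: v'_def Suc_diff_le)
  have vN: "v n < N n" "\<delta> n < D n" if "2 * l0 \<le> n" for n
    using t that by (auto simp: thread_def l0_def)
  have v'N: "v' n < N n" if "2 * l0 \<le> n" for n
    using that
  proof (induction n rule: dec_induct)
    case base
    then show ?case
      using tl[of l0] by (simp add: v'0) (simp add: l0_def)
  next
    case (step n)
    then show ?case
      using v'_Suc vN io_less by simp
  qed
  have t': "thread (2 * l0) v' \<delta>"
    unfolding thread_def using v'_Suc vN v'N by blast
  have pv: "p l = v (2 * l)" if "l0 \<le> l" for l
    using tl[of l] pt[of "2 * l"] vN[of "2 * l"] that cy_disjoint[of "p l" "2 * l" "v (2 * l)" x]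
    by (auto simp: l0_def)
  \<comment> \<open>The common words of \<open>x\<close> and \<open>x'\<close> are those read by the
    thread of \<open>x\<close>. Hence the even entries of \<open>v'\<close> follow
    \<open>x'\<close>.\<close>
  have b: "b l = block \<delta> (2 * l)" if l: "l0 \<le> l" for l
  proof -
    have "m \<le> 2 * l"
      using l by (simp add: l0_def)
    then have "ex (2 * l) (p l) (b l) = ex (2 * l) (p l) (block \<delta> (2 * l))"
      using tl[of l] pv[of l] pv[of "Suc l"] l thread_step[OF t, of "2 * l"] by (simp add: l0_def)
    then show ?thesis
      using ex_inj[of "p l" "2 * l" "b l" "p l" "block \<delta> (2 * l)"] tl[of l] l block_less(2)[OF t \<open>m \<le> 2 * l\<close>]
      by (simp add: l0_def)
  qed
  have p'v': "p' l = v' (2 * l)" if "l0 \<le> l" for l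
    using that
  proof (induction l rule: dec_induct)
    case (step l)
    then show ?case
      using tl[of l] thread_step[OF t', of "2 * l"] b[of l] by (simp add: l0_def)
  qed (simp add: v'0)
  obtain y' where y': "\<And>i. y' \<in> cy (Suc (2 * l0) + 2 * i) (v' (Suc (2 * l0) + 2 * i))"
    using thread_limit[OF t', of "Suc (2 * l0)"] by auto
  have "match x' y'"
  proof (rule match_thread_even[OF t' _ _ y'])
    fix i
    have "x' \<in> cy (2 * (l0 + i)) (p' (l0 + i))"
      using tl[of "l0 + i"] by (simp add: l0_def)
    then show "x' \<in> cy (2 * l0 + 2 * i) (v' (2 * l0 + 2 * i))"
      using p'v'[of "l0 + i"] by (simp add: algebra_simps)
  qed simp
  moreover have "tail 1 y y'"
    unfolding tail_def
  proof (rule exI[of _ l0], rule exI[of _ "\<lambda>l. v (1 + 2 * l)"], rule exI[of _ "\<lambda>l. v' (1 + 2 * l)"],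
      rule exI[of _ "\<lambda>l. block \<delta> (1 + 2 * l)"], intro allI impI conjI)
    fix l assume l: "l0 \<le> l"
    then have m: "m \<le> 1 + 2 * l" "2 * l0 \<le> 1 + 2 * l"
      by (auto simp: l0_def)
    show "v (1 + 2 * l) < N (1 + 2 * l)" "v' (1 + 2 * l) < N (1 + 2 * l)"
      using vN v'N m by auto
    show "block \<delta> (1 + 2 * l) < w (1 + 2 * l)"
      by (rule block_less(2)[OF t m(1)])
    show "y \<in> cy (1 + 2 * l) (v (1 + 2 * l))"
      using pt[OF m(1)] by simp
    show "y' \<in> cy (1 + 2 * l) (v' (1 + 2 * l))"
    proof -
      have "Suc (2 * l0) + 2 * (l - l0) = 1 + 2 * l"
        using l by simp
      then show ?thesis
        using y'[of "l - l0"] by simp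
    qed
    show "v (1 + 2 * Suc l) = ex (1 + 2 * l) (v (1 + 2 * l)) (block \<delta> (1 + 2 * l))"
      using thread_step[OF t m(1)] by simp
    show "v' (1 + 2 * Suc l) = ex (1 + 2 * l) (v' (1 + 2 * l)) (block \<delta> (1 + 2 * l))"
      using thread_step[OF t' m(2)] by simp
  qed
  ultimately show ?thesis
    by blast
qed

lemma tail_2:
  assumes "tail 2 x x'"
  shows "tail 0 x x'"
proof -
  obtain k v v' b where *: "\<And>l. k \<le> l \<Longrightarrow> v l < N (2 + 2 * l) \<and> v' l < N (2 + 2 * l) \<and> b l < w (2 + 2 * l) \<and>
     x \<in> cy (2 + 2 * l) (v l) \<and> x' \<in> cy (2 + 2 * l) (v' l) \<and>
     v (Suc l) = ex (2 + 2 * l) (v l) (b l) \<and> v' (Suc l) = ex (2 + 2 * l) (v' l) (b l)"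
    using assms unfolding tail_def by blast
  show ?thesis
    unfolding tail_def
  proof (rule exI[of _ "Suc k"], rule exI[of _ "\<lambda>l. v (l - 1)"], rule exI[of _ "\<lambda>l. v' (l - 1)"],
      rule exI[of _ "\<lambda>l. b (l - 1)"], intro allI impI)
    fix l assume "Suc k \<le> l"
    then obtain i where "l = Suc i" "k \<le> i"
      by (cases l) auto
    then have e: "0 + 2 * l = 2 + 2 * i" "l - 1 = i" "Suc l - 1 = Suc i"
      by simp_all
    show "v (l - 1) < N (0 + 2 * l) \<and> v' (l - 1) < N (0 + 2 * l) \<and> b (l - 1) < w (0 + 2 * l) \<and>
       x \<in> cy (0 + 2 * l) (v (l - 1)) \<and> x' \<in> cy (0 + 2 * l) (v' (l - 1)) \<and>
       v (Suc l - 1) = ex (0 + 2 * l) (v (l - 1)) (b (l - 1)) \<and>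
       v' (Suc l - 1) = ex (0 + 2 * l) (v' (l - 1)) (b (l - 1))"
      unfolding e using *[OF \<open>k \<le> i\<close>] by simp
  qed
qed

text \<open>This is \<open>match_tail\<close> with the spaces exchanged; two shifts return to the
  original side, one level later.\<close>

lemma match_tail':
  assumes xy: "match x y" and yy': "tail 1 y y'"
  shows "\<exists>x'. match x' y' \<and> tail 0 x x'"
proof -
  interpret s: interlaced "\<lambda>n. M (Suc n)" "\<lambda>n. cy (Suc n)" "\<lambda>n. N (Suc n)" "\<lambda>n. w (Suc n)"
    "\<lambda>n. D (Suc n)" "\<lambda>n. P (Suc n)" "\<lambda>n. ex (Suc n)" "\<lambda>n. io (Suc n)"
    by (rule shift)
  have "s.tail 0 y y'"
    using yy' unfolding tail_def s.tail_def by simp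
  moreover have "s.match y x"
    using xy by (simp add: match_swap)
  ultimately obtain x' where x': "s.match y' x'" "s.tail 1 x x'"
    using s.match_tail by blast
  have "tail 2 x x'"
    using x'(2) unfolding tail_def s.tail_def by simp
  then show ?thesis
    using x'(1) tail_2 by (auto simp: match_swap)
qed

text \<open>To be applied to the domains of the two actions. By \<open>distr_partner\<close> the
  preimage of a null set is null, so almost no point is lost by requiring the partner to be in the
  domain.\<close>

lemma match_both_sets:
  assumes A: "A \<in> sets (M 0)" "B \<in> sets (M 1)" and AE: "AE x in M 0. x \<in> A" "AE y in M 1. y \<in> B"
  shows "{x \<in> A. \<exists>y\<in>B. match x y} \<in> sets (M 0)"
    and "AE x in M 0. x \<in> {x \<in> A. \<exists>y\<in>B. match x y}"
proof -
  have eq: "{x \<in> A. \<exists>y\<in>B. match x y} = A \<inter> good \<inter> (partner -` B \<inter> space (M 0))"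
    using sets.sets_into_space[OF A(1)] by (auto simp: match_iff)
  show "{x \<in> A. \<exists>y\<in>B. match x y} \<in> sets (M 0)"
    unfolding eq using A good_sets measurable_sets[OF partner_measurable A(2)] by blast
  have "AE y in distr (M 0) (M 1) partner. y \<in> B"
    unfolding distr_partner
  proof (rule AE_I[of _ _ "space (M 1) - B"])
    have "emeasure (M 1) (space (M 1) - B) = 0"
      using AE(2) A(2) AE_iff_measurable[of "space (M 1) - B" "M 1" "\<lambda>y. y \<in> B"] by auto
    then show "emeasure (scale_measure (ennreal ratio) (M 1)) (space (M 1) - B) = 0"
      by simp
  qed (use A(2) in \<open>auto simp: space_scale_measure\<close>)
  then have "AE x in M 0. partner x \<in> B"
    using AE_distrD[OF partner_measurable] by blast
  with AE(1) AE_good AE_space show "AE x in M 0. x \<in> {x \<in> A. \<exists>y\<in>B. match x y}"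
    unfolding eq by eventually_elim simp
qed

lemma emeasure_matched:
  assumes A: "A \<in> sets (M 1)"
  shows "emeasure (M 0) {x. \<exists>y\<in>A. match x y} = ennreal ratio * emeasure (M 1) A"
proof -
  have eq: "{x. \<exists>y\<in>A. match x y} = good \<inter> (partner -` A \<inter> space (M 0))"
    using sets.sets_into_space[OF good_sets] by (auto simp: match_iff)
  have meas: "partner -` A \<inter> space (M 0) \<in> sets (M 0)"
    by (rule measurable_sets[OF partner_measurable A])
  have "emeasure (M 0) (good \<inter> (partner -` A \<inter> space (M 0))) = emeasure (M 0) (partner -` A \<inter> space (M 0))"
    using AE_good good_sets meas by (intro emeasure_eq_AE) auto
  also have "\<dots> = emeasure (distr (M 0) (M 1) partner) A"
    using emeasure_distr[OF partner_measurable A] by simp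
  finally show ?thesis
    unfolding eq distr_partner by simp
qed

end

section \<open>Cylinders in \<open>(C,F)\<close>-spaces\<close>

locale cf_system = group G for G :: "('g, 'm) monoid_scheme" (structure) +
  fixes C F :: "nat \<Rightarrow> 'g set" and cs fs :: "nat \<Rightarrow> 'g list"
  assumes CF: "CF_sequence G C F" and enum: "CF_enumeration C F cs fs"
begin

lemma finite_F: "finite (F n)" and F_carrier: "f \<in> F n \<Longrightarrow> f \<in> carrier G"
  and finite_C: "finite (C (Suc n))" and C_carrier: "c \<in> C (Suc n) \<Longrightarrow> c \<in> carrier G"
  and card_F_0: "card (F 0) = 1" and card_C: "1 < card (C (Suc n))"
  using CF unfolding CF_sequence_def by auto

lemma mult_in_F: "f \<in> F n \<Longrightarrow> c \<in> C (Suc n) \<Longrightarrow> f \<otimes> c \<in> F (Suc n)"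
  using CF unfolding CF_sequence_def set_mult_def by blast

lemma mult_cancel:
  assumes "f \<in> F n" "c \<in> C (Suc n)" "f' \<in> F n" "c' \<in> C (Suc n)" "f \<otimes> c = f' \<otimes> c'"
  shows "f = f' \<and> c = c'"
proof -
  have "c = c'"
  proof (rule ccontr)
    assume "c \<noteq> c'"
    then have "(F n #> c) \<inter> (F n #> c') = {}"
      using CF assms unfolding CF_sequence_def by blast
    moreover have "f \<otimes> c \<in> (F n #> c) \<inter> (F n #> c')"
      using assms(1,3,5) unfolding r_coset_def by blast
    ultimately show False
      by blast
  qed
  then show ?thesis
    using assms F_carrier C_carrier right_cancel by metis
qed

lemma distinct_fs: "distinct (fs n)" and set_fs: "set (fs n) = F n"
  and distinct_cs: "distinct (cs (Suc n))" and set_cs: "set (cs (Suc n)) = C (Suc n)"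
  using enum unfolding CF_enumeration_def by auto

lemma F_nth: "i < length (fs n) \<Longrightarrow> fs n ! i \<in> F n" and C_nth: "j < length (cs (Suc n)) \<Longrightarrow> cs (Suc n) ! j \<in> C (Suc n)"
  using set_fs set_cs nth_mem by metis+

lemma length_fs: "length (fs n) = card (F n)" and length_cs: "length (cs (Suc n)) = card (C (Suc n))"
  using distinct_card[OF distinct_fs] distinct_card[OF distinct_cs] set_fs set_cs by metis+

lemma F_index: "f \<in> F n \<Longrightarrow> \<exists>i<length (fs n). fs n ! i = f"
  and C_index: "c \<in> C (Suc n) \<Longrightarrow> \<exists>j<length (cs (Suc n)). cs (Suc n) ! j = c"
  using set_fs set_cs in_set_conv_nth by metis+

lemma C_nonempty: "C (Suc n) \<noteq> {}"
  using card_C[of n] by auto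

lemma F_nonempty: "F n \<noteq> {}"
proof (induction n)
  case 0
  show ?case
    using card_F_0 by auto
next
  case (Suc n)
  then show ?case
    using C_nonempty[of n] mult_in_F by blast
qed

section \<open>Coordinates of points and cylinders\<close>

abbreviation "level \<equiv> CF_level C F"
abbreviation "incl \<equiv> CF_incl G C F"
abbreviation "cylinder \<equiv> CF_cylinder G C F"
abbreviation "X \<equiv> CF_space G C F"

text \<open>The product of \<open>f\<close> and the letters at \<open>n + 1, ..., n + i\<close>,
  which is the first coordinate after \<open>i\<close> embeddings.\<close>

primrec walk :: "'g \<Rightarrow> (nat \<Rightarrow> 'g) \<Rightarrow> nat \<Rightarrow> nat \<Rightarrow> 'g" where
  "walk f c n 0 = f"
| "walk f c n (Suc i) = walk f c n i \<otimes> c (Suc (n + i))"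

lemma level_iff: "(f, c) \<in> level n \<longleftrightarrow> f \<in> F n \<and> c \<in> (\<Pi>\<^sub>E k\<in>{n<..}. C k)"
  by (simp add: CF_level_def)

lemma level_coord: "(f, c) \<in> level n \<Longrightarrow> n \<le> k \<Longrightarrow> c (Suc k) \<in> C (Suc k)"
  unfolding level_iff by (auto simp: PiE_def)

lemma walk_in_F: "(f, c) \<in> level n \<Longrightarrow> walk f c n i \<in> F (n + i)"
proof (induction i)
  case (Suc i)
  then show ?case
    using mult_in_F[OF Suc.IH level_coord[of f c n "n + i"]] by simp
qed (simp add: level_iff)

lemma restrict_level: "(f, c) \<in> level n \<Longrightarrow> restrict c {n + i<..} \<in> (\<Pi>\<^sub>E k\<in>{n + i<..}. C k)"
  unfolding level_iff by (auto simp: PiE_def)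

lemma walk_level: "(f, c) \<in> level n \<Longrightarrow> (walk f c n i, restrict c {n + i<..}) \<in> level (n + i)"
  using walk_in_F restrict_level by (simp add: level_iff)

lemma step_pow: "(f, c) \<in> level n \<Longrightarrow> (CF_step G ^^ i) (n, f, c) = (n + i, walk f c n i, restrict c {n + i<..})"
proof (induction i)
  case 0
  then have "restrict c {n<..} = c"
    using PiE_restrict[of c "{n<..}" C] by (simp add: level_iff)
  then show ?case
    by simp
next
  case (Suc i)
  then show ?case
    by (simp add: restrict_def fun_eq_iff)
qed

lemma walk_inj:
  assumes "(f, c) \<in> level n" "(f', c') \<in> level n" "walk f c n i = walk f' c' n i"
  shows "f = f' \<and> (\<forall>k. n < k \<and> k \<le> n + i \<longrightarrow> c k = c' k)"
  using assms(3)
proof (induction i)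
  case (Suc i)
  have *: "walk f c n i = walk f' c' n i \<and> c (Suc (n + i)) = c' (Suc (n + i))"
    using Suc.prems walk_in_F[OF assms(1)] walk_in_F[OF assms(2)] level_coord[OF assms(1)] level_coord[OF assms(2)]
    by (intro mult_cancel[of _ "n + i"]) auto
  then show ?case
    using Suc.IH by (auto simp: le_Suc_eq)
qed auto

lemma incl_eq_iff:
  assumes "(f, c) \<in> level n" "(f', c') \<in> level m"
  shows "incl n (f, c) = incl m (f', c') \<longleftrightarrow> (\<exists>i j. (CF_step G ^^ i) (n, f, c) = (CF_step G ^^ j) (m, f', c'))"
proof -
  let ?S = "Sigma UNIV level" and ?R = "CF_rel G C F"
  have "equiv ?S ?R"
  proof (rule equivI)
    show "refl_on ?S ?R"
      unfolding refl_on_def CF_rel_def by (auto intro!: exI[of _ 0])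
    show "?R \<subseteq> ?S \<times> ?S"
      unfolding CF_rel_def by auto
    show "sym ?R"
      unfolding sym_def CF_rel_def by (auto dest: sym)
    show "trans ?R"
      unfolding trans_def
    proof (intro allI impI)
      fix p q r assume "(p, q) \<in> ?R" "(q, r) \<in> ?R"
      then obtain i j k l where *: "(CF_step G ^^ i) p = (CF_step G ^^ j) q" "(CF_step G ^^ k) q = (CF_step G ^^ l) r"
        and S: "p \<in> ?S" "r \<in> ?S"
        unfolding CF_rel_def by blast
      \<comment> \<open>Transitivity: iterates of one map commute, so the two meeting points can be
        pushed to a common one.\<close>
      have "(CF_step G ^^ (k + i)) p = (CF_step G ^^ k) ((CF_step G ^^ j) q)"
        by (simp add: funpow_add *(1))
      also have "\<dots> = (CF_step G ^^ j) ((CF_step G ^^ k) q)"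
        by (metis add.commute comp_apply funpow_add)
      also have "\<dots> = (CF_step G ^^ (j + l)) r"
        by (simp add: funpow_add *(2))
      finally show "(p, r) \<in> ?R"
        using S unfolding CF_rel_def by blast
    qed
  qed
  then have "incl n (f, c) = incl m (f', c') \<longleftrightarrow> ((n, f, c), (m, f', c')) \<in> ?R"
    unfolding CF_incl_def using assms by (intro eq_equiv_class_iff) auto
  then show ?thesis
    using assms unfolding CF_rel_def by auto
qed

lemma incl_lift:
  assumes "(f, c) \<in> level n"
  shows "incl n (f, c) = incl (n + i) (walk f c n i, restrict c {n + i<..})"
  unfolding incl_eq_iff[OF assms walk_level[OF assms]]
  by (rule exI[of _ i], rule exI[of _ 0]) (simp add: step_pow[OF assms])

lemma incl_inj:
  assumes "(f, c) \<in> level n" "(f', c') \<in> level n" "incl n (f, c) = incl n (f', c')"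
  shows "f = f' \<and> c = c'"
proof -
  obtain i j where "(CF_step G ^^ i) (n, f, c) = (CF_step G ^^ j) (n, f', c')"
    using assms incl_eq_iff by blast
  then have ij: "walk f c n i = walk f' c' n i" "restrict c {n + i<..} = restrict c' {n + i<..}"
    unfolding step_pow[OF assms(1)] step_pow[OF assms(2)] by auto
  have "c k = c' k" for k
  proof -
    \<comment> \<open>Up to \<open>n\<close> both functions are \<open>undefined\<close>, up to
      \<open>n + i\<close> they are determined by the product, and beyond that the restrictions
      coincide.\<close>
    consider "k \<le> n" | "n < k" "k \<le> n + i" | "n + i < k"
      by linarith
    then show ?thesis
    proof cases
      case 1
      then show ?thesis
        using assms(1,2) unfolding level_iff by (auto simp: PiE_def extensional_def)
    next
      case 2
      then show ?thesis
        using walk_inj[OF assms(1,2) ij(1)] by blast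
    next
      case 3
      then show ?thesis
        using ij(2) by (metis greaterThan_iff restrict_apply')
    qed
  qed
  then show ?thesis
    using walk_inj[OF assms(1,2) ij(1)] by blast
qed

lemma X_cases:
  assumes "x \<in> X"
  obtains n f c where "(f, c) \<in> level n" "x = incl n (f, c)"
  using assms unfolding CF_space_def CF_incl_def by (auto elim!: quotientE)

lemma incl_in_X: "(f, c) \<in> level n \<Longrightarrow> incl n (f, c) \<in> X"
  unfolding CF_space_def CF_incl_def by (auto intro!: quotientI)

lemma cylinder_iff: "x \<in> cylinder n f \<longleftrightarrow> (\<exists>c\<in>(\<Pi>\<^sub>E k\<in>{n<..}. C k). x = incl n (f, c))"
  unfolding CF_cylinder_def by auto

lemma cylinderE:
  assumes "x \<in> cylinder n f" "f \<in> F n"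
  obtains c where "(f, c) \<in> level n" "x = incl n (f, c)"
  using assms unfolding cylinder_iff level_iff by blast

lemma cylinder_subset_X: "f \<in> F n \<Longrightarrow> cylinder n f \<subseteq> X"
  using incl_in_X unfolding level_iff by (auto simp: cylinder_iff)

lemma incl_in_cylinder: "(f, c) \<in> level n \<Longrightarrow> incl n (f, c) \<in> cylinder (n + i) (walk f c n i)"
  unfolding cylinder_iff by (intro bexI[of _ "restrict c {n + i<..}"] incl_lift restrict_level)

lemma cylinder_disjoint:
  assumes "f \<in> F n" "f' \<in> F n" "x \<in> cylinder n f" "x \<in> cylinder n f'"
  shows "f = f'"
  using assms incl_inj by (metis cylinderE)

lemma incl_in_cylinder_iff:
  assumes "(f, c) \<in> level n" "u \<in> F (n + i)"
  shows "incl n (f, c) \<in> cylinder (n + i) u \<longleftrightarrow> u = walk f c n i"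
  using cylinder_disjoint[OF assms(2) walk_in_F[OF assms(1)]] incl_in_cylinder[OF assms(1)] by blast

lemma cylinder_split:
  assumes "f \<in> F n" "x \<in> cylinder n f"
  shows "\<exists>c\<in>C (Suc n). x \<in> cylinder (Suc n) (f \<otimes> c)"
proof -
  obtain c where c: "(f, c) \<in> level n" "x = incl n (f, c)"
    using assms by (metis cylinderE)
  then show ?thesis
    using incl_in_cylinder[OF c(1), of 1] level_coord[OF c(1), of n] by auto
qed

lemma cylinder_mult_subset:
  assumes f: "f \<in> F n" and c: "c \<in> C (Suc n)"
  shows "cylinder (Suc n) (f \<otimes> c) \<subseteq> cylinder n f"
proof
  fix x assume "x \<in> cylinder (Suc n) (f \<otimes> c)"
  then obtain d where d: "d \<in> (\<Pi>\<^sub>E k\<in>{Suc n<..}. C k)" "x = incl (Suc n) (f \<otimes> c, d)"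
    unfolding cylinder_iff by blast
  define e where "e = d(Suc n := c)"
  have "e \<in> (\<Pi>\<^sub>E k\<in>{n<..}. C k)"
    using d(1) c unfolding e_def by (auto simp: PiE_def Pi_def extensional_def)
  then have e: "(f, e) \<in> level n"
    using f by (simp add: level_iff)
  have "restrict e {n + 1<..} = d"
    using d(1) unfolding e_def by (auto simp: PiE_def extensional_def restrict_def fun_eq_iff)
  then have "incl n (f, e) = x"
    using incl_lift[OF e, of 1] d(2) by (simp add: e_def)
  then show "x \<in> cylinder n f"
    using incl_in_cylinder[OF e, of 0] by simp
qed

lemma cylinder_walk_subset: "(f, c) \<in> level n \<Longrightarrow> cylinder (n + i) (walk f c n i) \<subseteq> cylinder n f"
proof (induction i)
  case (Suc i)
  then show ?case
    using cylinder_mult_subset[OF walk_in_F[OF Suc.prems, of i] level_coord[OF Suc.prems, of "n + i"]]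
    by auto
qed simp

lemma cylinder_refine:
  assumes "f \<in> F n" "x \<in> cylinder n f"
  shows "\<exists>u\<in>F (n + i). x \<in> cylinder (n + i) u \<and> cylinder (n + i) u \<subseteq> cylinder n f"
proof -
  obtain c where c: "(f, c) \<in> level n" "x = incl n (f, c)"
    using assms by (metis cylinderE)
  then show ?thesis
    using incl_in_cylinder walk_in_F cylinder_walk_subset by blast
qed

lemma cylinder_nested:
  assumes "f \<in> F n" "u \<in> F (n + i)" "x \<in> cylinder n f" "x \<in> cylinder (n + i) u"
  shows "cylinder (n + i) u \<subseteq> cylinder n f"
  using cylinder_refine[OF assms(1,3), of i] cylinder_disjoint[OF assms(2) _ assms(4)] by blast

lemma cylinder_separate:
  assumes h: "\<And>m. \<exists>i\<ge>m. \<exists>u\<in>F i. x \<in> cylinder i u \<and> y \<in> cylinder i u"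
  shows "x = y"
proof -
  obtain n f where f: "f \<in> F n" "x \<in> cylinder n f" "y \<in> cylinder n f"
    using h[of 0] by blast
  obtain c where c: "(f, c) \<in> level n" "x = incl n (f, c)"
    using f by (metis cylinderE)
  obtain d where d: "(f, d) \<in> level n" "y = incl n (f, d)"
    using f by (metis cylinderE)
  have "c k = d k" for k
  proof (cases "k \<le> n")
    case True
    then show ?thesis
      using c(1) d(1) unfolding level_iff by (auto simp: PiE_def extensional_def)
  next
    case False
    obtain m u where m: "n + k \<le> m" "u \<in> F m" "x \<in> cylinder m u" "y \<in> cylinder m u"
      using h by blast
    then obtain i where i: "m = n + i"
      using le_Suc_ex[of n m] by auto
    have "walk f c n i = walk f d n i"
      using m incl_in_cylinder_iff[OF c(1), of u i] incl_in_cylinder_iff[OF d(1), of u i] c(2) d(2) i by simp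
    then show ?thesis
      using walk_inj[OF c(1) d(1)] False m(1) i by simp
  qed
  then show ?thesis
    using c(2) d(2) by (simp add: fun_eq_iff[of c d, THEN iffD2])
qed


subsection \<open>Topology\<close>

text \<open>The box in \<open>X_n\<close> that fixes the first coordinate and the next
  \<open>i\<close> ones; in the limit space it becomes a cylinder of level
  \<open>n + i\<close>.\<close>

definition window :: "nat \<Rightarrow> 'g \<Rightarrow> (nat \<Rightarrow> 'g) \<Rightarrow> nat \<Rightarrow> ('g \<times> (nat \<Rightarrow> 'g)) set" where
  "window n f c i = {f} \<times> (\<Pi>\<^sub>E k\<in>{n<..}. if k \<le> n + i then {c k} else C k)"

lemma mem_window_iff:
  assumes "(f, c) \<in> level n"
  shows "z \<in> window n f c i \<longleftrightarrow> z \<in> level n \<and> incl n z \<in> cylinder (n + i) (walk f c n i)"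
proof -
  obtain f' c' where z: "z = (f', c')"
    by (cases z)
  have "(f', c') \<in> window n f c i \<longleftrightarrow>
      (f', c') \<in> level n \<and> f' = f \<and> (\<forall>k. n < k \<and> k \<le> n + i \<longrightarrow> c' k = c k)"
  proof -
    have "c' k \<in> C k" if "n < k" "c' k = c k" for k
      using assms that unfolding level_iff PiE_def by auto
    then show ?thesis
      using assms unfolding window_def level_iff PiE_def by (auto simp: Pi_iff split: if_splits)
  qed
  also have "\<dots> \<longleftrightarrow> (f', c') \<in> level n \<and> walk f' c' n i = walk f c n i"
  proof -
    have "walk f c' n i = walk f c n i" if "\<forall>k. n < k \<and> k \<le> n + i \<longrightarrow> c' k = c k"
      using that by (induction i) auto
    then show ?thesis
      using walk_inj[OF _ assms] by blast
  qed
  also have "\<dots> \<longleftrightarrow> (f', c') \<in> level n \<and> incl n (f', c') \<in> cylinder (n + i) (walk f c n i)"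
    using incl_in_cylinder_iff walk_in_F[OF assms] by auto
  finally show ?thesis
    by (simp add: z)
qed

lemma openin_window:
  assumes "(f, c) \<in> level n"
  shows "openin (CF_level_topology C F n) (window n f c i)"
proof -
  have "finite {k \<in> {n<..}. (if k \<le> n + i then {c k} else C k) \<noteq> C k}"
    by (rule finite_subset[of _ "{..n + i}"]) auto
  moreover have "c k \<in> C k" if "n < k" for k
    using assms that unfolding level_iff PiE_def by auto
  ultimately show ?thesis
    using assms unfolding CF_level_topology_def window_def level_iff
    by (auto simp: openin_prod_Times_iff openin_PiE_gen)
qed

lemma openin_cylinder:
  assumes "u \<in> F m"
  shows "openin (CF_topology G C F) (cylinder m u)"
  unfolding openin_CF_topology
proof (intro conjI allI)
  show "cylinder m u \<subseteq> X"
    by (rule cylinder_subset_X[OF assms])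
  fix n
  let ?S = "{z \<in> level n. incl n z \<in> cylinder m u}"
  show "openin (CF_level_topology C F n) ?S"
  proof (subst openin_subopen, intro ballI)
    fix z assume "z \<in> ?S"
    moreover obtain f c where z: "z = (f, c)"
      by (cases z)
    ultimately have fc: "(f, c) \<in> level n" "incl n (f, c) \<in> cylinder m u"
      by auto
    have "cylinder (n + m) (walk f c n m) \<subseteq> cylinder m u"
      using cylinder_nested[OF assms, of "walk f c n m" n] walk_in_F[OF fc(1), of m] fc(2)
        incl_in_cylinder[OF fc(1), of m] by (simp add: add.commute)
    then have "window n f c m \<subseteq> ?S"
      using mem_window_iff[OF fc(1)] by blast
    moreover have "z \<in> window n f c m"
      unfolding z mem_window_iff[OF fc(1)] using fc incl_in_cylinder by blast
    ultimately show "\<exists>T. openin (CF_level_topology C F n) T \<and> z \<in> T \<and> T \<subseteq> ?S"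
      using openin_window[OF fc(1)] by blast
  qed
qed

lemma cylinder_in_open:
  assumes U: "openin (CF_topology G C F) U" and x: "x \<in> U"
  shows "\<exists>n. \<exists>f\<in>F n. x \<in> cylinder n f \<and> cylinder n f \<subseteq> U"
proof -
  have "x \<in> X"
    using U x unfolding openin_CF_topology by blast
  then obtain n f c where fc: "(f, c) \<in> level n" "x = incl n (f, c)"
    by (rule X_cases)
  have "openin (CF_level_topology C F n) {z \<in> level n. incl n z \<in> U}"
    using U unfolding openin_CF_topology by blast
  moreover have "(f, c) \<in> {z \<in> level n. incl n z \<in> U}"
    using fc x by simp
  ultimately obtain A B where AB: "openin (discrete_topology (F n)) A"
    "openin (product_topology (\<lambda>k. discrete_topology (C k)) {n<..}) B" "f \<in> A" "c \<in> B"
    "A \<times> B \<subseteq> {z \<in> level n. incl n z \<in> U}"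
    unfolding CF_level_topology_def openin_prod_topology_alt by meson
  obtain V where V: "finite {k \<in> {n<..}. V k \<noteq> C k}" "c \<in> Pi\<^sub>E {n<..} V" "Pi\<^sub>E {n<..} V \<subseteq> B"
    using AB(2,4) unfolding openin_product_topology_alt by auto
  \<comment> \<open>The last coordinate that the basic open box restricts; the inserted 0 covers a
    box without restrictions.\<close>
  define i where "i = Max (insert 0 {k \<in> {n<..}. V k \<noteq> C k})"
  have i: "V k = C k" if "n + i < k" for k
  proof (rule ccontr)
    assume "V k \<noteq> C k"
    then have "k \<le> i"
      unfolding i_def using V(1) that by (intro Max_ge) auto
    with that show False
      by simp
  qed
  have "window n f c i \<subseteq> A \<times> B"
  proof -
    have "(\<Pi>\<^sub>E k\<in>{n<..}. if k \<le> n + i then {c k} else C k) \<subseteq> Pi\<^sub>E {n<..} V"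
    proof (rule PiE_mono)
      fix k assume "k \<in> {n<..}"
      then show "(if k \<le> n + i then {c k} else C k) \<subseteq> V k"
        using PiE_mem[OF V(2), of k] i[of k] by simp
    qed
    then have "(\<Pi>\<^sub>E k\<in>{n<..}. if k \<le> n + i then {c k} else C k) \<subseteq> B"
      using V(3) by (rule subset_trans)
    moreover have "{f} \<subseteq> A"
      using AB(3) by simp
    ultimately show ?thesis
      unfolding window_def by (intro Sigma_mono)
  qed
  have "cylinder (n + i) (walk f c n i) \<subseteq> U"
  proof
    fix y assume y: "y \<in> cylinder (n + i) (walk f c n i)"
    then have "y \<in> cylinder n f"
      using cylinder_walk_subset[OF fc(1)] by blast
    then obtain d where d: "(f, d) \<in> level n" "y = incl n (f, d)"
      using fc(1) by (metis cylinderE level_iff)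
    then have "(f, d) \<in> window n f c i"
      using mem_window_iff[OF fc(1)] y by blast
    then show "y \<in> U"
      using \<open>window n f c i \<subseteq> A \<times> B\<close> AB(5) d(2) by blast
  qed
  then show ?thesis
    using walk_in_F[OF fc(1)] incl_in_cylinder[OF fc(1)] fc(2) by blast
qed

lemma space_CF_borel [simp]: "space (CF_borel G C F) = X"
  unfolding CF_borel_def by (rule space_measure_of) (auto simp: openin_CF_topology)

lemma cylinder_sets [measurable]: "f \<in> F n \<Longrightarrow> cylinder n f \<in> sets (CF_borel G C F)"
  unfolding CF_borel_def using openin_cylinder
  by (subst sets_measure_of) (auto simp: openin_CF_topology)

text \<open>Open sets are countable unions of cylinders whose levels belong to \<open>L\<close>. An
  arbitrary cofinal \<open>L\<close> is allowed because the stages visit only some levels of each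
  space.\<close>

lemma sets_CF_borel:
  assumes L: "\<And>m. \<exists>n\<ge>m. n \<in> L"
  shows "sets (CF_borel G C F) = sigma_sets X {cylinder n f | n f. n \<in> L \<and> f \<in> F n}" (is "_ = sigma_sets X ?E")
proof -
  have E: "?E \<subseteq> Pow X"
    using cylinder_subset_X by blast
  have "countable (\<Union>n. cylinder n ` F n)"
    using finite_F by (intro countable_UN countable_image) (auto intro: countable_finite)
  then have cE: "countable ?E"
    by (rule countable_subset[rotated]) blast
  have "U \<in> sigma_sets X ?E" if U: "openin (CF_topology G C F) U" for U
  proof -
    have "U = \<Union>{A \<in> ?E. A \<subseteq> U}"
    proof (intro equalityI subsetI)
      fix x assume "x \<in> U"
      then obtain n f where f: "f \<in> F n" "x \<in> cylinder n f" "cylinder n f \<subseteq> U"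
        using cylinder_in_open[OF U] by blast
      obtain i where i: "n + i \<in> L"
        using L[of n] le_Suc_ex by blast
      obtain u where "u \<in> F (n + i)" "x \<in> cylinder (n + i) u" "cylinder (n + i) u \<subseteq> cylinder n f"
        using cylinder_refine[OF f(1,2)] by blast
      then show "x \<in> \<Union>{A \<in> ?E. A \<subseteq> U}"
        using f(3) i by blast
    qed blast
    moreover have "countable {A \<in> ?E. A \<subseteq> U}"
      using cE by (rule countable_subset[rotated]) blast
    ultimately show ?thesis
      using sigma_sets_UNION[of "{A \<in> ?E. A \<subseteq> U}" X ?E] by (auto intro: sigma_sets.Basic)
  qed
  moreover have "sets (CF_borel G C F) = sigma_sets X {U. openin (CF_topology G C F) U}"
    unfolding CF_borel_def by (rule sets_measure_of) (auto simp: openin_CF_topology)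
  ultimately show ?thesis
  proof (simp only:, intro sigma_sets_eqI)
    fix A assume "A \<in> ?E"
    then show "A \<in> sigma_sets X {U. openin (CF_topology G C F) U}"
      using openin_cylinder by (auto intro: sigma_sets.Basic)
  qed simp
qed


subsection \<open>The Haar measure\<close>

definition level_set :: "nat \<Rightarrow> 'g CF_point set" where
  "level_set n = (\<Union>f\<in>F n. cylinder n f)"

definition weight_C :: "nat \<Rightarrow> real" where
  "weight_C n = 1 / (\<Prod>k=1..n. real (card (C k)))"

abbreviation "level_measure n \<equiv> CF_level_measure C F n"
abbreviation "pushed n \<equiv> distr (level_measure n) (CF_borel G C F) (incl n)"

lemma level_set_iff: "x \<in> level_set n \<longleftrightarrow> (\<exists>z\<in>level n. x = incl n z)"
  unfolding level_set_def CF_level_def by (auto simp: cylinder_iff)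

lemma level_set_sets [measurable]: "level_set n \<in> sets (CF_borel G C F)"
  unfolding level_set_def using finite_F cylinder_sets by (intro sets.finite_UN) auto

lemma level_set_mono: "n \<le> m \<Longrightarrow> level_set n \<subseteq> level_set m"
proof
  fix x assume "n \<le> m" "x \<in> level_set n"
  moreover then obtain f where "f \<in> F n" "x \<in> cylinder n f"
    unfolding level_set_def by blast
  ultimately show "x \<in> level_set m"
    using cylinder_refine[of f n x "m - n"] unfolding level_set_def by auto
qed

lemma level_set_union: "(\<Union>n. level_set n) = X"
proof (intro equalityI subsetI)
  fix x assume "x \<in> X"
  then show "x \<in> (\<Union>n. level_set n)"
    by (rule X_cases) (auto simp: level_set_iff)
next
  fix x assume "x \<in> (\<Union>n. level_set n)"
  then show "x \<in> X"
    using cylinder_subset_X unfolding level_set_def by blast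
qed

lemma weight_C_Suc: "weight_C (Suc n) = weight_C n / card (C (Suc n))"
  by (simp add: weight_C_def)

lemma weight_C_pos: "0 < weight_C n"
proof -
  have "0 < card (C k)" if "k \<in> {1..n}" for k
    using that card_C[of "k - 1"] by simp
  then show ?thesis
    unfolding weight_C_def by (auto intro!: prod_pos)
qed

lemma space_level_measure: "space (level_measure n) = level n"
  unfolding CF_level_measure_def CF_level_def
  by (simp add: space_pair_measure space_PiM space_point_measure space_uniform_count_measure)

lemma prob_space_C: "k \<in> {n<..} \<Longrightarrow> prob_space (uniform_count_measure (C k))"
  using finite_C[of "k - 1"] C_nonempty[of "k - 1"] by (intro prob_space_uniform_count_measure) auto

lemma window_measure:
  assumes fc: "(f, c) \<in> level n"
  shows "window n f c i \<in> sets (level_measure n)"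
    and "emeasure (level_measure n) (window n f c i) = ennreal (weight_C (n + i))"
proof -
  let ?M = "\<lambda>k. uniform_count_measure (C k)" and ?J = "{n<..n + i}"
  let ?B = "prod_emb {n<..} ?M ?J (\<Pi>\<^sub>E k\<in>?J. {c k})"
  have c: "c k \<in> C k" if "n < k" for k
    using fc that unfolding level_iff PiE_def by auto
  have B: "(\<Pi>\<^sub>E k\<in>{n<..}. if k \<le> n + i then {c k} else C k) = ?B"
    unfolding prod_emb_PiE_same_index prod_emb_def
    using c by (auto simp: PiE_iff space_uniform_count_measure extensional_def restrict_def split: if_splits) 
  have Bs: "?B \<in> sets (Pi\<^sub>M {n<..} ?M)"
    using c by (intro sets_PiM_I) (auto simp: sets_uniform_count_measure)
  interpret P: prob_space "Pi\<^sub>M {n<..} ?M"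
    by (intro prob_space_PiM prob_space_C)
  have f: "f \<in> F n"
    using fc by (simp add: level_iff)
  have fs: "{f} \<in> sets (point_measure (F n) (\<lambda>_. ennreal (weight_C n)))"
    using f by (simp add: sets_point_measure)
  have w: "window n f c i = {f} \<times> ?B"
    unfolding window_def B ..
  show "window n f c i \<in> sets (level_measure n)"
    unfolding w CF_level_measure_def weight_C_def[symmetric] using fs Bs by (intro pair_measureI)
  have "emeasure (Pi\<^sub>M {n<..} ?M) ?B = (\<Prod>k\<in>?J. emeasure (?M k) {c k})"
    using c prob_space_C by (intro emeasure_PiM_emb) (auto simp: sets_uniform_count_measure)
  also have "\<dots> = (\<Prod>k\<in>?J. ennreal (1 / card (C k)))"
  proof (intro prod.cong refl)
    fix k assume "k \<in> ?J"
    then have "finite (C k)"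
      using finite_C[of "k - 1"] by simp
    then show "emeasure (?M k) {c k} = ennreal (1 / card (C k))"
      using c[of k] \<open>k \<in> ?J\<close> by (subst emeasure_uniform_count_measure) (auto simp: ennreal_divide_numeral)
  qed
  also have "\<dots> = ennreal (\<Prod>k\<in>?J. 1 / card (C k))"
    by (rule prod_ennreal) simp
  finally have eB: "emeasure (Pi\<^sub>M {n<..} ?M) ?B = ennreal (\<Prod>k\<in>?J. 1 / card (C k))" .
  have "weight_C n * (\<Prod>k\<in>{n<..n + i}. 1 / card (C k)) = weight_C (n + i)" for i
  proof (induction i)
    case (Suc i)
    have "{n<..n + Suc i} = insert (Suc (n + i)) {n<..n + i}"
      by auto
    then show ?case
      using Suc by (simp add: weight_C_Suc)
  qed simp
  moreover have "emeasure (point_measure (F n) (\<lambda>_. ennreal (weight_C n))) {f} = ennreal (weight_C n)"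
    using f finite_F[of n] by (subst emeasure_point_measure_finite) auto
  ultimately show "emeasure (level_measure n) (window n f c i) = ennreal (weight_C (n + i))"
    unfolding w CF_level_measure_def weight_C_def[symmetric]
    using P.emeasure_pair_measure_Times[OF fs Bs] weight_C_pos[of n]
    by (simp add: eB ennreal_mult'[symmetric])
qed

lemma cylinder_or_disjoint:
  assumes "n \<le> m" "u \<in> F m"
  shows "(\<exists>f c. (f, c) \<in> level n \<and> u = walk f c n (m - n) \<and> cylinder m u \<subseteq> level_set n) \<or>
    cylinder m u \<inter> level_set n = {}"
proof (cases "cylinder m u \<inter> level_set n = {}")
  case False
  then obtain x f c where x: "x \<in> cylinder m u" "(f, c) \<in> level n" "x = incl n (f, c)"
    unfolding disjoint_iff level_set_iff by (metis surj_pair)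
  then have u: "u = walk f c n (m - n)"
    using incl_in_cylinder_iff[of f c n u "m - n"] assms by simp
  have "cylinder m u \<subseteq> cylinder n f"
    using cylinder_walk_subset[OF x(2), of "m - n"] assms(1) u by simp
  then have "cylinder m u \<subseteq> level_set n"
    using x(2) unfolding level_set_def level_iff by blast
  with u x(2) show ?thesis
    by blast
qed simp

lemma incl_vimage_cylinder:
  assumes "n \<le> m" "u \<in> F m"
  shows "incl n -` cylinder m u \<inter> level n \<in> sets (level_measure n)"
    and "emeasure (level_measure n) (incl n -` cylinder m u \<inter> level n) =
      (if cylinder m u \<subseteq> level_set n then ennreal (weight_C m) else 0)"
proof -
  have *: "incl n -` cylinder m u \<inter> level n \<in> sets (level_measure n) \<and>
    emeasure (level_measure n) (incl n -` cylinder m u \<inter> level n) =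
      (if cylinder m u \<subseteq> level_set n then ennreal (weight_C m) else 0)"
    using cylinder_or_disjoint[OF assms]
  proof
    assume "\<exists>f c. (f, c) \<in> level n \<and> u = walk f c n (m - n) \<and> cylinder m u \<subseteq> level_set n"
    then obtain f c where fc: "(f, c) \<in> level n" "u = walk f c n (m - n)" "cylinder m u \<subseteq> level_set n"
      by blast
    have "incl n -` cylinder m u \<inter> level n = window n f c (m - n)"
      using mem_window_iff[OF fc(1), of _ "m - n"] assms(1) fc(2) by auto
    then show ?thesis
      using window_measure[OF fc(1), of "m - n"] fc(3) assms(1) by simp
  next
    assume disj: "cylinder m u \<inter> level_set n = {}"
    then have "incl n -` cylinder m u \<inter> level n = {}"
      unfolding level_set_iff disjoint_iff by blast
    \<comment> \<open>Being nonempty, a cylinder disjoint from \<open>level_set n\<close> is not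
      contained in it, which selects the value 0.\<close>
    moreover have "cylinder m u \<noteq> {}"
    proof -
      have "(\<lambda>k\<in>{m<..}. SOME c. c \<in> C k) \<in> (\<Pi>\<^sub>E k\<in>{m<..}. C k)"
        using C_nonempty by (auto simp: some_in_eq gr0_conv_Suc dest!: less_imp_Suc_add)
      then show ?thesis
        unfolding cylinder_iff set_eq_iff by blast
    qed
    ultimately show ?thesis
      using disj by auto
  qed
  then show "incl n -` cylinder m u \<inter> level n \<in> sets (level_measure n)"
    "emeasure (level_measure n) (incl n -` cylinder m u \<inter> level n) =
      (if cylinder m u \<subseteq> level_set n then ennreal (weight_C m) else 0)"
    by auto
qed

lemma incl_measurable [measurable]: "incl n \<in> level_measure n \<rightarrow>\<^sub>M CF_borel G C F"
proof (rule measurable_sigma_sets)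
  show "sets (CF_borel G C F) = sigma_sets X {cylinder m f | m f. m \<in> {n..} \<and> f \<in> F m}"
    by (rule sets_CF_borel) (metis atLeast_iff max.cobounded1 max.cobounded2)
  show "incl n \<in> space (level_measure n) \<rightarrow> X"
    using incl_in_X by (auto simp: space_level_measure)
qed (use cylinder_subset_X incl_vimage_cylinder(1) in \<open>auto simp: space_level_measure\<close>)

lemma emeasure_pushed:
  assumes "n \<le> m" "u \<in> F m"
  shows "emeasure (pushed n) (cylinder m u) = (if cylinder m u \<subseteq> level_set n then ennreal (weight_C m) else 0)"
  using assms incl_vimage_cylinder(2)[OF assms] by (simp add: emeasure_distr space_level_measure cylinder_sets)

lemma measure_eqI_cylinders:
  assumes sets: "sets M = sets (CF_borel G C F)" "sets M' = sets (CF_borel G C F)"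
    and eq: "\<And>n f. N \<le> n \<Longrightarrow> f \<in> F n \<Longrightarrow> emeasure M (cylinder n f) = emeasure M' (cylinder n f)"
    and fin: "\<And>n f. N \<le> n \<Longrightarrow> f \<in> F n \<Longrightarrow> emeasure M (cylinder n f) \<noteq> \<infinity>"
  shows "M = M'"
proof (rule measure_eqI_nested)
  let ?Cy = "{cylinder m f | m f. m \<in> {N..} \<and> f \<in> F m}"
  have gen: "sets (CF_borel G C F) = sigma_sets X ?Cy"
    by (rule sets_CF_borel) (metis atLeast_iff max.cobounded1 max.cobounded2)
  show "sets M = sigma_sets X ?Cy" "sets M' = sigma_sets X ?Cy"
    using sets gen by auto
  show "\<Union>?Cy = X"
  proof (intro equalityI subsetI)
    fix x assume "x \<in> X"
    then obtain n where "x \<in> level_set n"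
      using level_set_union by blast
    then have "x \<in> level_set (max n N)"
      using level_set_mono[of n "max n N"] by auto
    then obtain f where "f \<in> F (max n N)" "x \<in> cylinder (max n N) f"
      unfolding level_set_def by blast
    moreover have "max n N \<in> {N..}"
      by simp
    ultimately show "x \<in> \<Union>?Cy"
      by blast
  qed (use cylinder_subset_X in blast)
  have "countable (\<Union>n. cylinder n ` F n)"
    using finite_F by (intro countable_UN countable_image) (auto intro: countable_finite)
  then show "countable ?Cy"
    by (rule countable_subset[rotated]) blast
next
  fix A B assume "A \<in> {cylinder m f | m f. m \<in> {N..} \<and> f \<in> F m}" "B \<in> {cylinder m f | m f. m \<in> {N..} \<and> f \<in> F m}"
  then obtain m u n v where *: "A = cylinder m u" "u \<in> F m" "B = cylinder n v" "v \<in> F n"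
    by blast
  have "cylinder m u \<inter> cylinder n v = {} \<or> cylinder n v \<subseteq> cylinder m u"
    if "m \<le> n" "u \<in> F m" "v \<in> F n" for m n u v
    using cylinder_nested[OF that(2), of v "n - m"] that by auto
  from this[of m n u v] this[of n m v u] * show "A \<inter> B = {} \<or> A \<subseteq> B \<or> B \<subseteq> A"
    by (cases "m \<le> n") auto
qed (use cylinder_subset_X eq fin in auto)

text \<open>Consistency of the level measures. It is checked on cylinders of level at least
  \<open>m\<close>, each of which lies inside or outside of \<open>level_set n\<close>.\<close>

lemma pushed_restrict:
  assumes "n \<le> m"
  shows "pushed n = density (pushed m) (indicator (level_set n))"
proof (rule measure_eqI_cylinders[of _ _ m])
  fix k f assume k: "m \<le> k" "f \<in> F k"
  have "emeasure (density (pushed m) (indicator (level_set n))) (cylinder k f) =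
      emeasure (pushed m) (level_set n \<inter> cylinder k f)"
    using cylinder_sets[OF k(2)] by (intro emeasure_restricted) auto
  also have "\<dots> = emeasure (pushed n) (cylinder k f)"
  proof (cases "cylinder k f \<subseteq> level_set n")
    case True
    then have "level_set n \<inter> cylinder k f = cylinder k f" "cylinder k f \<subseteq> level_set m"
      using level_set_mono[OF assms] by auto
    then show ?thesis
      using emeasure_pushed[of m k f] emeasure_pushed[of n k f] True k assms by simp
  next
    case False
    then have "level_set n \<inter> cylinder k f = {}"
      using cylinder_or_disjoint[of n k f] k assms by auto
    then show ?thesis
      using emeasure_pushed[of n k f] False k assms by simp
  qed
  finally show "emeasure (pushed n) (cylinder k f) =
      emeasure (density (pushed m) (indicator (level_set n))) (cylinder k f)" ..
  show "emeasure (pushed n) (cylinder k f) \<noteq> \<infinity>"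
    using emeasure_pushed[of n k f] k assms by simp
qed simp_all

lemma emeasure_pushed_restrict:
  "n \<le> m \<Longrightarrow> A \<in> sets (CF_borel G C F) \<Longrightarrow> emeasure (pushed n) A = emeasure (pushed m) (level_set n \<inter> A)"
  using emeasure_restricted[of "level_set n" "pushed m" A] pushed_restrict[of n m] by simp

lemma pushed_mono: "n \<le> m \<Longrightarrow> pushed n \<le> pushed m"
  unfolding le_measure[of "pushed n" "pushed m", simplified]
  by (auto simp: le_fun_def emeasure_pushed_restrict[of n m] emeasure_notin_sets intro!: emeasure_mono)

text \<open>The pushed measures form a chain, and on a chain the supremum of measures is computed
  set by set.\<close>

lemma emeasure_haar:
  assumes "A \<in> sets (CF_borel G C F)"
  shows "emeasure (CF_haar G C F) A = (SUP n. emeasure (pushed n) A)"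
  unfolding CF_haar_def
proof (rule emeasure_SUP_chain[where N = "CF_borel G C F"])
  show "Complete_Partial_Order.chain (\<le>) (range pushed)"
    unfolding Complete_Partial_Order.chain_def using pushed_mono nat_le_linear by blast
qed (use assms in auto)

lemma sets_haar [simp, measurable_cong]: "sets (CF_haar G C F) = sets (CF_borel G C F)"
  unfolding CF_haar_def by (rule sets_SUP) auto

lemma space_haar [simp]: "space (CF_haar G C F) = X"
  using sets_eq_imp_space_eq[OF sets_haar] by simp

lemma emeasure_pushed_ge:
  assumes "n \<le> m" "f \<in> F n"
  shows "emeasure (pushed m) (cylinder n f) = ennreal (weight_C n)"
proof -
  have sub: "cylinder n f \<subseteq> level_set n"
    using assms(2) unfolding level_set_def by blast
  then have "emeasure (pushed n) (cylinder n f) = emeasure (pushed m) (cylinder n f)"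
    using emeasure_pushed_restrict[OF assms(1) cylinder_sets[OF assms(2)]] by (simp add: Int_absorb1)
  then show ?thesis
    using emeasure_pushed[of n n f] assms(2) sub by simp
qed

lemma emeasure_haar_cylinder:
  assumes "f \<in> F n"
  shows "emeasure (CF_haar G C F) (cylinder n f) = ennreal (weight_C n)"
  unfolding emeasure_haar[OF cylinder_sets[OF assms]]
proof (rule antisym)
  show "(SUP m. emeasure (pushed m) (cylinder n f)) \<le> ennreal (weight_C n)"
  proof (rule SUP_least)
    fix m
    have "pushed m \<le> pushed (max m n)"
      by (rule pushed_mono) simp
    then have "emeasure (pushed m) (cylinder n f) \<le> emeasure (pushed (max m n)) (cylinder n f)"
      by (rule le_measureD3) simp
    then show "emeasure (pushed m) (cylinder n f) \<le> ennreal (weight_C n)"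
      using emeasure_pushed_ge[OF _ assms, of "max m n"] by simp
  qed
  show "ennreal (weight_C n) \<le> (SUP m. emeasure (pushed m) (cylinder n f))"
    using emeasure_pushed_ge[OF order_refl assms] by (intro SUP_upper2[of n]) auto
qed

lemma emeasure_haar_X: "emeasure (CF_haar G C F) X = (SUP n. ennreal (card (F n) * weight_C n))"
proof -
  have "emeasure (CF_haar G C F) (level_set n) = ennreal (card (F n) * weight_C n)" for n
  proof -
    have "disjoint_family_on (cylinder n) (F n)"
      unfolding disjoint_family_on_def using cylinder_disjoint by blast
    then have "emeasure (CF_haar G C F) (level_set n) = (\<Sum>f\<in>F n. emeasure (CF_haar G C F) (cylinder n f))"
      unfolding level_set_def using cylinder_sets finite_F by (intro sum_emeasure[symmetric]) auto
    also have "\<dots> = (\<Sum>f\<in>F n. ennreal (weight_C n))"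
      by (intro sum.cong refl emeasure_haar_cylinder)
    finally show ?thesis
      using weight_C_pos[of n] by (simp add: ennreal_mult ennreal_of_nat_eq_real_of_nat)
  qed
  moreover have "(SUP n. emeasure (CF_haar G C F) (level_set n)) = emeasure (CF_haar G C F) (\<Union>n. level_set n)"
    using level_set_mono by (intro SUP_emeasure_incseq) (auto simp: incseq_def)
  ultimately show ?thesis
    by (simp add: level_set_union)
qed

subsection \<open>Positions instead of group elements\<close>

abbreviation "tab \<equiv> CF_table G cs fs"

definition cyl :: "nat \<Rightarrow> nat \<Rightarrow> 'g CF_point set" where
  "cyl n i = cylinder n (fs n ! i)"

lemma fs_inj: "i < length (fs n) \<Longrightarrow> j < length (fs n) \<Longrightarrow> fs n ! i = fs n ! j \<Longrightarrow> i = j"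
  using distinct_fs nth_eq_iff_index_eq by blast

lemma cs_inj: "i < length (cs (Suc n)) \<Longrightarrow> j < length (cs (Suc n)) \<Longrightarrow> cs (Suc n) ! i = cs (Suc n) ! j \<Longrightarrow> i = j"
  using distinct_cs nth_eq_iff_index_eq by blast

lemma length_pos: "0 < length (fs n)" "0 < length (cs (Suc n))"
  using F_nonempty[of n] C_nonempty[of n] set_fs[of n] set_cs[of n] by auto

lemma tab_eq: "tab (pair n (pair i j)) = (if i < length (fs n) \<and> j < length (cs (Suc n))
    then Suc (LEAST k. k < length (fs (Suc n)) \<and> fs (Suc n) ! k = fs n ! i \<otimes> cs (Suc n) ! j) else 0)"
  by (simp add: CF_table_def)

lemma num_F_tab: "num_F tab n = length (fs n)"
  unfolding num_F_def tab_eq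
  by (rule Least_equality) (use length_pos(2)[of n] in \<open>auto split: if_splits\<close>)

lemma num_C_tab: "num_C tab n = length (cs (Suc n))"
  unfolding num_C_def tab_eq
  by (rule Least_equality) (use length_pos(1)[of n] in \<open>auto split: if_splits\<close>)

lemma mult_pos_tab:
  assumes "i < num_F tab n" "j < num_C tab n"
  shows "mult_pos tab n i j < num_F tab (Suc n)" "fs (Suc n) ! mult_pos tab n i j = fs n ! i \<otimes> cs (Suc n) ! j"
proof -
  have ij: "i < length (fs n)" "j < length (cs (Suc n))"
    using assms by (simp_all add: num_F_tab num_C_tab)
  have "\<exists>k. k < length (fs (Suc n)) \<and> fs (Suc n) ! k = fs n ! i \<otimes> cs (Suc n) ! j"
    using F_index[OF mult_in_F[OF F_nth[OF ij(1)] C_nth[OF ij(2)]]] by blast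
  from LeastI_ex[OF this]
  show "mult_pos tab n i j < num_F tab (Suc n)" "fs (Suc n) ! mult_pos tab n i j = fs n ! i \<otimes> cs (Suc n) ! j"
    using ij by (simp_all add: mult_pos_def tab_eq num_F_tab)
qed

lemma F_nth': "i < num_F tab n \<Longrightarrow> fs n ! i \<in> F n"
  and C_nth': "j < num_C tab n \<Longrightarrow> cs (Suc n) ! j \<in> C (Suc n)"
  using F_nth C_nth by (simp_all add: num_F_tab num_C_tab)

lemma nth_carrier: "i < num_F tab n \<Longrightarrow> fs n ! i \<in> carrier G"
  "j < num_C tab n \<Longrightarrow> cs (Suc n) ! j \<in> carrier G"
  using F_nth' F_carrier C_nth' C_carrier by blast+

lemma F_index': "f \<in> F n \<Longrightarrow> \<exists>i<num_F tab n. fs n ! i = f"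
  using F_index by (simp add: num_F_tab)

sublocale table: valid_table tab
proof
  fix n
  show "\<exists>i. tab (pair n (pair i 0)) = 0"
    by (rule exI[of _ "length (fs n)"]) (simp add: tab_eq)
  show "\<exists>j. tab (pair n (pair 0 j)) = 0"
    by (rule exI[of _ "length (cs (Suc n))"]) (simp add: tab_eq)
  show "num_F tab 0 = 1"
    using card_F_0 by (simp add: num_F_tab length_fs)
  show "2 \<le> num_C tab n"
    using card_C[of n] by (simp add: num_C_tab length_cs)
  fix i j assume ij: "i < num_F tab n" "j < num_C tab n"
  show "mult_pos tab n i j < num_F tab (Suc n)"
    by (rule mult_pos_tab[OF ij])
  fix i' j' assume ij': "i' < num_F tab n" "j' < num_C tab n" "mult_pos tab n i j = mult_pos tab n i' j'"
  then have "fs n ! i \<otimes> cs (Suc n) ! j = fs n ! i' \<otimes> cs (Suc n) ! j'"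
    using mult_pos_tab(2)[OF ij] mult_pos_tab(2)[OF ij'(1,2)] by simp
  then show "i = i' \<and> j = j'"
    using mult_cancel[OF F_nth'[OF ij(1)] C_nth'[OF ij(2)] F_nth'[OF ij'(1)] C_nth'[OF ij'(2)]]
      fs_inj cs_inj ij ij' by (simp add: num_F_tab num_C_tab)
qed

primrec word :: "nat \<Rightarrow> nat \<Rightarrow> nat \<Rightarrow> 'g" where
  "word L b 0 = \<one>"
| "word L b (Suc t) = word L b t \<otimes> cs (Suc (L + t)) ! (b div num_words tab L t mod num_C tab (L + t))"

lemma word_carrier: "word L b t \<in> carrier G"
  by (induction t) (auto intro!: nth_carrier)

text \<open>By associativity, extension is right multiplication by a word that does not involve
  \<open>i\<close>; therefore it commutes with left translations.\<close>

lemma nth_extend: "i < num_F tab L \<Longrightarrow> fs (L + t) ! extend tab L t i b = fs L ! i \<otimes> word L b t"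
proof (induction t)
  case (Suc t)
  then show ?case
    using mult_pos_tab(2)[OF table.extend_less[OF Suc.prems], of _ t b]
    by (simp add: extend_Suc m_assoc nth_carrier word_carrier)
qed (simp add: nth_carrier)

lemma cyl_disjoint: "i < num_F tab n \<Longrightarrow> j < num_F tab n \<Longrightarrow> x \<in> cyl n i \<Longrightarrow> x \<in> cyl n j \<Longrightarrow> i = j"
  unfolding cyl_def using cylinder_disjoint F_nth' fs_inj by (metis num_F_tab)

lemma cyl_split:
  assumes "i < num_F tab L" "x \<in> cyl L i"
  shows "\<exists>b<num_words tab L t. x \<in> cyl (L + t) (extend tab L t i b)"
proof (induction t)
  case (Suc t)
  let ?P = "num_words tab L t"
  obtain b where b: "b < ?P" "x \<in> cyl (L + t) (extend tab L t i b)"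
    using Suc by blast
  have u: "extend tab L t i b < num_F tab (L + t)"
    by (rule table.extend_less[OF assms(1)])
  obtain c where c: "c \<in> C (Suc (L + t))" "x \<in> cylinder (Suc (L + t)) (fs (L + t) ! extend tab L t i b \<otimes> c)"
    using cylinder_split[OF F_nth'[OF u]] b(2) unfolding cyl_def by blast
  obtain j where j: "j < num_C tab (L + t)" "cs (Suc (L + t)) ! j = c"
    using C_index[OF c(1)] by (auto simp: num_C_tab)
  \<comment> \<open>The new letter becomes the top digit of the word number.\<close>
  have "b + ?P * j < num_words tab L (Suc t)"
    using mixed_radix_less[OF b(1) j(1)] by (simp add: num_words_Suc)
  moreover have "extend tab L (Suc t) i (b + ?P * j) = mult_pos tab (L + t) (extend tab L t i b) j"
    using b(1) j(1) extend_cong[of "b + ?P * j" tab L t b i] by (simp add: extend_Suc)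
  moreover have "x \<in> cyl (L + Suc t) (mult_pos tab (L + t) (extend tab L t i b) j)"
    using mult_pos_tab(2)[OF u j(1)] c(2) j(2) by (simp add: cyl_def)
  ultimately show ?case
    by metis
qed (use assms in auto)

lemma cyl_extend_subset: "i < num_F tab L \<Longrightarrow> cyl (L + t) (extend tab L t i b) \<subseteq> cyl L i"
proof (induction t)
  case (Suc t)
  let ?j = "b div num_words tab L t mod num_C tab (L + t)"
  have u: "extend tab L t i b < num_F tab (L + t)"
    by (rule table.extend_less[OF Suc.prems])
  have j: "?j < num_C tab (L + t)"
    by simp
  have "cyl (L + Suc t) (extend tab L (Suc t) i b) \<subseteq> cyl (L + t) (extend tab L t i b)"
    using cylinder_mult_subset[OF F_nth'[OF u] C_nth'[OF j]] mult_pos_tab(2)[OF u j]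
    by (simp add: cyl_def extend_Suc)
  then show ?case
    using Suc by blast
qed simp

lemma path_limit:
  assumes f: "\<And>m. n \<le> m \<Longrightarrow> f m < num_F tab m \<and> (\<exists>j<num_C tab m. f (Suc m) = mult_pos tab m (f m) j)"
  shows "\<exists>x. \<forall>m\<ge>n. x \<in> cyl m (f m)"
proof -
  obtain j where j: "\<And>m. n \<le> m \<Longrightarrow> j m < num_C tab m \<and> f (Suc m) = mult_pos tab m (f m) (j m)"
    using f by metis
  define c where "c = (\<lambda>k\<in>{n<..}. cs k ! j (k - 1))"
  have "c k \<in> C k" if "n < k" for k
    using C_nth'[of "j (k - 1)" "k - 1"] j[of "k - 1"] that by (cases k) (auto simp: c_def)
  then have fc: "(fs n ! f n, c) \<in> level n"
    using F_nth' f[of n] by (auto simp: level_iff c_def)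
  have "walk (fs n ! f n) c n i = fs (n + i) ! f (n + i)" for i
  proof (induction i)
    case (Suc i)
    then show ?case
      using mult_pos_tab(2)[of "f (n + i)" "n + i" "j (n + i)"] f[of "n + i"] j[of "n + i"] by (simp add: c_def)
  qed simp
  then have "incl n (fs n ! f n, c) \<in> cyl (n + i) (f (n + i))" for i
    using incl_in_cylinder[OF fc, of i] by (simp add: cyl_def)
  then show ?thesis
    using le_Suc_ex by blast
qed

text \<open>The levels between \<open>h k\<close> and \<open>h (Suc k)\<close> are filled in by
  partial extensions, which reduces the claim to a path through consecutive levels.\<close>

lemma extend_limit:
  assumes h: "\<And>k. h k < h (Suc k)"
    and v: "\<And>k. v k < num_F tab (h k)"
    and step: "\<And>k. v (Suc k) = extend tab (h k) (h (Suc k) - h k) (v k) (b k)"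
  shows "\<exists>x. \<forall>k. x \<in> cyl (h k) (v k)"
proof -
  have sm: "strict_mono h"
    using h by (rule strict_monoI_Suc)
  have ex: "\<exists>k. m < h (Suc k)" for m
    using strict_mono_imp_increasing[OF sm, of "Suc m"] by (intro exI[of _ m]) simp
  \<comment> \<open>For \<open>m\<close> from \<open>h 0\<close> on, \<open>\<kappa> m\<close> is
    the \<open>k\<close> with \<open>h k <= m < h (Suc k)\<close>.\<close>
  define \<kappa> where "\<kappa> m = (LEAST k. m < h (Suc k))" for m
  have up: "m < h (Suc (\<kappa> m))" for m
    unfolding \<kappa>_def using ex by (rule LeastI_ex)
  have low: "h (\<kappa> m) \<le> m" if "h 0 \<le> m" for m
  proof (cases "\<kappa> m")
    case (Suc k)
    then have "\<not> m < h (Suc k)"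
      unfolding \<kappa>_def by (intro not_less_Least) simp
    with Suc show ?thesis
      by simp
  qed (use that in simp)
  have \<kappa>_unique: "\<kappa> m = k" if "h k \<le> m" "m < h (Suc k)" for m k
    unfolding \<kappa>_def
  proof (rule Least_equality)
    fix i assume "m < h (Suc i)"
    then have "h k < h (Suc i)"
      using that by simp
    then show "k \<le> i"
      using sm by (simp add: strict_mono_less less_Suc_eq_le)
  qed (use that in simp)
  define f where "f m = extend tab (h (\<kappa> m)) (m - h (\<kappa> m)) (v (\<kappa> m)) (b (\<kappa> m))" for m
  have fh: "f (h k) = v k" for k
    using \<kappa>_unique[of k "h k"] h[of k] by (simp add: f_def)
  have "\<exists>x. \<forall>m\<ge>h 0. x \<in> cyl m (f m)"
  proof (rule path_limit)
    fix m assume m: "h 0 \<le> m"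
    let ?k = "\<kappa> m"
    have l: "h ?k \<le> m" "m < h (Suc ?k)"
      using low[OF m] up by auto
    have fm: "f m < num_F tab m"
      using table.extend_less[OF v, of ?k "m - h ?k" "b ?k"] l(1) by (simp add: f_def)
    have e: "extend tab (h ?k) (Suc m - h ?k) (v ?k) (b ?k) =
        mult_pos tab m (f m) (b ?k div num_words tab (h ?k) (m - h ?k) mod num_C tab m)"
      using l(1) by (simp add: f_def Suc_diff_le extend_Suc)
    have "f (Suc m) = extend tab (h ?k) (Suc m - h ?k) (v ?k) (b ?k)"
    proof (cases "Suc m < h (Suc ?k)")
      case True
      then have "\<kappa> (Suc m) = ?k"
        using l by (intro \<kappa>_unique) auto
      then show ?thesis
        by (simp add: f_def)
    next
      case False
      then have "Suc m = h (Suc ?k)"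
        using l(2) by simp
      then show ?thesis
        using fh[of "Suc ?k"] step[of ?k] by simp
    qed
    then show "f m < num_F tab m \<and> (\<exists>j<num_C tab m. f (Suc m) = mult_pos tab m (f m) j)"
      using fm e table.num_C_pos[of m] mod_less_divisor by metis
  qed
  then show ?thesis
    using fh sm by (metis strict_mono_less_eq zero_le)
qed

lemma cyl_separate:
  assumes "\<And>m. \<exists>n\<ge>m. \<exists>u<num_F tab n. x \<in> cyl n u \<and> y \<in> cyl n u"
  shows "x = y"
proof (rule cylinder_separate)
  fix m
  obtain n u where "m \<le> n" "u < num_F tab n" "x \<in> cyl n u" "y \<in> cyl n u"
    using assms by blast
  then show "\<exists>i\<ge>m. \<exists>u\<in>F i. x \<in> cylinder i u \<and> y \<in> cylinder i u"
    using F_nth' unfolding cyl_def by blast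
qed

lemma cyl_cover:
  assumes "x \<in> X" and L: "\<And>m. \<exists>n\<ge>m. n \<in> L"
  shows "\<exists>n\<in>L. \<exists>u<num_F tab n. x \<in> cyl n u"
proof -
  obtain m f c where x: "(f, c) \<in> level m" "x = incl m (f, c)"
    using assms(1) by (rule X_cases)
  obtain i where i: "m + i \<in> L"
    using L[of m] le_Suc_ex by blast
  obtain u where "u < num_F tab (m + i)" "fs (m + i) ! u = walk f c m i"
    using F_index'[OF walk_in_F[OF x(1)]] by blast
  then show ?thesis
    using i incl_in_cylinder[OF x(1), of i] x(2) unfolding cyl_def by metis
qed

lemma cyl_sets: "i < num_F tab n \<Longrightarrow> cyl n i \<in> sets (CF_borel G C F)"
  unfolding cyl_def by (intro cylinder_sets F_nth')

lemma sets_CF_borel_cyl: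
  assumes "\<And>m. \<exists>n\<ge>m. n \<in> L"
  shows "sets (CF_borel G C F) = sigma_sets X {cyl n i | n i. n \<in> L \<and> i < num_F tab n}"
proof -
  have "{cyl n i | n i. n \<in> L \<and> i < num_F tab n} = {cylinder n f | n f. n \<in> L \<and> f \<in> F n}"
    unfolding cyl_def using F_nth' F_index' by blast
  then show ?thesis
    using sets_CF_borel[OF assms] by simp
qed

lemma weight_C_eq: "weight_C n = 1 / num_words tab 0 n"
proof (induction n)
  case (Suc n)
  then show ?case
    by (simp add: weight_C_Suc num_words_Suc num_C_tab length_cs)
qed (simp add: weight_C_def)

lemma emeasure_haar_cyl: "i < num_F tab n \<Longrightarrow> emeasure (CF_haar G C F) (cyl n i) = ennreal (1 / num_words tab 0 n)"
  unfolding cyl_def using emeasure_haar_cylinder[OF F_nth'] by (simp add: weight_C_eq)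

lemma haar_X_mass: "emeasure (CF_haar G C F) X = (SUP n. ennreal (table.mass n))"
  unfolding emeasure_haar_X by (simp add: table.mass_def weight_C_eq num_F_tab length_fs)

lemma mass_bounded:
  assumes "emeasure (CF_haar G C F) X < \<infinity>"
  shows "\<exists>B. \<forall>n. table.mass n \<le> B"
proof (intro exI allI)
  fix n
  have "ennreal (table.mass n) \<le> emeasure (CF_haar G C F) X"
    unfolding haar_X_mass by (rule SUP_upper) simp
  then have "enn2real (ennreal (table.mass n)) \<le> enn2real (emeasure (CF_haar G C F) X)"
    using assms by (intro enn2real_mono) auto
  then show "table.mass n \<le> enn2real (emeasure (CF_haar G C F) X)"
    using table.mass_ge_1[of n] by simp
qed

lemma mass_unbounded:
  assumes "emeasure (CF_haar G C F) X = \<infinity>"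
  shows "unbounded_table tab"
  unfolding unbounded_table_def
proof
  fix B :: nat
  have "ennreal B < (SUP n. ennreal (table.mass n))"
    using assms unfolding haar_X_mass by (metis ennreal_less_top infinity_ennreal_def)
  then obtain n where "ennreal B < ennreal (table.mass n)"
    unfolding less_SUP_iff by blast
  then have "B < table.mass n"
    by (simp add: ennreal_less_iff)
  then have "real B * real (num_words tab 0 n) < real (num_F tab n)"
    by (simp add: table.mass_def less_divide_eq)
  then have "B * num_words tab 0 n < num_F tab n"
    by (metis of_nat_less_iff of_nat_mult)
  then show "\<exists>n. B * num_words tab 0 n \<le> num_F tab n"
    using less_imp_le by blast
qed


subsection \<open>The action and the tail relation\<close>

lemma walk_mult_left:
  assumes "(f, c) \<in> level n" "g \<in> carrier G"
  shows "walk (g \<otimes> f) c n i = g \<otimes> walk f c n i"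
proof (induction i)
  case (Suc i)
  have "walk f c n i \<in> carrier G" "c (Suc (n + i)) \<in> carrier G"
    using F_carrier[OF walk_in_F[OF assms(1)]] C_carrier[OF level_coord[OF assms(1)]] by auto
  with Suc assms(2) show ?case
    by (simp add: m_assoc)
qed simp

lemma level_left: "(f, c) \<in> level n \<Longrightarrow> g \<otimes> f \<in> F n \<Longrightarrow> (g \<otimes> f, c) \<in> level n"
  by (simp add: level_iff)

lemma CF_dom_iff: "x \<in> CF_dom G C F g \<longleftrightarrow>
    (\<exists>n f c. (f, c) \<in> level n \<and> g \<otimes> f \<in> F n \<and> x = incl n (f, c))"
  unfolding CF_dom_def by auto

text \<open>Two representatives of a point become equal after lifting, and lifting commutes with
  left multiplication; so the image does not depend on the representative.\<close>

lemma act_eq: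
  assumes g: "g \<in> carrier G" and fc: "(f, c) \<in> level n" "g \<otimes> f \<in> F n"
  shows "CF_act G C F g (incl n (f, c)) = incl n (g \<otimes> f, c)"
  unfolding CF_act_def
proof (rule the_equality)
  show "\<exists>m f' c'. (f', c') \<in> level m \<and> g \<otimes> f' \<in> F m \<and> incl n (f, c) = incl m (f', c') \<and>
      incl n (g \<otimes> f, c) = incl m (g \<otimes> f', c')"
    using fc by blast
next
  fix y assume "\<exists>m f' c'. (f', c') \<in> level m \<and> g \<otimes> f' \<in> F m \<and> incl n (f, c) = incl m (f', c') \<and>
      y = incl m (g \<otimes> f', c')"
  then obtain m f' c' where *: "(f', c') \<in> level m" "g \<otimes> f' \<in> F m" "incl n (f, c) = incl m (f', c')"
    "y = incl m (g \<otimes> f', c')"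
    by blast
  obtain i j where "(CF_step G ^^ i) (n, f, c) = (CF_step G ^^ j) (m, f', c')"
    using *(3) incl_eq_iff[OF fc(1) *(1)] by blast
  then have "n + i = m + j" "walk f c n i = walk f' c' m j" "restrict c {n + i<..} = restrict c' {m + j<..}"
    unfolding step_pow[OF fc(1)] step_pow[OF *(1)] by auto
  moreover have "incl n (g \<otimes> f, c) = incl (n + i) (g \<otimes> walk f c n i, restrict c {n + i<..})"
    using incl_lift[OF level_left[OF fc], of i] walk_mult_left[OF fc(1) g] by simp
  moreover have "y = incl (m + j) (g \<otimes> walk f' c' m j, restrict c' {m + j<..})"
    using incl_lift[OF level_left[OF *(1,2)], of j] walk_mult_left[OF *(1) g] *(4) by simp
  ultimately show "y = incl n (g \<otimes> f, c)"
    by simp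
qed

lemma dom_lift:
  assumes "g \<in> carrier G" "x \<in> CF_dom G C F g"
  shows "\<exists>n. \<forall>m\<ge>n. \<exists>f c. (f, c) \<in> level m \<and> g \<otimes> f \<in> F m \<and> x = incl m (f, c)"
proof -
  obtain n f c where *: "(f, c) \<in> level n" "g \<otimes> f \<in> F n" "x = incl n (f, c)"
    using assms(2) unfolding CF_dom_iff by blast
  have "(walk f c n i, restrict c {n + i<..}) \<in> level (n + i) \<and> g \<otimes> walk f c n i \<in> F (n + i) \<and>
      x = incl (n + i) (walk f c n i, restrict c {n + i<..})" for i
    using walk_level[OF *(1)] incl_lift[OF *(1)] *(3) walk_in_F[OF level_left[OF *(1,2)], of i]
      walk_mult_left[OF *(1) assms(1), of i] by simp
  then show ?thesis
    by (metis le_Suc_ex)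
qed

lemma domain_dom: "x \<in> CF_domain G C F \<Longrightarrow> g \<in> carrier G \<Longrightarrow> x \<in> CF_dom G C F g"
  unfolding CF_domain_def by blast

lemma domain_subset: "CF_domain G C F \<subseteq> X"
proof
  fix x assume "x \<in> CF_domain G C F"
  then show "x \<in> X"
    using domain_dom[OF _ one_closed] incl_in_X unfolding CF_dom_iff by blast
qed

text \<open>To apply \<open>k\<close> after \<open>g\<close>, a level is taken at which both
  \<open>g\<close> and the product of \<open>k\<close> and \<open>g\<close> can be applied.\<close>

lemma act_in_domain:
  assumes x: "x \<in> CF_domain G C F" and g: "g \<in> carrier G"
  shows "CF_act G C F g x \<in> CF_domain G C F"
  unfolding CF_domain_def
proof
  fix k assume k: "k \<in> carrier G"
  obtain n where n: "\<And>m. n \<le> m \<Longrightarrow> \<exists>f c. (f, c) \<in> level m \<and> g \<otimes> f \<in> F m \<and> x = incl m (f, c)"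
    using dom_lift[OF g domain_dom[OF x g]] by blast
  obtain n' where n': "\<And>m. n' \<le> m \<Longrightarrow> \<exists>f c. (f, c) \<in> level m \<and> k \<otimes> g \<otimes> f \<in> F m \<and> x = incl m (f, c)"
    using dom_lift[OF _ domain_dom[OF x], of "k \<otimes> g"] g k by auto
  let ?m = "max n n'"
  obtain f c where fc: "(f, c) \<in> level ?m" "g \<otimes> f \<in> F ?m" "x = incl ?m (f, c)"
    using n[of ?m] by auto
  obtain f' c' where fc': "(f', c') \<in> level ?m" "k \<otimes> g \<otimes> f' \<in> F ?m" "x = incl ?m (f', c')"
    using n'[of ?m] by auto
  have "f' = f"
    using incl_inj[OF fc(1) fc'(1)] fc(3) fc'(3) by simp
  then have "k \<otimes> (g \<otimes> f) \<in> F ?m"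
    using fc'(2) k g F_carrier[of f ?m] fc(1) by (simp add: m_assoc level_iff)
  then show "CF_act G C F g x \<in> CF_dom G C F k"
    unfolding fc(3) act_eq[OF g fc(1,2)] CF_dom_iff using level_left[OF fc(1,2)] by blast
qed

lemma orbit_translate:
  assumes x: "x \<in> CF_domain G C F" and y: "y \<in> CF_orbit G C F x"
  shows "\<exists>g\<in>carrier G. \<exists>n. \<forall>m\<ge>n. \<forall>u\<in>F m. x \<in> cylinder m u \<longrightarrow> g \<otimes> u \<in> F m \<and> y \<in> cylinder m (g \<otimes> u)"
proof -
  obtain g where g: "g \<in> carrier G" "y = CF_act G C F g x"
    using y unfolding CF_orbit_def by blast
  obtain n f c where *: "(f, c) \<in> level n" "g \<otimes> f \<in> F n" "x = incl n (f, c)"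
    using domain_dom[OF x g(1)] unfolding CF_dom_iff by blast
  have "g \<otimes> u \<in> F (n + i) \<and> y \<in> cylinder (n + i) (g \<otimes> u)" if "u \<in> F (n + i)" "x \<in> cylinder (n + i) u" for i u
  proof -
    have "u = walk f c n i"
      using that incl_in_cylinder_iff[OF *(1)] *(3) by simp
    then have "g \<otimes> u = walk (g \<otimes> f) c n i"
      using walk_mult_left[OF *(1) g(1)] by simp
    then show ?thesis
      using incl_in_cylinder[OF level_left[OF *(1,2)]] walk_in_F[OF level_left[OF *(1,2)]]
        act_eq[OF g(1) *(1,2)] g(2) *(3) by simp
  qed
  then show ?thesis
    using g(1) by (metis le_Suc_ex)
qed

lemma act_inv:
  assumes y: "y \<in> CF_domain G C F" and g: "g \<in> carrier G"
  shows "CF_act G C F g (CF_act G C F (inv g) y) = y"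
proof -
  obtain n f c where *: "(f, c) \<in> level n" "inv g \<otimes> f \<in> F n" "y = incl n (f, c)"
    using domain_dom[OF y inv_closed[OF g]] unfolding CF_dom_iff by blast
  have f: "g \<otimes> (inv g \<otimes> f) = f"
    using g *(1) F_carrier[of f n] by (simp add: level_iff m_assoc[symmetric])
  have "CF_act G C F (inv g) y = incl n (inv g \<otimes> f, c)"
    unfolding *(3) by (rule act_eq[OF inv_closed[OF g] *(1,2)])
  moreover have "CF_act G C F g (incl n (inv g \<otimes> f, c)) = incl n (g \<otimes> (inv g \<otimes> f), c)"
    using act_eq[OF g level_left[OF *(1,2)]] *(1) f by (simp add: level_iff)
  ultimately show ?thesis
    by (simp add: f *(3))
qed

lemma act_image:
  assumes "Y \<subseteq> CF_domain G C F" and Y: "\<And>y z. y \<in> Y \<Longrightarrow> z \<in> CF_orbit G C F y \<Longrightarrow> z \<in> Y"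
    and g: "g \<in> carrier G"
  shows "CF_act G C F g ` Y = Y"
proof (intro equalityI subsetI)
  fix z assume "z \<in> CF_act G C F g ` Y"
  then show "z \<in> Y"
    using Y g unfolding CF_orbit_def by blast
next
  fix y assume y: "y \<in> Y"
  then have "CF_act G C F (inv g) y \<in> Y"
    using Y[OF y] inv_closed[OF g] unfolding CF_orbit_def by blast
  then show "y \<in> CF_act G C F g ` Y"
    using act_inv[OF _ g, of y] y assms(1) by (metis image_eqI subsetD)
qed

lemma orbit_in_domain: "x \<in> CF_domain G C F \<Longrightarrow> y \<in> CF_orbit G C F x \<Longrightarrow> y \<in> CF_domain G C F"
  unfolding CF_orbit_def using act_in_domain by blast

text \<open>The relation \<open>tail\<close> of the interlaced partitions, formulated within one
  space along the levels \<open>h\<close>.\<close>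

definition index_tail :: "(nat \<Rightarrow> nat) \<Rightarrow> 'g CF_point \<Rightarrow> 'g CF_point \<Rightarrow> bool" where
  "index_tail h x x' \<longleftrightarrow> (\<exists>k v v' b. \<forall>l\<ge>k. v l < num_F tab (h l) \<and> v' l < num_F tab (h l) \<and>
     b l < num_words tab (h l) (h (Suc l) - h l) \<and> x \<in> cyl (h l) (v l) \<and> x' \<in> cyl (h l) (v' l) \<and>
     v (Suc l) = extend tab (h l) (h (Suc l) - h l) (v l) (b l) \<and>
     v' (Suc l) = extend tab (h l) (h (Suc l) - h l) (v' l) (b l))"

text \<open>From some level on, \<open>g\<close> multiplies all positions of \<open>x\<close> from
  the left, and this does not affect the words on the right.\<close>

lemma orbit_index_tail:
  assumes h: "\<And>k. h k < h (Suc k)" and x: "x \<in> CF_domain G C F" and y: "y \<in> CF_orbit G C F x"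
  shows "index_tail h x y"
proof -
  have sm: "strict_mono h"
    using h by (rule strict_monoI_Suc)
  obtain g n where g: "g \<in> carrier G"
    and tr: "\<And>m u. n \<le> m \<Longrightarrow> u \<in> F m \<Longrightarrow> x \<in> cylinder m u \<Longrightarrow> g \<otimes> u \<in> F m \<and> y \<in> cylinder m (g \<otimes> u)"
    using orbit_translate[OF x y] by blast
  obtain n' f c where fc: "(f, c) \<in> level n'" "x = incl n' (f, c)"
    using x domain_subset X_cases by blast
  define k where "k = n + n'"
  have hl: "n \<le> h l" "n' \<le> h l" if "k \<le> l" for l
    using strict_mono_imp_increasing[OF sm, of l] that by (auto simp: k_def)
  have "\<exists>i<num_F tab (h l). x \<in> cyl (h l) i" if "k \<le> l" for l
  proof -
    obtain i where i: "h l = n' + i"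
      using hl(2)[OF \<open>k \<le> l\<close>] le_Suc_ex by blast
    obtain u where "u < num_F tab (h l)" "fs (h l) ! u = walk f c n' i"
      using F_index'[OF walk_in_F[OF fc(1), of i]] i by auto
    then show ?thesis
      using incl_in_cylinder[OF fc(1), of i] fc(2) i unfolding cyl_def by metis
  qed
  then obtain v where v: "\<And>l. k \<le> l \<Longrightarrow> v l < num_F tab (h l) \<and> x \<in> cyl (h l) (v l)"
    by metis
  have "\<exists>j<num_F tab (h l). fs (h l) ! j = g \<otimes> fs (h l) ! v l" if "k \<le> l" for l
    using tr[OF hl(1)[OF that] F_nth', of "v l"] v[OF that] F_index' unfolding cyl_def by blast
  then obtain v' where v': "\<And>l. k \<le> l \<Longrightarrow> v' l < num_F tab (h l) \<and> fs (h l) ! v' l = g \<otimes> fs (h l) ! v l"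
    by metis
  have y': "y \<in> cyl (h l) (v' l)" if "k \<le> l" for l
    using tr[OF hl(1)[OF that] F_nth', of "v l"] v[OF that] v'[OF that] unfolding cyl_def by simp
  have L: "h l + (h (Suc l) - h l) = h (Suc l)" for l
    using h[of l] by simp
  have "\<exists>b<num_words tab (h l) (h (Suc l) - h l). x \<in> cyl (h (Suc l)) (extend tab (h l) (h (Suc l) - h l) (v l) b)"
    if "k \<le> l" for l
    using cyl_split[of "v l" "h l" x "h (Suc l) - h l"] v[OF that] L[of l] by simp
  then obtain b where b: "\<And>l. k \<le> l \<Longrightarrow> b l < num_words tab (h l) (h (Suc l) - h l) \<and>
      x \<in> cyl (h (Suc l)) (extend tab (h l) (h (Suc l) - h l) (v l) (b l))"
    by metis
  have less: "extend tab (h l) (h (Suc l) - h l) i (b l) < num_F tab (h (Suc l))" if "i < num_F tab (h l)" for l i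
    using table.extend_less[OF that, of "h (Suc l) - h l" "b l"] L[of l] by simp
  have ext: "v (Suc l) = extend tab (h l) (h (Suc l) - h l) (v l) (b l)" if "k \<le> l" for l
    by (rule cyl_disjoint[of _ "h (Suc l)" _ x]) (use v less b that in auto)
  have ext': "v' (Suc l) = extend tab (h l) (h (Suc l) - h l) (v' l) (b l)" if "k \<le> l" for l
  proof -
    have "fs (h (Suc l)) ! v' (Suc l) = g \<otimes> fs (h (Suc l)) ! v (Suc l)"
      using v' that by simp
    also have "fs (h (Suc l)) ! v (Suc l) = fs (h l) ! v l \<otimes> word (h l) (b l) (h (Suc l) - h l)"
      using nth_extend[of "v l" "h l" "h (Suc l) - h l" "b l"] v[OF that] ext[OF that] L[of l] by simp
    also have "g \<otimes> \<dots> = fs (h l) ! v' l \<otimes> word (h l) (b l) (h (Suc l) - h l)"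
      using v'[OF that] v[OF that] g by (simp add: m_assoc nth_carrier word_carrier)
    also have "\<dots> = fs (h (Suc l)) ! extend tab (h l) (h (Suc l) - h l) (v' l) (b l)"
      using nth_extend[of "v' l" "h l" "h (Suc l) - h l" "b l"] v'[OF that] L[of l] by simp
    finally show ?thesis
      by (intro fs_inj[of _ "h (Suc l)"])
        (use less[of "v' l" l] v'[OF that] v'[of "Suc l"] that in \<open>simp_all add: num_F_tab\<close>)
  qed
  show ?thesis
    unfolding index_tail_def
    by (rule exI[of _ k], rule exI[of _ v], rule exI[of _ v'], rule exI[of _ b])
      (use v v' y' b ext ext' in auto)
qed

text \<open>The quotient of the two elements at the first common level gives \<open>g\<close>.
  Common words carry the translation by \<open>g\<close> to all later levels, and these separate
  points.\<close>

lemma index_tail_orbit: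
  assumes h: "\<And>k. h k < h (Suc k)" and tl: "index_tail h x y"
  shows "y \<in> CF_orbit G C F x"
proof -
  have sm: "strict_mono h"
    using h by (rule strict_monoI_Suc)
  obtain k v v' b where *: "\<And>l. k \<le> l \<Longrightarrow> v l < num_F tab (h l) \<and> v' l < num_F tab (h l) \<and>
     b l < num_words tab (h l) (h (Suc l) - h l) \<and> x \<in> cyl (h l) (v l) \<and> y \<in> cyl (h l) (v' l) \<and>
     v (Suc l) = extend tab (h l) (h (Suc l) - h l) (v l) (b l) \<and>
     v' (Suc l) = extend tab (h l) (h (Suc l) - h l) (v' l) (b l)"
    using tl unfolding index_tail_def by blast
  define f f' g where "f = fs (h k) ! v k" and "f' = fs (h k) ! v' k" and "g = f' \<otimes> inv f"
  have f: "f \<in> F (h k)" "f' \<in> F (h k)"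
    using *[of k] F_nth' by (auto simp: f_def f'_def)
  then have g: "g \<in> carrier G" "g \<otimes> f = f'"
    using F_carrier by (auto simp: g_def m_assoc)
  have gv: "fs (h l) ! v' l = g \<otimes> fs (h l) ! v l" if "k \<le> l" for l
    using that
  proof (induction l rule: dec_induct)
    case base
    then show ?case
      using g by (simp add: f_def f'_def)
  next
    case (step l)
    have L: "h l + (h (Suc l) - h l) = h (Suc l)"
      using h[of l] by simp
    show ?case
      using nth_extend[of "v l" "h l" "h (Suc l) - h l" "b l"] nth_extend[of "v' l" "h l" "h (Suc l) - h l" "b l"]
        *[of l] step g L by (simp add: m_assoc nth_carrier word_carrier)
  qed
  obtain c where c: "(f, c) \<in> level (h k)" "x = incl (h k) (f, c)"
    using *[of k] f(1) unfolding cyl_def f_def[symmetric] by (metis cylinderE order_refl)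
  have c': "(f', c) \<in> level (h k)"
    using c(1) f(2) by (simp add: level_iff)
  have "incl (h k) (f', c) = y"
  proof (rule cyl_separate)
    fix m
    let ?l = "k + m"
    have m: "m \<le> h ?l"
      using strict_mono_imp_increasing[OF sm, of ?l] by simp
    obtain i where i: "h ?l = h k + i"
      using sm le_Suc_ex by (metis le_add1 strict_mono_less_eq)
    have "fs (h ?l) ! v ?l = walk f c (h k) i"
      using incl_in_cylinder_iff[OF c(1), of "fs (h ?l) ! v ?l" i] F_nth'[of "v ?l" "h ?l"] *[of ?l] c(2) i
      unfolding cyl_def by simp
    then have "fs (h ?l) ! v' ?l = walk f' c (h k) i"
      using gv[of ?l] walk_mult_left[OF c(1) g(1)] g(2) by simp
    then have "incl (h k) (f', c) \<in> cyl (h ?l) (v' ?l)"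
      using incl_in_cylinder[OF c', of i] i unfolding cyl_def by simp
    then show "\<exists>n\<ge>m. \<exists>u<num_F tab n. incl (h k) (f', c) \<in> cyl n u \<and> y \<in> cyl n u"
      using *[of ?l] m by (intro exI[of _ "h ?l"]) auto
  qed
  moreover have "CF_act G C F g x = incl (h k) (f', c)"
    using act_eq[OF g(1) c(1)] f(2) g(2) c(2) by simp
  ultimately show ?thesis
    using g(1) unfolding CF_orbit_def by blast
qed

lemma domain_sets:
  assumes "countable (carrier G)"
  shows "CF_domain G C F \<in> sets (CF_borel G C F)"
proof -
  have "CF_dom G C F g \<in> sets (CF_borel G C F)" for g
  proof -
    have "CF_dom G C F g = (\<Union>n. \<Union>f\<in>{f \<in> F n. g \<otimes> f \<in> F n}. cylinder n f)"
    proof (intro equalityI subsetI)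
      fix x assume "x \<in> CF_dom G C F g"
      then obtain n f c where "(f, c) \<in> level n" "g \<otimes> f \<in> F n" "x = incl n (f, c)"
        unfolding CF_dom_iff by blast
      moreover from this have "x \<in> cylinder n f"
        using incl_in_cylinder[of f c n 0] by simp
      ultimately show "x \<in> (\<Union>n. \<Union>f\<in>{f \<in> F n. g \<otimes> f \<in> F n}. cylinder n f)"
        unfolding level_iff by blast
    next
      fix x assume "x \<in> (\<Union>n. \<Union>f\<in>{f \<in> F n. g \<otimes> f \<in> F n}. cylinder n f)"
      then obtain n f where "f \<in> F n" "g \<otimes> f \<in> F n" "x \<in> cylinder n f"
        by blast
      then show "x \<in> CF_dom G C F g"
        unfolding CF_dom_iff by (metis cylinderE)
    qed
    moreover have "(\<Union>f\<in>{f \<in> F n. g \<otimes> f \<in> F n}. cylinder n f) \<in> sets (CF_borel G C F)" for n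
      using finite_F cylinder_sets by (intro sets.finite_UN) auto
    ultimately show ?thesis
      by (simp add: sets.countable_UN')
  qed
  then show ?thesis
    unfolding CF_domain_def using assms one_closed
    by (intro sets.countable_INT') auto
qed

lemma haar_AE_domain:
  assumes "countable (carrier G)" "emeasure (CF_haar G C F) (X - CF_domain G C F) = 0"
  shows "AE x in CF_haar G C F. x \<in> CF_domain G C F"
  using assms(2) sets.compl_sets[OF domain_sets[OF assms(1)]]
  by (intro AE_I[of _ _ "X - CF_domain G C F"]) auto

end

section \<open>The orbit equivalence\<close>

locale cf_pair = A: cf_system G C F cs fs + B: cf_system G C' F' cs' fs'
  for G :: "('g, 'm) monoid_scheme" (structure) and C F C' F' cs fs cs' fs' +
  assumes countable_G: "countable (carrier G)"
    and null: "emeasure (CF_haar G C F) (CF_space G C F - CF_domain G C F) = 0"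
      "emeasure (CF_haar G C' F') (CF_space G C' F' - CF_domain G C' F') = 0"
    and masses: "max (emeasure (CF_haar G C F) (CF_space G C F)) (emeasure (CF_haar G C' F') (CF_space G C' F')) < \<infinity> \<or>
      min (emeasure (CF_haar G C F) (CF_space G C F)) (emeasure (CF_haar G C' F') (CF_space G C' F')) = \<infinity>"
begin

abbreviation "\<mu> \<equiv> CF_haar G C F"
abbreviation "\<mu>' \<equiv> CF_haar G C' F'"

text \<open>By the hypothesis on the masses this bit decides finiteness for both spaces; it selects
  the program.\<close>

definition finite_mass :: bool where
  "finite_mass \<longleftrightarrow> emeasure \<mu> (CF_space G C F) < \<infinity>"

definition tabs :: oracles where
  "tabs = (CF_table G cs fs, CF_table G cs' fs')"

definition Cn :: "nat \<Rightarrow> nat \<Rightarrow> 'g set" where "Cn n = (if even n then C' else C)"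
definition Fn :: "nat \<Rightarrow> nat \<Rightarrow> 'g set" where "Fn n = (if even n then F' else F)"
definition csn :: "nat \<Rightarrow> nat \<Rightarrow> 'g list" where "csn n = (if even n then cs' else cs)"
definition fsn :: "nat \<Rightarrow> nat \<Rightarrow> 'g list" where "fsn n = (if even n then fs' else fs)"

lemma period: "Cn (Suc (Suc n)) = Cn n" "Fn (Suc (Suc n)) = Fn n" "csn (Suc (Suc n)) = csn n"
  "fsn (Suc (Suc n)) = fsn n" "Cn (n + 2 * k) = Cn n" "Fn (n + 2 * k) = Fn n" "csn (n + 2 * k) = csn n"
  "fsn (n + 2 * k) = fsn n" "side tabs (n + 2 * k) = side tabs n"
  by (simp_all add: Cn_def Fn_def csn_def fsn_def side_def)

lemma system: "cf_system G (Cn n) (Fn n) (csn n) (fsn n)"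
  using A.cf_system_axioms B.cf_system_axioms by (simp add: Cn_def Fn_def csn_def fsn_def)

lemma side_tabs: "side tabs n = CF_table G (csn n) (fsn n)"
  by (simp add: side_def tabs_def csn_def fsn_def)

lemma finite_iff: "emeasure \<mu>' (CF_space G C' F') < \<infinity> \<longleftrightarrow> finite_mass"
  "emeasure (CF_haar G (Cn n) (Fn n)) (CF_space G (Cn n) (Fn n)) < \<infinity> \<longleftrightarrow> finite_mass"
proof -
  show *: "emeasure \<mu>' (CF_space G C' F') < \<infinity> \<longleftrightarrow> finite_mass"
    using masses unfolding finite_mass_def by (auto simp: max_def min_def split: if_splits)
  then show "emeasure (CF_haar G (Cn n) (Fn n)) (CF_space G (Cn n) (Fn n)) < \<infinity> \<longleftrightarrow> finite_mass"
    by (simp add: Cn_def Fn_def finite_mass_def)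
qed

sublocale stages tabs finite_mass
proof (intro stages.intro valid_tables.intro stages_axioms.intro)
  fix n
  interpret S: cf_system G "Cn n" "Fn n" "csn n" "fsn n"
    by (rule system)
  show "valid_table (side tabs n)"
    unfolding side_tabs by (rule S.table.valid_table_axioms)
next
  have "unbounded_table (side tabs n)" if "\<not> finite_mass" for n
  proof -
    interpret S: cf_system G "Cn n" "Fn n" "csn n" "fsn n"
      by (rule system)
    show ?thesis
      unfolding side_tabs using that finite_iff(2)[of n] by (intro S.mass_unbounded) (metis infinity_ennreal_def top.not_eq_extremum)
  qed
  then show "finite_mass \<or> (\<forall>n. unbounded_table (side tabs n))"
    by blast
qed

definition haar_n :: "nat \<Rightarrow> 'g CF_point measure" where
  "haar_n n = CF_haar G (Cn n) (Fn n)"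

definition cyl_n :: "nat \<Rightarrow> nat \<Rightarrow> 'g CF_point set" where
  "cyl_n n u = cf_system.cyl G (Cn n) (Fn n) (fsn n) (level n) u"

lemma level_mono: "strict_mono (\<lambda>k. level (n + 2 * k))"
  using level_less by (intro strict_monoI_Suc) simp

lemma level_cofinal: "\<exists>j\<ge>m. j \<in> range (\<lambda>k. level (n + 2 * k))"
  using strict_mono_imp_increasing[OF level_mono, of m n] by blast

lemma level_add: "level n + (level (Suc (Suc n)) - level n) = level (Suc (Suc n))"
  using level_less[of n] by simp

sublocale I: interlaced haar_n cyl_n size_F words fan "\<lambda>n. num_words (side tabs n) 0 (level n)" ext inject
proof
  fix n
  interpret S: cf_system G "Cn n" "Fn n" "csn n" "fsn n"
    by (rule system)
  note side = side_tabs[of n]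
  have cyl: "cyl_n (n + 2 * k) u = S.cyl (level (n + 2 * k)) u"
    and size: "size_F (n + 2 * k) = num_F S.tab (level (n + 2 * k))"
    and wrd: "words (n + 2 * k) = num_words S.tab (level (n + 2 * k)) (level (n + 2 * Suc k) - level (n + 2 * k))"
    and xt: "ext (n + 2 * k) = extend S.tab (level (n + 2 * k)) (level (n + 2 * Suc k) - level (n + 2 * k))" for k u
    by (simp_all add: cyl_n_def size_F_def words_def ext_def period side del: mult_Suc_right)
      (simp_all add: side period(9)[of n, unfolded side_tabs])
  have cyl0: "cyl_n n u = S.cyl (level n) u" "cyl_n (Suc (Suc n)) u = S.cyl (level (Suc (Suc n))) u" for u
    using cyl[of 0] cyl[of 1] by simp_all
  have size0: "size_F n = num_F S.tab (level n)" "size_F (Suc (Suc n)) = num_F S.tab (level (Suc (Suc n)))"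
    using size[of 0] size[of 1] by simp_all
  have wrd0: "words n = num_words S.tab (level n) (level (Suc (Suc n)) - level n)"
    and xt0: "ext n = extend S.tab (level n) (level (Suc (Suc n)) - level n)"
    using wrd[of 0] xt[of 0] by simp_all
  show "haar_n (Suc (Suc n)) = haar_n n"
    by (simp add: haar_n_def period)
  show "0 < size_F n" "0 < words n" "0 < num_words (side tabs n) 0 (level n)"
    by (simp_all add: size0 wrd0 side)
  show "0 < fan n"
    by (rule fan_pos)
  show "cyl_n n u \<in> sets (haar_n n)" if "u < size_F n" for u
    using S.cyl_sets that by (simp add: cyl0 size0 haar_n_def)
  show "\<exists>k. \<exists>u<size_F (n + 2 * k). x \<in> cyl_n (n + 2 * k) u" if "x \<in> space (haar_n n)" for x
    using S.cyl_cover[of x "range (\<lambda>k. level (n + 2 * k))", OF _ level_cofinal] that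
    unfolding haar_n_def by (auto simp: cyl size)
  show "u = v" if "u < size_F n" "v < size_F n" "x \<in> cyl_n n u" "x \<in> cyl_n n v" for u v x
    using S.cyl_disjoint that by (simp add: cyl0 size0)
  show "\<exists>b<words n. x \<in> cyl_n (Suc (Suc n)) (ext n u b)" if "u < size_F n" "x \<in> cyl_n n u" for u x
    using S.cyl_split[of u "level n" x "level (Suc (Suc n)) - level n"] that
    by (simp add: cyl0 size0 wrd0 xt0 level_add)
  show "ext n u b < size_F (Suc (Suc n))" if "u < size_F n" "b < words n" for u b
    using S.table.extend_less[of u "level n" "level (Suc (Suc n)) - level n" b] that
    by (simp add: size0 xt0 level_add)
  show "cyl_n (Suc (Suc n)) (ext n u b) \<subseteq> cyl_n n u" if "u < size_F n" "b < words n" for u b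
    using S.cyl_extend_subset[of u "level n" "level (Suc (Suc n)) - level n" b] that
    by (simp add: size0 cyl0 xt0 level_add)
  show "u = u' \<and> b = b'" if "u < size_F n" "b < words n" "u' < size_F n" "b' < words n" "ext n u b = ext n u' b'"
    for u b u' b'
    using S.table.extend_inj[of u "level n" u' b "level (Suc (Suc n)) - level n" b'] that
    by (simp add: size0 wrd0 xt0)
  show "\<exists>x. \<forall>k. x \<in> cyl_n (n + 2 * k) (f k)"
    if "\<And>k. f k < size_F (n + 2 * k)" "\<And>k. g k < words (n + 2 * k)" "\<And>k. f (Suc k) = ext (n + 2 * k) (f k) (g k)"
    for f g
    unfolding cyl
  proof (rule S.extend_limit)
    show "level (n + 2 * k) < level (n + 2 * Suc k)" for k
      using level_less[of "n + 2 * k"] by simp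
  qed (use that in \<open>simp_all only: size xt\<close>)
  show "x = y" if *: "\<And>k. \<exists>u<size_F (n + 2 * k). x \<in> cyl_n (n + 2 * k) u \<and> y \<in> cyl_n (n + 2 * k) u" for x y
  proof (rule S.cyl_separate)
    fix m
    obtain k where "m \<le> level (n + 2 * k)"
      using level_cofinal[of m n] by blast
    then show "\<exists>j\<ge>m. \<exists>u<num_F S.tab j. x \<in> S.cyl j u \<and> y \<in> S.cyl j u"
      using *[of k] by (auto simp: size cyl)
  qed
  show "emeasure (haar_n n) (cyl_n n u) = ennreal (1 / real (num_words (side tabs n) 0 (level n)))"
    if "u < size_F n" for u
    using S.emeasure_haar_cyl that by (simp add: haar_n_def cyl0 size0 side)
  show "num_words (side tabs (Suc (Suc n))) 0 (level (Suc (Suc n))) =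
      num_words (side tabs n) 0 (level n) * words n"
    using num_words_add[of S.tab 0 "level n" "level (Suc (Suc n)) - level n"] level_add[of n]
    by (simp add: wrd0 side)
  show "sets (haar_n n) = sigma_sets (space (haar_n n)) {cyl_n (n + 2 * k) u |k u. u < size_F (n + 2 * k)}"
  proof -
    have "{cyl_n (n + 2 * k) u |k u. u < size_F (n + 2 * k)} =
        {S.cyl m i | m i. m \<in> range (\<lambda>k. level (n + 2 * k)) \<and> i < num_F S.tab m}"
      unfolding cyl size by blast
    then show ?thesis
      using S.sets_CF_borel_cyl[OF level_cofinal] by (simp add: haar_n_def)
  qed
  show "inject n u d < size_F (Suc n)" if "u < size_F n" "d < fan n" for u d
    by (rule inject_less[OF that])
  show "u = u' \<and> d = d'"
    if "u < size_F n" "d < fan n" "u' < size_F n" "d' < fan n" "inject n u d = inject n u' d'" for u d u' d'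
    by (rule inject_inj[OF that])
  show "inject (Suc n) (inject n u d) d' = ext n u (d + fan n * d')"
    if "u < size_F n" "d < fan n" "d' < fan (Suc n)" for u d d'
    by (rule inject_inject[OF that])
  show "fan n * fan (Suc n) \<le> words n"
    by (rule fan_mult_le)
next
  show "summable (\<lambda>n. 1 - real (fan n * fan (Suc n)) / real (words n))"
  proof (rule summable_loss_stages)
    assume finite_mass
    then obtain b b' where "\<And>n. A.table.mass n \<le> b" "\<And>n. B.table.mass n \<le> b'"
      using A.mass_bounded B.mass_bounded finite_iff(1) unfolding finite_mass_def by blast
    then have "valid_table.mass (side tabs n) k \<le> max b b'" for n k
      by (simp add: side_def tabs_def max.coboundedI1 max.coboundedI2)
    then show "\<exists>B. \<forall>n k. valid_table.mass (side tabs n) k \<le> B"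
      by blast
  qed
qed

text \<open>In \<open>I\<close> the second space comes first, so its relation reads
  \<open>I.match y x\<close>. After the shift the first space comes first: \<open>S.partner\<close>
  leads from the first space to the second, and \<open>I.partner\<close> back.\<close>

sublocale S: interlaced "\<lambda>n. haar_n (Suc n)" "\<lambda>n. cyl_n (Suc n)" "\<lambda>n. size_F (Suc n)" "\<lambda>n. words (Suc n)"
    "\<lambda>n. fan (Suc n)" "\<lambda>n. num_words (side tabs (Suc n)) 0 (level (Suc n))" "\<lambda>n. ext (Suc n)" "\<lambda>n. inject (Suc n)"
  by (rule I.shift)

lemma haar_0 [simp]: "haar_n 0 = \<mu>'" and haar_1 [simp]: "haar_n (Suc 0) = \<mu>"
  by (simp_all add: haar_n_def Cn_def Fn_def)

lemma haar_2 [simp]: "haar_n (Suc (Suc 0)) = \<mu>'"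
  by (simp add: haar_n_def Cn_def Fn_def)

abbreviation "act_dom \<equiv> CF_domain G C F"
abbreviation "act_dom' \<equiv> CF_domain G C' F'"

definition Y :: "'g CF_point set" where "Y = {x \<in> act_dom. \<exists>y\<in>act_dom'. I.match y x}"
definition Y' :: "'g CF_point set" where "Y' = {y \<in> act_dom'. \<exists>x\<in>act_dom. I.match y x}"

abbreviation "\<phi> \<equiv> S.partner"

lemma S_match: "S.match x y \<longleftrightarrow> I.match y x"
  by (rule I.match_swap)

lemma phi_match: "I.match y x \<longleftrightarrow> x \<in> S.good \<and> \<phi> x = y"
  using S.match_iff S_match by blast

lemma Y_sets: "Y \<in> sets (CF_borel G C F)" "AE x in \<mu>. x \<in> Y"
  and Y'_sets: "Y' \<in> sets (CF_borel G C' F')" "AE y in \<mu>'. y \<in> Y'"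
proof -
  note act_dom = A.domain_sets[OF countable_G] A.haar_AE_domain[OF countable_G null(1)]
  note act_dom' = B.domain_sets[OF countable_G] B.haar_AE_domain[OF countable_G null(2)]
  show "Y \<in> sets (CF_borel G C F)" "AE x in \<mu>. x \<in> Y"
    using S.match_both_sets[of act_dom act_dom', unfolded One_nat_def haar_1 haar_2 S_match] act_dom act_dom'
    by (simp_all add: Y_def)
  show "Y' \<in> sets (CF_borel G C' F')" "AE y in \<mu>'. y \<in> Y'"
    using I.match_both_sets[of act_dom' act_dom, unfolded One_nat_def haar_0 haar_1] act_dom act_dom'
    by (simp_all add: Y'_def)
qed

lemma tail_1: "I.tail 1 x x' \<longleftrightarrow> A.index_tail (\<lambda>k. level (1 + 2 * k)) x x'"
  by (simp add: I.tail_def A.index_tail_def size_F_def words_def cyl_n_def ext_def Cn_def Fn_def fsn_def csn_def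
      side_tabs)

lemma tail_0: "I.tail 0 y y' \<longleftrightarrow> B.index_tail (\<lambda>k. level (2 * k)) y y'"
  by (simp add: I.tail_def B.index_tail_def size_F_def words_def cyl_n_def ext_def Cn_def Fn_def fsn_def csn_def
      side_tabs)

text \<open>Orbits are turned into tail classes of the first space, matched with tail classes of the
  second one, and turned back into orbits.\<close>

lemma orbit_forward:
  assumes "I.match y x" "x \<in> act_dom" "x2 \<in> CF_orbit G C F x"
  shows "\<exists>y2. I.match y2 x2 \<and> y2 \<in> CF_orbit G C' F' y"
proof -
  have "I.tail 1 x x2"
    unfolding tail_1 using level_less by (intro A.orbit_index_tail assms) simp
  then obtain y2 where "I.match y2 x2" "I.tail 0 y y2"
    using I.match_tail'[OF assms(1)] by blast
  moreover have "y2 \<in> CF_orbit G C' F' y"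
    using \<open>I.tail 0 y y2\<close> level_less unfolding tail_0
    by (intro B.index_tail_orbit[of "\<lambda>k. level (2 * k)"]) simp_all
  ultimately show ?thesis
    by blast
qed

lemma orbit_backward:
  assumes "I.match y x" "y \<in> act_dom'" "y2 \<in> CF_orbit G C' F' y"
  shows "\<exists>x2. I.match y2 x2 \<and> x2 \<in> CF_orbit G C F x"
proof -
  have "I.tail 0 y y2"
    unfolding tail_0 using level_less by (intro B.orbit_index_tail assms) simp
  then obtain x2 where "I.match y2 x2" "I.tail 1 x x2"
    using I.match_tail[OF assms(1)] by blast
  moreover have "x2 \<in> CF_orbit G C F x"
    using \<open>I.tail 1 x x2\<close> level_less unfolding tail_1
    by (intro A.index_tail_orbit[of "\<lambda>k. level (1 + 2 * k)"]) simp_all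
  ultimately show ?thesis
    by blast
qed

section \<open>Invariance of the two sets and properties of the map\<close>

lemma Y_orbit: "x \<in> Y \<Longrightarrow> x2 \<in> CF_orbit G C F x \<Longrightarrow> x2 \<in> Y"
  using orbit_forward A.orbit_in_domain B.orbit_in_domain unfolding Y_def by blast

lemma Y'_orbit: "y \<in> Y' \<Longrightarrow> y2 \<in> CF_orbit G C' F' y \<Longrightarrow> y2 \<in> Y'"
  using orbit_backward A.orbit_in_domain B.orbit_in_domain unfolding Y'_def by blast

lemma conull_Y: "conull_invariant G C F Y"
proof -
  have "emeasure \<mu> (CF_space G C F - Y) = 0"
    using Y_sets AE_iff_measurable[of "CF_space G C F - Y" \<mu> "\<lambda>x. x \<in> Y"] sets.compl_sets[of Y \<mu>] by auto
  moreover have "Y \<subseteq> act_dom"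
    by (auto simp: Y_def)
  moreover have "CF_act G C F g ` Y = Y" if "g \<in> carrier G" for g
    using \<open>Y \<subseteq> act_dom\<close> Y_orbit that by (rule A.act_image)
  ultimately show ?thesis
    unfolding conull_invariant_def using Y_sets(1) by blast
qed

lemma conull_Y': "conull_invariant G C' F' Y'"
proof -
  have "emeasure \<mu>' (CF_space G C' F' - Y') = 0"
    using Y'_sets AE_iff_measurable[of "CF_space G C' F' - Y'" \<mu>' "\<lambda>y. y \<in> Y'"] sets.compl_sets[of Y' \<mu>'] by auto
  moreover have "Y' \<subseteq> act_dom'"
    by (auto simp: Y'_def)
  moreover have "CF_act G C' F' g ` Y' = Y'" if "g \<in> carrier G" for g
    using \<open>Y' \<subseteq> act_dom'\<close> Y'_orbit that by (rule B.act_image)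
  ultimately show ?thesis
    unfolding conull_invariant_def using Y'_sets(1) by blast
qed

lemma phi_Y: "x \<in> Y \<Longrightarrow> \<phi> x \<in> Y' \<and> I.match (\<phi> x) x"
proof -
  assume "x \<in> Y"
  then obtain y where y: "x \<in> act_dom" "y \<in> act_dom'" "I.match y x"
    unfolding Y_def by blast
  then have "\<phi> x = y"
    by (simp add: phi_match)
  with y show ?thesis
    unfolding Y'_def by blast
qed

lemma phi_inverse: "y \<in> Y' \<Longrightarrow> I.partner y \<in> Y \<and> \<phi> (I.partner y) = y"
proof -
  assume "y \<in> Y'"
  then obtain x where x: "x \<in> act_dom" "y \<in> act_dom'" "I.match y x"
    unfolding Y'_def by blast
  have "\<phi> x = y"
    using x(3) unfolding phi_match by blast
  moreover have "I.partner y = x"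
    using x(3) unfolding I.match_iff by blast
  moreover have "x \<in> Y"
    using x unfolding Y_def by blast
  ultimately show ?thesis
    by simp
qed

lemma bij_phi: "bij_betw \<phi> Y Y'"
  by (rule bij_betw_byWitness[where f' = I.partner])
    (use phi_Y phi_inverse I.match_iff in auto)

lemma phi_measurable:
  "\<phi> \<in> restrict_space (CF_borel G C F) Y \<rightarrow>\<^sub>M restrict_space (CF_borel G C' F') Y'"
proof (rule measurable_restrict_space3)
  show "\<phi> \<in> CF_borel G C F \<rightarrow>\<^sub>M CF_borel G C' F'"
    using S.partner_measurable by (simp cong: measurable_cong_sets)
qed (use phi_Y in auto)

text \<open>On \<open>Y'\<close> the inverse is again a partner map, the one of the unshifted
  system.\<close>

lemma inverse_measurable:
  "the_inv_into Y \<phi> \<in> restrict_space (CF_borel G C' F') Y' \<rightarrow>\<^sub>M restrict_space (CF_borel G C F) Y"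
proof -
  have "I.partner \<in> restrict_space (CF_borel G C' F') Y' \<rightarrow>\<^sub>M restrict_space (CF_borel G C F) Y"
  proof (rule measurable_restrict_space3)
    show "I.partner \<in> CF_borel G C' F' \<rightarrow>\<^sub>M CF_borel G C F"
      using I.partner_measurable by (simp cong: measurable_cong_sets)
  qed (use phi_inverse in auto)
  moreover have "the_inv_into Y \<phi> y = I.partner y" if "y \<in> Y'" for y
    using that phi_inverse bij_phi by (intro the_inv_into_f_eq) (auto simp: bij_betw_def)
  ultimately show ?thesis
    by (subst measurable_cong) (auto simp: space_restrict_space)
qed

lemma emeasure_phi:
  assumes "B \<in> sets (CF_borel G C F)" "B \<subseteq> Y"
  shows "emeasure \<mu>' (\<phi> ` B) = ennreal I.ratio * emeasure \<mu> B"
proof -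
  have "I.match y x \<longleftrightarrow> \<phi> x = y" if "x \<in> B" for x y
    using phi_Y[of x] assms(2) that by (auto simp: phi_match)
  then have "\<phi> ` B = {y. \<exists>x\<in>B. I.match y x}"
    by blast
  then show ?thesis
    using I.emeasure_matched[of B] assms(1) by simp
qed

text \<open>The proportionality is applied to the whole first space, whose set of partners is conull
  in the second.\<close>

lemma ratio_finite:
  assumes "max (emeasure \<mu> (CF_space G C F)) (emeasure \<mu>' (CF_space G C' F')) < \<infinity>"
  shows "I.ratio = measure \<mu>' (CF_space G C' F') / measure \<mu> (CF_space G C F)"
proof -
  have "emeasure \<mu>' {y. \<exists>x\<in>CF_space G C F. I.match y x} = ennreal I.ratio * emeasure \<mu> (CF_space G C F)"
    using I.emeasure_matched[of "CF_space G C F"] sets.top[of \<mu>] by simp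
  also have "{y. \<exists>x\<in>CF_space G C F. I.match y x} = I.good"
    using I.match_in_space(2) unfolding I.good_def by auto
  also have "emeasure \<mu>' I.good = emeasure \<mu>' (CF_space G C' F')"
    using I.AE_good[unfolded haar_0] I.good_sets sets.top[of \<mu>'] by (intro emeasure_eq_AE) auto
  finally have "measure \<mu>' (CF_space G C' F') = I.ratio * measure \<mu> (CF_space G C F)"
    using I.ratio_pos by (simp add: measure_def enn2real_mult)
  moreover have "measure \<mu> (CF_space G C F) > 0"
  proof -
    have "ennreal (A.table.mass 0) \<le> emeasure \<mu> (CF_space G C F)"
      unfolding A.haar_X_mass by (rule SUP_upper) simp
    moreover have "0 < ennreal (A.table.mass 0)"
      using A.table.mass_ge_1[of 0] by simp
    ultimately have "0 < emeasure \<mu> (CF_space G C F)"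
      by (rule less_le_trans[rotated])
    moreover have "emeasure \<mu> (CF_space G C F) < \<infinity>"
      using assms unfolding max_less_iff_conj by blast
    ultimately show ?thesis
      by (simp add: measure_def enn2real_positive_iff)
  qed
  ultimately show ?thesis
    by simp
qed

lemma orbit_phi:
  assumes x: "x \<in> Y"
  shows "\<phi> ` CF_orbit G C F x = CF_orbit G C' F' (\<phi> x)"
proof -
  have m: "I.match (\<phi> x) x" "x \<in> act_dom" "\<phi> x \<in> act_dom'"
    using phi_Y[OF x] x by (auto simp: Y_def Y'_def)
  have phi: "\<phi> x2 = y2" if "I.match y2 x2" for x2 y2
    using that unfolding phi_match by blast
  show ?thesis
  proof (intro equalityI subsetI)
    fix y2 assume "y2 \<in> \<phi> ` CF_orbit G C F x"
    then show "y2 \<in> CF_orbit G C' F' (\<phi> x)"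
      using orbit_forward[OF m(1,2)] phi by force
  next
    fix y2 assume "y2 \<in> CF_orbit G C' F' (\<phi> x)"
    then obtain x2 where "I.match y2 x2" "x2 \<in> CF_orbit G C F x"
      using orbit_backward[OF m(1,3)] by blast
    then show "y2 \<in> \<phi> ` CF_orbit G C F x"
      using phi[of y2 x2] by blast
  qed
qed

text \<open>Each stage offers its own \<open>u\<close> and \<open>d\<close>. That consecutive
  choices fit together is automatic, as cylinders of one level are disjoint.\<close>

lemma stages_match_iff:
  "stages_match G C F fs C' F' fs' (stage finite_mass tabs) x y \<longleftrightarrow> I.match y x"
proof -
  define pt where "pt n = (if even n then y else x)" for n :: nat
  let ?linked = "\<lambda>n u d. u < size_F n \<and> d < fan n \<and> pt n \<in> cyl_n n u \<and> pt (Suc n) \<in> cyl_n (Suc n) (inject n u d)"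
  have "(case stage_decode (stage finite_mass tabs n) of (k, l, R) \<Rightarrow>
        \<exists>(i, j)\<in>R. x \<in> CF_cylinder G C F k (fs k ! i) \<and> y \<in> CF_cylinder G C' F' l (fs' l ! j)) \<longleftrightarrow>
      (\<exists>u d. ?linked n u d)" for n
    unfolding stage_decode_stage links_def pt_def cyl_n_def
    by (auto simp: A.cyl_def B.cyl_def Cn_def Fn_def fsn_def)
  then have "stages_match G C F fs C' F' fs' (stage finite_mass tabs) x y \<longleftrightarrow>
      (\<exists>m. \<forall>n\<ge>m. \<exists>u d. ?linked n u d)"
    unfolding stages_match_def eventually_sequentially by simp
  also have "\<dots> \<longleftrightarrow> I.match y x"
  proof
    assume "\<exists>m. \<forall>n\<ge>m. \<exists>u d. ?linked n u d"
    then obtain m where "\<forall>n\<ge>m. \<exists>u d. ?linked n u d"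
      by blast
    then obtain u d where ud: "\<And>n. m \<le> n \<Longrightarrow> ?linked n (u n) (d n)"
      by metis
    \<comment> \<open>Both positions name the cylinder of stage \<open>n + 1\<close> around the same
      point.\<close>
    have "u (Suc n) = inject n (u n) (d n)" if "m \<le> n" for n
      using ud[OF that] ud[of "Suc n"] that inject_less[of "u n" n "d n"]
      by (intro I.cy_disjoint[of _ "Suc n" _ "pt (Suc n)"]) auto
    then have "I.thread m u d"
      unfolding I.thread_def using ud by blast
    then show "I.match y x"
      unfolding I.match_def using ud unfolding pt_def by blast
  next
    assume "I.match y x"
    then obtain m v \<delta> where *: "I.thread m v \<delta>" "\<And>n. m \<le> n \<Longrightarrow> (if even n then y else x) \<in> cyl_n n (v n)"
      unfolding I.match_def by blast
    have "?linked n (v n) (\<delta> n)" if "m \<le> n" for n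
      using *(1)[unfolded I.thread_def, rule_format, OF that] *(2)[OF that] *(2)[of "Suc n"] that
      unfolding pt_def by simp
    then show "\<exists>m. \<forall>n\<ge>m. \<exists>u d. ?linked n u d"
      by blast
  qed
  finally show ?thesis .
qed

lemma explicit:
  assumes p: "\<And>n. evaluates (CF_table G cs fs) (CF_table G cs' fs') p n (stage finite_mass tabs n)"
  shows "explicitly_constructed p G C F cs fs C' F' cs' fs' Y Y' \<phi>"
  unfolding explicitly_constructed_def
proof (intro exI[of _ "stage finite_mass tabs"] conjI allI p)
  fix n
  have sub: "links n \<subseteq> {..<size_F n} \<times> {..<size_F (Suc n)}"
    unfolding links_def using inject_less by auto
  have sv: "single_valued ((links n)\<inverse>)"
    unfolding links_def single_valued_def using inject_inj by fastforce
  have size: "size_F k = length (if even k then fs' (level k) else fs (level k))" for k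
    by (simp add: size_F_def side_tabs csn_def fsn_def A.num_F_tab B.num_F_tab)
  show "case stage_decode (stage finite_mass tabs n) of (k, l, R) \<Rightarrow>
      R \<subseteq> {..<length (fs k)} \<times> {..<length (fs' l)} \<and>
      (if even n then single_valued R else single_valued (R\<inverse>))"
    unfolding stage_decode_stage using sub sv size[of n] size[of "Suc n"] by auto
next
  show "Y = {x \<in> act_dom. \<exists>y\<in>act_dom'. stages_match G C F fs C' F' fs' (stage finite_mass tabs) x y}"
    unfolding stages_match_iff Y_def ..
  show "Y' = {y \<in> act_dom'. \<exists>x\<in>act_dom. stages_match G C F fs C' F' fs' (stage finite_mass tabs) x y}"
    unfolding stages_match_iff Y'_def ..
  show "\<forall>x\<in>Y. \<forall>y\<in>Y'. \<phi> x = y \<longleftrightarrow> stages_match G C F fs C' F' fs' (stage finite_mass tabs) x y"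
    unfolding stages_match_iff using phi_Y by (auto simp: phi_match)
qed

end

theorem theoremA:
  fixes G :: "('g, 'm) monoid_scheme"
  assumes "group G" and "countable (carrier G)" and "infinite (carrier G)"
  shows "\<exists>P :: bool \<Rightarrow> program.
    \<forall>C F C' F' cs fs cs' fs'.
      CF_sequence G C F \<longrightarrow> CF_sequence G C' F' \<longrightarrow>
      CF_enumeration C F cs fs \<longrightarrow> CF_enumeration C' F' cs' fs' \<longrightarrow>
      (let X = CF_space G C F; \<mu> = CF_haar G C F;
           X' = CF_space G C' F'; \<mu>' = CF_haar G C' F' in
        emeasure \<mu> (X - CF_domain G C F) = 0 \<longrightarrow>
        emeasure \<mu>' (X' - CF_domain G C' F') = 0 \<longrightarrow>
        max (emeasure \<mu> X) (emeasure \<mu>' X') < \<infinity> \<or> min (emeasure \<mu> X) (emeasure \<mu>' X') = \<infinity> \<longrightarrow>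
        (\<exists>Y Y' \<phi> (c::real).
          conull_invariant G C F Y \<and> conull_invariant G C' F' Y' \<and>
          bij_betw \<phi> Y Y' \<and>
          \<phi> \<in> restrict_space (CF_borel G C F) Y \<rightarrow>\<^sub>M restrict_space (CF_borel G C' F') Y' \<and>
          the_inv_into Y \<phi> \<in> restrict_space (CF_borel G C' F') Y' \<rightarrow>\<^sub>M restrict_space (CF_borel G C F) Y \<and>
          c > 0 \<and>
          (\<forall>A\<in>sets (CF_borel G C F). A \<subseteq> Y \<longrightarrow> emeasure \<mu>' (\<phi> ` A) = ennreal c * emeasure \<mu> A) \<and>
          (\<forall>x\<in>Y. \<phi> ` CF_orbit G C F x = CF_orbit G C' F' (\<phi> x)) \<and>
          (max (emeasure \<mu> X) (emeasure \<mu>' X') < \<infinity> \<longrightarrow> c = measure \<mu>' X' / measure \<mu> X) \<and>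
          explicitly_constructed (P (emeasure \<mu> X < \<infinity>)) G C F cs fs C' F' cs' fs' Y Y' \<phi>))"
proof -
  \<comment> \<open>For each bit one program serves all admissible oracle pairs, so it can be chosen
    before the sequences and their enumerations are given.\<close>
  have "\<exists>p. \<forall>t\<in>{t. stages t b}. \<forall>n. evaluates (fst t) (snd t) p n (stage b t n)" for b
    using stage_computation.computable_stage[of b "{t. stages t b}"]
    unfolding computable_def stage_computation_def by blast
  then obtain P where P: "\<And>b t n. stages t b \<Longrightarrow> evaluates (fst t) (snd t) (P b) n (stage b t n)"
    by (metis mem_Collect_eq)
  show ?thesis
    unfolding Let_def
  proof (rule exI[of _ P], intro allI impI, goal_cases)
    case (1 C F C' F' cs fs cs' fs')
    interpret cf_pair G C F C' F' cs fs cs' fs'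
      by (intro cf_pair.intro cf_system.intro cf_system_axioms.intro cf_pair_axioms.intro) (use assms 1 in auto)
    have "explicitly_constructed (P (emeasure \<mu> (CF_space G C F) < \<infinity>)) G C F cs fs C' F' cs' fs' Y Y' \<phi>"
      using P[OF stages_axioms] unfolding finite_mass_def[symmetric] by (intro explicit) (simp add: tabs_def)
    then show ?case
      using conull_Y conull_Y' bij_phi phi_measurable inverse_measurable I.ratio_pos emeasure_phi orbit_phi ratio_finite
      by (intro exI[of _ Y] exI[of _ Y'] exI[of _ \<phi>] exI[of _ I.ratio] conjI ballI impI)
  qed
qed

end
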